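(* Let $\Omega$ be a bounded domain of the hyperbolic space $\mathbb{H}^n$ and let $0<\lambda_1\le\lambda_2\le\cdots\to+\infty$ be the eigenvalues of the clamped plate problem $$\Delta^2u=\lambda u\ \text{ in }\Omega,\qquad u=\frac{\partial u}{\partial\nu}=0\ \text{ on }\partial\Omega .$$ Then for any $k\ge1$ such that $\lambda_{k+1}>\lambda_k$ and for any couple $(f,g)\in\Im_{\lambda_{k+1}}$, $$\sum_{i=1}^k f(\lambda_i)\le\left[\sum_{i=1}^k g(\lambda_i)\Big(6\lambda_i^{1/2}-(n-1)^2\Big)\right]^{1/2}\left[\sum_{i=1}^k\frac{f(\lambda_i)^2}{g(\lambda_i)(\lambda_{k+1}-\lambda_i)}\Big(4\lambda_i^{1/2}-(n-1)^2\Big)\right]^{1/2}.$$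
   Context: $\mathbb{H}^n$ is the hyperbolic space in the half-space model $\{x=(x_1,\dots,x_n)\in\mathbb{R}^n: x_n>0\}$ with metric $ds^2=\frac{dx_1^2+\cdots+dx_n^2}{x_n^2}$. Its Laplacian is $\Delta=x_n^2\sum_{j=1}^n\frac{\partial^2}{\partial x_j^2}+(2-n)x_n\frac{\partial}{\partial x_n}$; $\Delta^2$ is the biharmonic operator and $\nu$ the outward unit normal to $\partial\Omega$. It is taken as well known that the eigenvalues of the clamped plate problem on the bounded domain $\Omega$, repeated according to multiplicity, form a countable family $0<\lambda_1\le\lambda_2\le\cdots\to+\infty$. For $\lambda>0$, $\Im_\lambda$ is the set of couples $(f,g)$ of functions defined on the open interval $(0,\lambda)$ such that: (1) $f$ and $g$ are positive; (2) for all $x,y\in(0,\lambda)$ with $x\ne y$, $$\left(\frac{f(x)-f(y)}{x-y}\right)^2+\left(\frac{f(x)^2}{g(x)(\lambda-x)}+\frac{f(y)^2}{g(y)(\lambda-y)}\right)\left(\frac{g(x)-g(y)}{x-y}\right)\le0 .$$ *)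

theory Defs
  imports "HOL-Analysis.Analysis"
begin

text \<open>
  The space \<open>H\<^sup>n\<close> is modelled on \<open>real ^ 'n\<close> with \<open>n = CARD('n)\<close>. The index \<open>p :: 'n\<close>
  singles out the coordinate that is positive on the half-space (the \<open>x\<^sub>n\<close> of the usual
  notation); all definitions take it as a parameter.
\<close>

definition hyp_space :: "'n::finite \<Rightarrow> (real ^ 'n) set" where
  "hyp_space p = {x. 0 < x $ p}"

text \<open>Closed form of the Riemannian distance of \<open>(dx\<^sub>1\<^sup>2 + \<dots> + dx\<^sub>n\<^sup>2) / x\<^sub>n\<^sup>2\<close> on the half-space.\<close>

definition hyp_dist :: "'n::finite \<Rightarrow> real ^ 'n \<Rightarrow> real ^ 'n \<Rightarrow> real" where
  "hyp_dist p x y = arcosh (1 + (dist x y)\<^sup>2 / (2 * x $ p * y $ p))"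

text \<open>
  Boundedness refers to the hyperbolic metric, so a bounded domain stays away from the
  ideal boundary \<open>x\<^sub>n = 0\<close>. No regularity of the boundary is assumed.
\<close>

definition bounded_hyp_domain :: "'n::finite \<Rightarrow> (real ^ 'n) set \<Rightarrow> bool" where
  "bounded_hyp_domain p \<Omega> \<longleftrightarrow>
     \<Omega> \<noteq> {} \<and> open \<Omega> \<and> connected \<Omega> \<and> \<Omega> \<subseteq> hyp_space p \<and>
     (\<exists>r. \<forall>x\<in>\<Omega>. \<forall>y\<in>\<Omega>. hyp_dist p x y \<le> r)"

definition partial_deriv :: "'n::finite \<Rightarrow> (real ^ 'n \<Rightarrow> real) \<Rightarrow> real ^ 'n \<Rightarrow> real" where
  "partial_deriv j u x = frechet_derivative u (at x) (axis j 1)"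

primrec iter_partial :: "'n::finite list \<Rightarrow> (real ^ 'n \<Rightarrow> real) \<Rightarrow> real ^ 'n \<Rightarrow> real" where
  "iter_partial [] u = u"
| "iter_partial (j # js) u = partial_deriv j (iter_partial js u)"

definition hyp_laplacian :: "'n::finite \<Rightarrow> (real ^ 'n \<Rightarrow> real) \<Rightarrow> real ^ 'n \<Rightarrow> real" where
  "hyp_laplacian p u x =
     (x $ p)\<^sup>2 * (\<Sum>j\<in>UNIV. partial_deriv j (partial_deriv j u) x)
     + (2 - real CARD('n)) * x $ p * partial_deriv p u x"

definition hyp_volume :: "'n::finite \<Rightarrow> (real ^ 'n) set \<Rightarrow> (real ^ 'n) measure" where
  "hyp_volume p \<Omega> = density (restrict_space lborel \<Omega>) (\<lambda>x. ennreal (1 / (x $ p) ^ CARD('n)))"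

text \<open>
  The space of smooth functions with compact support in \<open>\<Omega>\<close>, extended by zero. A function
  is smooth if and only if all its iterated partial derivatives exist and are (totally)
  differentiable.
\<close>

definition test_functions :: "(real ^ 'n::finite) set \<Rightarrow> (real ^ 'n \<Rightarrow> real) set" where
  "test_functions \<Omega> =
     {\<phi>. (\<forall>js. iter_partial js \<phi> differentiable_on UNIV) \<and>
         compact (closure {x. \<phi> x \<noteq> 0}) \<and> closure {x. \<phi> x \<noteq> 0} \<subseteq> \<Omega>}"

definition L2_space :: "'n::finite \<Rightarrow> (real ^ 'n) set \<Rightarrow> (real ^ 'n \<Rightarrow> real) set" where
  "L2_space p \<Omega> =
     {u. u \<in> borel_measurable (hyp_volume p \<Omega>) \<and> integrable (hyp_volume p \<Omega>) (\<lambda>x. (u x)\<^sup>2)}"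

text \<open>
  The Sobolev space \<open>H\<^sup>2\<^sub>0(\<Omega>)\<close>, the closure of the test functions for the norm made of all
  partial derivatives of order at most two; \<open>v js\<close> is the weak derivative of \<open>u\<close>
  along \<open>js\<close>. On a bounded domain the factor \<open>x\<^sub>n\<close> lies between positive constants,
  so coordinate derivatives give the same space as covariant ones.
\<close>

definition H20_space :: "'n::finite \<Rightarrow> (real ^ 'n) set \<Rightarrow> (real ^ 'n \<Rightarrow> real) set" where
  "H20_space p \<Omega> =
     {u. \<exists>\<phi> v. (\<forall>m::nat. \<phi> m \<in> test_functions \<Omega>) \<and> v [] = u \<and>
           (\<forall>js. length js \<le> 2 \<longrightarrow>
              v js \<in> L2_space p \<Omega> \<and>
              (\<lambda>m. \<integral>x. (iter_partial js (\<phi> m) x - v js x)\<^sup>2 \<partial>hyp_volume p \<Omega>) \<longlonglongrightarrow> 0)}"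

text \<open>
  The solutions (including zero) of \<open>\<Delta>\<^sup>2 u = \<mu> u\<close> in \<open>\<Omega>\<close>, \<open>u = \<partial>u/\<partial>\<nu> = 0\<close> on \<open>\<partial>\<Omega>\<close>.
  Since \<open>\<Omega>\<close> is an arbitrary bounded domain, the boundary conditions mean membership
  in \<open>H\<^sup>2\<^sub>0(\<Omega>)\<close> and the equation holds in the sense of distributions with respect to the
  Riemannian volume, for which \<open>\<Delta>\<close> is formally self-adjoint.
\<close>

definition clamped_eigenspace ::
    "'n::finite \<Rightarrow> (real ^ 'n) set \<Rightarrow> real \<Rightarrow> (real ^ 'n \<Rightarrow> real) set" where
  "clamped_eigenspace p \<Omega> \<mu> =
     {u \<in> H20_space p \<Omega>. \<forall>\<phi>\<in>test_functions \<Omega>.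
        (\<integral>x. u x * hyp_laplacian p (hyp_laplacian p \<phi>) x \<partial>hyp_volume p \<Omega>)
        = \<mu> * (\<integral>x. u x * \<phi> x \<partial>hyp_volume p \<Omega>)}"

text \<open>
  The eigenspace of \<open>\<mu>\<close>, with functions identified when equal almost everywhere, has a
  basis of \<open>m\<close> elements; \<open>m = 0\<close> means that \<open>\<mu>\<close> is not an eigenvalue.
\<close>

definition has_multiplicity :: "'n::finite \<Rightarrow> (real ^ 'n) set \<Rightarrow> real \<Rightarrow> nat \<Rightarrow> bool" where
  "has_multiplicity p \<Omega> \<mu> m \<longleftrightarrow>
     (\<exists>e. (\<forall>i<m. e i \<in> clamped_eigenspace p \<Omega> \<mu>) \<and>
          (\<forall>c. (AE x in hyp_volume p \<Omega>. (\<Sum>i<m. c i * e i x) = 0) \<longrightarrow> (\<forall>i<m. c i = 0)) \<and>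
          (\<forall>u\<in>clamped_eigenspace p \<Omega> \<mu>.
             \<exists>c. AE x in hyp_volume p \<Omega>. u x = (\<Sum>i<m. c i * e i x)))"

text \<open>
  \<open>lam 1 \<le> lam 2 \<le> \<dots>\<close> lists all eigenvalues, each repeated according to its multiplicity;
  \<open>lam 0\<close> is not used. These conditions determine \<open>lam i\<close> for all \<open>i \<ge> 1\<close>.
\<close>

definition clamped_plate_eigenvalues ::
    "'n::finite \<Rightarrow> (real ^ 'n) set \<Rightarrow> (nat \<Rightarrow> real) \<Rightarrow> bool" where
  "clamped_plate_eigenvalues p \<Omega> lam \<longleftrightarrow>
     (\<forall>i\<ge>1. 0 < lam i) \<and> mono_on {1..} lam \<and> filterlim lam at_top sequentially \<and>
     (\<forall>\<mu>. has_multiplicity p \<Omega> \<mu> (card {i. 1 \<le> i \<and> lam i = \<mu>}))"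

text \<open>Only the values of \<open>f\<close> and \<open>g\<close> on the open interval from \<open>0\<close> to \<open>l\<close> matter.\<close>

definition Im_class :: "real \<Rightarrow> ((real \<Rightarrow> real) \<times> (real \<Rightarrow> real)) set" where
  "Im_class l =
     {(f, g). (\<forall>x\<in>{0<..<l}. 0 < f x \<and> 0 < g x) \<and>
        (\<forall>x\<in>{0<..<l}. \<forall>y\<in>{0<..<l}. x \<noteq> y \<longrightarrow>
           ((f x - f y) / (x - y))\<^sup>2
           + ((f x)\<^sup>2 / (g x * (l - x)) + (f y)\<^sup>2 / (g y * (l - y))) * ((g x - g y) / (x - y)) \<le> 0)}"

end

theory Submission
  imports Defs "HOL-Library.Function_Algebras"
begin

text \<open>
  Let \<open>F = ln x\<^sub>n\<close> and \<open>T = [\<Delta>, F]\<close>. Since \<open>\<bar>\<nabla>F\<bar> = 1\<close> and \<open>\<Delta>F = 1 - n\<close> are constant, \<open>[T, F] = 2\<close>,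
  \<open>\<parallel>T u\<parallel>\<^sup>2 \<le> 4 \<integral>\<bar>\<nabla>u\<bar>\<^sup>2 - (n - 1)\<^sup>2 \<parallel>u\<parallel>\<^sup>2\<close> and
  \<open>\<parallel>\<Delta>(F u)\<parallel>\<^sup>2 - (\<Delta>u, \<Delta>(F\<^sup>2 u)) = \<parallel>T u\<parallel>\<^sup>2 + 2 \<integral>\<bar>\<nabla>u\<bar>\<^sup>2\<close>, while \<open>\<integral>\<bar>\<nabla>u\<bar>\<^sup>2 \<le> \<lambda>\<^sup>1\<^sup>/\<^sup>2\<close> for a normalized
  eigenfunction. Following Ilias and Makhoul, one projects \<open>F u\<^sub>i\<close> off the first \<open>k\<close> eigenfunctions, inserts
  the result into the variational characterization of \<open>\<lambda>\<^sub>k\<^sub>+\<^sub>1\<close>, pairs it with \<open>T u\<^sub>i\<close>, and sums with weights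
  \<open>f\<close> and \<open>g\<close>; the inequality defining the class of couples makes the off-diagonal terms harmless.

  All this takes place in the \<open>L\<^sup>2\<close>-closure of the graph of \<open>\<Delta>\<close> on test functions. The variational
  characterization holds because an infimum of the Rayleigh quotient below \<open>\<lambda>\<^sub>k\<^sub>+\<^sub>1\<close> would be
  attained, by Rellich compactness, at an eigenfunction orthogonal to those already listed; the
  elliptic estimate places this minimizer in \<open>H\<^sup>2\<^sub>0(\<Omega>)\<close>.
\<close>

section \<open>Semi-Hilbert spaces\<close>

text \<open>Neither the boundary nor the eigenfunctions are known to be regular, so identities such
  as [T, F] = 2 are computed on test functions only and carried to eigenfunctions by limits in mean.
  This works because F is a bounded multiplication (hyperbolic boundedness keeps x_n between
  positive constants) and T is bounded in the graph norm of the Laplacian. Functions equal almost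
  everywhere are not identified: the abstract part uses a semidefinite inner product, and limits are
  unique only up to null vectors. The eigenvalue list enters through its multiplicities alone: they
  make orthonormal eigenvectors fill every eigenspace below \<open>lam (k + 1)\<close>. The bound on
  T costs 4 times the Dirichlet integral, and the excess energy of the trial vector adds 2 more;
  hence the constants 4 and 6. The product of square roots arises from AM-GM with one parameter
  \<alpha> common to all indices, optimized only after summation; being common, it lets the
  off-diagonal terms of rows i and j be combined.\<close>

lemma quadratic_nonneg_imp_zero:
  fixes a b :: real
  assumes "\<And>s. 0 \<le> b * s + a * s\<^sup>2"
  shows "b = 0"
proof (rule ccontr)
  assume b: "b \<noteq> 0"
  \<comment> \<open>At s = -b/d the quadratic equals b^2/d (a/d - 1), and d exceeds a, so a nonzero
    slope b would make it negative.\<close>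
  define d where "d = 2 * (\<bar>a\<bar> + 1)"
  have d: "d > 0" by (simp add: d_def)
  have "0 \<le> b * (- b / d) + a * (- b / d)\<^sup>2" by (rule assms)
  also have "\<dots> = b\<^sup>2 / d * (a / d - 1)"
    using d by (simp add: power2_eq_square field_simps)
  finally have 1: "0 \<le> b\<^sup>2 / d * (a / d - 1)" .
  have "a / d < 1" using d by (simp add: d_def)
  then have "b\<^sup>2 / d * (a / d - 1) < 0" using b d by (intro mult_pos_neg) auto
  with 1 show False by simp
qed

text \<open>Gaussian elimination by induction on the number of equations: a nonzero entry
  \<open>a i q\<close> expresses the unknown at \<open>q\<close> through the others, and the reduced
  system still has fewer equations than unknowns. It serves as the dimension count both for finding
  a new orthogonal eigenvector and for excluding too many of them.\<close>

lemma homogeneous_system_solution: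
  fixes a :: "'i \<Rightarrow> 'j \<Rightarrow> real"
  assumes "finite I" "finite J" "card I < card J"
  shows "\<exists>c. (\<exists>j\<in>J. c j \<noteq> 0) \<and> (\<forall>i\<in>I. (\<Sum>j\<in>J. a i j * c j) = 0)"
  using assms
proof (induction I arbitrary: J a rule: finite_induct)
  case empty
  then obtain j where "j \<in> J" by fastforce
  then show ?case by (intro exI[of _ "\<lambda>_. 1"]) auto
next
  case (insert i I)
  show ?case
  proof (cases "\<forall>j\<in>J. a i j = 0")
    case True
    have "card I < card J" using insert by simp
    from insert.IH[OF insert.prems(1) this, of a] obtain c
      where "(\<exists>j\<in>J. c j \<noteq> 0) \<and> (\<forall>i\<in>I. (\<Sum>j\<in>J. a i j * c j) = 0)" by blast
    with True show ?thesis by (intro exI[of _ c]) auto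
  next
    case False
    then obtain q where q: "q \<in> J" "a i q \<noteq> 0" by blast
    define K where "K = J - {q}"
    have K: "finite K" "q \<notin> K" "J = insert q K" using q insert.prems by (auto simp: K_def)
    have "card I < card K" using insert K by simp
    from insert.IH[OF K(1) this, of "\<lambda>k j. a k j - a k q * a i j / a i q"] obtain c
      where c: "\<exists>j\<in>K. c j \<noteq> 0" "\<And>k. k \<in> I \<Longrightarrow> (\<Sum>j\<in>K. (a k j - a k q * a i j / a i q) * c j) = 0"
      by blast
    define s where "s = (\<Sum>j\<in>K. a i j * c j)"
    define d where "d = c(q := - s / a i q)"
    have dK: "(\<Sum>j\<in>K. a k j * d j) = (\<Sum>j\<in>K. a k j * c j)" for k
      by (rule sum.cong) (use K in \<open>auto simp: d_def\<close>)
    have dJ: "(\<Sum>j\<in>J. a k j * d j) = (\<Sum>j\<in>K. a k j * c j) - a k q * s / a i q" for k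
      using K by (simp add: dK) (simp add: d_def)
    have "(\<Sum>j\<in>J. a i j * d j) = 0"
      using q by (simp add: dJ s_def)
    moreover have "(\<Sum>j\<in>J. a k j * d j) = 0" if "k \<in> I" for k
    proof -
      have "(\<Sum>j\<in>K. (a k j - a k q * a i j / a i q) * c j) = (\<Sum>j\<in>K. a k j * c j) - a k q * s / a i q"
        by (simp add: s_def left_diff_distrib sum_subtractf sum_distrib_left sum_divide_distrib mult.assoc)
      with c(2)[OF that] dJ show ?thesis by simp
    qed
    moreover have "\<exists>j\<in>J. d j \<noteq> 0" using c(1) K by (auto simp: d_def)
    ultimately show ?thesis by (intro exI[of _ d]) auto
  qed
qed

text \<open>Bolzano-Weierstrass for one sequence at a time; convergence already achieved survives
  passing to a further subsequence.\<close>

lemma finite_family_convergent_subsequence: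
  fixes h :: "'q \<Rightarrow> nat \<Rightarrow> real"
  assumes "finite Q" "\<And>q. q \<in> Q \<Longrightarrow> bounded (range (h q))"
  shows "\<exists>r::nat\<Rightarrow>nat. strict_mono r \<and> (\<forall>q\<in>Q. convergent (\<lambda>m. h q (r m)))"
  using assms
proof (induction Q rule: finite_induct)
  case empty
  show ?case by (intro exI[of _ id]) (auto simp: strict_mono_def)
next
  case (insert q Q)
  then obtain r where r: "strict_mono r" "\<And>p. p \<in> Q \<Longrightarrow> convergent (\<lambda>m. h p (r m))" by blast
  have "bounded (range (h q \<circ> r))"
    using insert.prems[of q] by (rule_tac bounded_subset) auto
  then obtain l s where s: "strict_mono s" "((h q \<circ> r) \<circ> s) \<longlonglongrightarrow> l"
    using bounded_imp_convergent_subsequence by blast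
  have "convergent (\<lambda>m. h p ((r \<circ> s) m))" if "p \<in> insert q Q" for p
  proof (cases "p = q")
    case True
    with s show ?thesis by (auto simp: convergent_def o_def)
  next
    case False
    with that have "convergent (\<lambda>m. h p (r m))" using r by auto
    then have "convergent ((\<lambda>m. h p (r m)) \<circ> s)" using s(1) by (rule convergent_subseq_convergent)
    then show ?thesis by (simp add: o_def)
  qed
  with r(1) s(1) show ?case by (intro exI[of _ "r \<circ> s"]) (auto simp: strict_mono_def)
qed

text \<open>For positive \<open>W\<close> and \<open>S\<close> the choice \<alpha> = sqrt S / sqrt W
  makes both terms on the right equal to sqrt W sqrt S. If \<open>W = 0\<close> or
  \<open>S = 0\<close> this choice breaks down, and \<alpha> = \<open>S / X\<close> or
  \<open>X / W\<close> gives \<open>2 * X \<le> X\<close>, contradicting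
  \<open>X > 0\<close>.\<close>

lemma le_sqrt_mult_sqrt_if_AM_bounds:
  fixes X W S :: real
  assumes "\<And>\<alpha>. \<alpha> > 0 \<Longrightarrow> 2 * X \<le> \<alpha> * W + S / \<alpha>" "W \<ge> 0" "S \<ge> 0"
  shows "X \<le> sqrt W * sqrt S"
proof (cases "X \<le> 0")
  case True
  then show ?thesis using assms(2,3) by (meson mult_nonneg_nonneg order_trans real_sqrt_ge_zero)
next
  case False
  then have X: "X > 0" by simp
  consider "W = 0" | "S = 0" | "W > 0" "S > 0" using assms(2,3) by linarith
  then show ?thesis
  proof cases
    case 1
    then have "2 * X \<le> S" using assms(1)[of 1] by simp
    then have "S > 0" using X by simp
    with X have "2 * X \<le> X" using assms(1)[of "S / X"] 1 by simp
    with X show ?thesis by simp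
  next
    case 2
    then have "2 * X \<le> W" using assms(1)[of 1] by simp
    then have "W > 0" using X by simp
    with X have "2 * X \<le> X" using assms(1)[of "X / W"] 2 by simp
    with X show ?thesis by simp
  next
    case 3
    define s w where "s = sqrt S" and "w = sqrt W"
    have sw: "s > 0" "w > 0" "S = s * s" "W = w * w" using 3 by (auto simp: s_def w_def)
    have "2 * X \<le> s / w * (w * w) + s * s / (s / w)"
      using assms(1)[of "s / w"] sw by simp
    also have "\<dots> = 2 * (w * s)" using sw by (simp add: field_simps)
    finally show ?thesis by (simp add: s_def w_def)
  qed
qed

lemma two_mult_le_of_square_le:
  fixes y P Q \<alpha> :: real
  assumes "y\<^sup>2 \<le> P * Q" "P \<ge> 0" "Q \<ge> 0" "\<alpha> > 0"
  shows "2 * y \<le> \<alpha> * P + Q / \<alpha>"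
proof (rule power2_le_imp_le)
  have "(2 * y)\<^sup>2 \<le> 4 * ((\<alpha> * P) * (Q / \<alpha>))" using assms by (simp add: power_mult_distrib)
  also have "\<dots> \<le> (\<alpha> * P + Q / \<alpha>)\<^sup>2"
    using sum_squares_ge_zero[of "\<alpha> * P - Q / \<alpha>" 0] by (simp add: power2_eq_square algebra_simps)
  finally show "(2 * y)\<^sup>2 \<le> (\<alpha> * P + Q / \<alpha>)\<^sup>2" .
  show "0 \<le> \<alpha> * P + Q / \<alpha>" using assms by simp
qed

text \<open>The form is only semidefinite because representatives of L2 functions are not identified
  when equal almost everywhere: vanishing means \<open>ip u u = 0\<close>, and completeness yields
  some limit, determined up to null vectors. The carrier \<open>H\<close> is there because the type
  of all functions also contains those that are not square-integrable.\<close>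

locale semi_hilbert =
  fixes H :: "'v::real_vector set" and ip :: "'v \<Rightarrow> 'v \<Rightarrow> real"
  assumes subspace_H: "subspace H"
    and ip_commute: "u \<in> H \<Longrightarrow> v \<in> H \<Longrightarrow> ip u v = ip v u"
    and ip_add_left [simp]: "u \<in> H \<Longrightarrow> v \<in> H \<Longrightarrow> w \<in> H \<Longrightarrow> ip (u + v) w = ip u w + ip v w"
    and ip_scale_left [simp]: "u \<in> H \<Longrightarrow> w \<in> H \<Longrightarrow> ip (c *\<^sub>R u) w = c * ip u w"
    and ip_nonneg [simp]: "u \<in> H \<Longrightarrow> 0 \<le> ip u u"
    and complete: "(\<And>m. X m \<in> H) \<Longrightarrow>
      (\<And>e. e > 0 \<Longrightarrow> \<exists>N. \<forall>m\<ge>N. \<forall>n\<ge>N. ip (X m - X n) (X m - X n) < e) \<Longrightarrow>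
      \<exists>x\<in>H. (\<lambda>m::nat. ip (X m - x) (X m - x)) \<longlonglongrightarrow> 0"
begin

abbreviation sq :: "'v \<Rightarrow> real" where "sq u \<equiv> ip u u"

definition conv :: "(nat \<Rightarrow> 'v) \<Rightarrow> 'v \<Rightarrow> bool" where
  "conv X x \<longleftrightarrow> (\<lambda>m. sq (X m - x)) \<longlonglongrightarrow> 0"

lemma H_zero [simp, intro]: "0 \<in> H"
  and H_add [simp, intro]: "u \<in> H \<Longrightarrow> v \<in> H \<Longrightarrow> u + v \<in> H"
  and H_diff [simp, intro]: "u \<in> H \<Longrightarrow> v \<in> H \<Longrightarrow> u - v \<in> H"
  and H_minus [simp, intro]: "u \<in> H \<Longrightarrow> - u \<in> H"
  and H_scale [simp, intro]: "u \<in> H \<Longrightarrow> c *\<^sub>R u \<in> H"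
  and H_sum [simp, intro]: "(\<And>i. i \<in> I \<Longrightarrow> z i \<in> H) \<Longrightarrow> sum z I \<in> H"
  using subspace_H by (auto intro: subspace_0 subspace_add subspace_diff subspace_neg subspace_scale subspace_sum)

lemma ip_add_right [simp]: "u \<in> H \<Longrightarrow> v \<in> H \<Longrightarrow> w \<in> H \<Longrightarrow> ip w (u + v) = ip w u + ip w v"
  by (simp add: ip_commute[of w])

lemma ip_scale_right [simp]: "u \<in> H \<Longrightarrow> w \<in> H \<Longrightarrow> ip w (c *\<^sub>R u) = c * ip w u"
  by (simp add: ip_commute[of w])

lemma ip_minus_left [simp]: "u \<in> H \<Longrightarrow> w \<in> H \<Longrightarrow> ip (- u) w = - ip u w"
  using ip_scale_left[of u w "-1"] by simp

lemma ip_diff_left [simp]: "u \<in> H \<Longrightarrow> v \<in> H \<Longrightarrow> w \<in> H \<Longrightarrow> ip (u - v) w = ip u w - ip v w"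
  using ip_add_left[of u "- v" w] by simp

lemma ip_diff_right [simp]: "u \<in> H \<Longrightarrow> v \<in> H \<Longrightarrow> w \<in> H \<Longrightarrow> ip w (u - v) = ip w u - ip w v"
  by (simp add: ip_commute[of w])

lemma ip_zero_left [simp]: "w \<in> H \<Longrightarrow> ip 0 w = 0"
  using ip_scale_left[of 0 w 0] by simp

lemma ip_zero_right [simp]: "w \<in> H \<Longrightarrow> ip w 0 = 0"
  by (simp add: ip_commute[of w])

lemma ip_sum_left: "(\<And>i. i \<in> I \<Longrightarrow> z i \<in> H) \<Longrightarrow> w \<in> H \<Longrightarrow> ip (sum z I) w = (\<Sum>i\<in>I. ip (z i) w)"
  by (induction I rule: infinite_finite_induct) auto

lemma ip_sum_right: "(\<And>i. i \<in> I \<Longrightarrow> z i \<in> H) \<Longrightarrow> w \<in> H \<Longrightarrow> ip w (sum z I) = (\<Sum>i\<in>I. ip w (z i))"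
  by (induction I rule: infinite_finite_induct) auto

lemma sq_add: "u \<in> H \<Longrightarrow> v \<in> H \<Longrightarrow> sq (u + v) = sq u + 2 * ip u v + sq v"
  by (simp add: ip_commute[of v u])

lemma sq_diff: "u \<in> H \<Longrightarrow> v \<in> H \<Longrightarrow> sq (u - v) = sq u - 2 * ip u v + sq v"
  by (simp add: ip_commute[of v u])

lemma sq_add_le: "u \<in> H \<Longrightarrow> v \<in> H \<Longrightarrow> sq (u + v) \<le> 2 * sq u + 2 * sq v"
  using ip_nonneg[of "u - v"] by (simp add: sq_add sq_diff del: ip_nonneg)

lemma sq_diff_le: "u \<in> H \<Longrightarrow> v \<in> H \<Longrightarrow> sq (u - v) \<le> 2 * sq u + 2 * sq v"
  using ip_nonneg[of "u + v"] by (simp add: sq_add sq_diff del: ip_nonneg)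

lemma sq_diff_le_via: "u \<in> H \<Longrightarrow> v \<in> H \<Longrightarrow> w \<in> H \<Longrightarrow> sq (u - w) \<le> 2 * sq (u - v) + 2 * sq (v - w)"
  using sq_add_le[of "u - v" "v - w"] by simp

lemma cauchy_schwarz:
  assumes [simp]: "u \<in> H" "v \<in> H"
  shows "(ip u v)\<^sup>2 \<le> sq u * sq v"
proof (cases "sq v = 0")
  case True
  \<comment> \<open>Here \<open>v\<close> may be a nonzero null vector. An affine function of
    \<open>t\<close> that stays nonnegative has slope zero.\<close>
  have *: "0 \<le> sq u + 2 * t * ip u v" for t
  proof -
    have "0 \<le> sq (u + t *\<^sub>R v)" by (intro ip_nonneg) auto
    then show ?thesis using True by (simp add: sq_add mult_ac del: ip_add_left ip_add_right)
  qed
  have "ip u v = 0"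
  proof (rule ccontr)
    assume "ip u v \<noteq> 0"
    then have "- (sq u + 1) / ip u v * ip u v = - (sq u + 1)" by simp
    then show False using *[of "- (sq u + 1) / ip u v"] ip_nonneg[OF assms(1)] by linarith
  qed
  then show ?thesis by simp
next
  case False
  then have v: "sq v > 0" using ip_nonneg[of v] by (simp add: less_le del: ip_nonneg)
  define t where "t = ip u v / sq v"
  have "0 \<le> sq (u - t *\<^sub>R v)" by (intro ip_nonneg) auto
  also have "\<dots> = sq u - 2 * t * ip u v + t * t * sq v"
    by (simp add: sq_diff del: ip_diff_left ip_diff_right)
  also have "\<dots> = sq u - (ip u v)\<^sup>2 / sq v" using v by (simp add: t_def power2_eq_square)
  finally show ?thesis using v by (simp add: pos_divide_le_eq)
qed

lemma ip_null: "u \<in> H \<Longrightarrow> v \<in> H \<Longrightarrow> sq u = 0 \<Longrightarrow> ip u v = 0"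
  using cauchy_schwarz[of u v] by simp

lemma abs_ip_le: "u \<in> H \<Longrightarrow> v \<in> H \<Longrightarrow> \<bar>ip u v\<bar> \<le> sqrt (sq u) * sqrt (sq v)"
  using cauchy_schwarz[of u v] by (metis real_sqrt_abs real_sqrt_le_mono real_sqrt_mult)

lemma conv_ip_null:
  assumes "\<And>m. X m \<in> H" "\<And>m. Y m \<in> H" "(\<lambda>m. sq (X m)) \<longlonglongrightarrow> 0" "(\<lambda>m. sq (Y m)) \<longlonglongrightarrow> y"
  shows "(\<lambda>m. ip (X m) (Y m)) \<longlonglongrightarrow> 0"
proof (rule Lim_null_comparison)
  show "\<forall>\<^sub>F m in sequentially. norm (ip (X m) (Y m)) \<le> sqrt (sq (X m)) * sqrt (sq (Y m))"
    using abs_ip_le assms by simp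
  have "(\<lambda>m. sqrt (sq (X m)) * sqrt (sq (Y m))) \<longlonglongrightarrow> sqrt 0 * sqrt y"
    by (intro tendsto_mult tendsto_real_sqrt assms)
  then show "(\<lambda>m. sqrt (sq (X m)) * sqrt (sq (Y m))) \<longlonglongrightarrow> 0" by simp
qed

lemma conv_ip:
  assumes "conv X x" "conv Y y" and [simp]: "\<And>m. X m \<in> H" "\<And>m. Y m \<in> H" "x \<in> H" "y \<in> H"
  shows "(\<lambda>m. ip (X m) (Y m)) \<longlonglongrightarrow> ip x y"
proof -
  have a: "(\<lambda>m. ip (X m - x) (Y m - y)) \<longlonglongrightarrow> 0" "(\<lambda>m. ip (X m - x) y) \<longlonglongrightarrow> 0"
      "(\<lambda>m. ip (Y m - y) x) \<longlonglongrightarrow> 0"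
    using assms by (auto intro!: conv_ip_null simp: conv_def simp del: ip_diff_left ip_diff_right)
  have "(\<lambda>m. ip (X m - x) (Y m - y) + ip (X m - x) y + ip (Y m - y) x + ip x y) \<longlonglongrightarrow> 0 + 0 + 0 + ip x y"
    by (intro tendsto_add a tendsto_const)
  moreover have "ip (X m - x) (Y m - y) + ip (X m - x) y + ip (Y m - y) x + ip x y = ip (X m) (Y m)" for m
    by (simp add: ip_commute[of _ x])
  ultimately show ?thesis by (simp only: add_0_left)
qed

lemma conv_const [simp]: "x \<in> H \<Longrightarrow> conv (\<lambda>_. x) x"
  by (simp add: conv_def)

lemma conv_add:
  assumes "conv X x" "conv Y y" and [simp]: "\<And>m. X m \<in> H" "\<And>m. Y m \<in> H" "x \<in> H" "y \<in> H"
  shows "conv (\<lambda>m. X m + Y m) (x + y)"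
  unfolding conv_def
proof (rule Lim_null_comparison)
  show "\<forall>\<^sub>F m in sequentially. norm (sq (X m + Y m - (x + y))) \<le> 2 * sq (X m - x) + 2 * sq (Y m - y)"
    using sq_add_le[of "X _ - x" "Y _ - y"] by (simp add: add_diff_add[symmetric] del: ip_diff_left ip_diff_right ip_add_left ip_add_right)
  have "(\<lambda>m. 2 * sq (X m - x) + 2 * sq (Y m - y)) \<longlonglongrightarrow> 2 * 0 + 2 * 0"
    using assms by (intro tendsto_intros) (auto simp: conv_def)
  then show "(\<lambda>m. 2 * sq (X m - x) + 2 * sq (Y m - y)) \<longlonglongrightarrow> 0" by simp
qed

lemma conv_scale:
  assumes "conv X x" and [simp]: "\<And>m. X m \<in> H" "x \<in> H"
  shows "conv (\<lambda>m. c *\<^sub>R X m) (c *\<^sub>R x)"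
proof -
  have "sq (c *\<^sub>R X m - c *\<^sub>R x) = c * c * sq (X m - x)" for m
    by (simp add: scaleR_diff_right[symmetric] del: ip_diff_left ip_diff_right)
  moreover have "(\<lambda>m. c * c * sq (X m - x)) \<longlonglongrightarrow> c * c * 0"
    using assms(1) by (intro tendsto_intros) (simp add: conv_def)
  ultimately show ?thesis by (simp add: conv_def)
qed

lemma conv_imp_cauchy:
  assumes "conv X x" and [simp]: "\<And>m. X m \<in> H" "x \<in> H" and "e > 0"
  shows "\<exists>N. \<forall>m\<ge>N. \<forall>n\<ge>N. sq (X m - X n) < e"
proof -
  have "\<forall>\<^sub>F m in sequentially. sq (X m - x) < e / 4"
    using assms(1,4) by (intro order_tendstoD(2)[of _ 0]) (auto simp: conv_def)
  then obtain N where N: "\<And>m. m \<ge> N \<Longrightarrow> sq (X m - x) < e / 4"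
    by (auto simp: eventually_sequentially)
  have "sq (X m - X n) < e" if "m \<ge> N" "n \<ge> N" for m n
  proof -
    have "sq (X m - X n) \<le> 2 * sq (X m - x) + 2 * sq (X n - x)"
      using sq_diff_le[of "X m - x" "X n - x"] by (simp del: ip_diff_left ip_diff_right)
    also have "\<dots> < e" using N[of m] N[of n] that by linarith
    finally show ?thesis .
  qed
  then show ?thesis by blast
qed

lemma cauchy_imp_conv:
  assumes "\<And>m. X m \<in> H" "\<And>e. e > 0 \<Longrightarrow> \<exists>N. \<forall>m\<ge>N. \<forall>n\<ge>N. sq (X m - X n) < e"
  obtains x where "x \<in> H" "conv X x"
  using complete[OF assms] unfolding conv_def by blast

end

section \<open>The closure of a symmetric operator\<close>

text \<open>\<open>L\<close> stands for an unbounded operator, so no continuity is assumed. As it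
  maps \<open>D\<close> into itself, \<open>L \<phi>\<close> is again a test vector, which gives a
  meaning to the fourth-order expression \<open>L (L \<phi>)\<close>.\<close>

locale symmetric_operator = semi_hilbert H ip for H :: "'v::real_vector set" and ip +
  fixes D :: "'v set" and L :: "'v \<Rightarrow> 'v"
  assumes subspace_D: "subspace D"
    and D_subset_H: "D \<subseteq> H"
    and L_in_D [simp]: "\<phi> \<in> D \<Longrightarrow> L \<phi> \<in> D"
    and L_add: "\<phi> \<in> D \<Longrightarrow> \<psi> \<in> D \<Longrightarrow> L (\<phi> + \<psi>) = L \<phi> + L \<psi>"
    and L_scale: "\<phi> \<in> D \<Longrightarrow> L (c *\<^sub>R \<phi>) = c *\<^sub>R L \<phi>"
    and L_symmetric: "\<phi> \<in> D \<Longrightarrow> \<psi> \<in> D \<Longrightarrow> ip (L \<phi>) \<psi> = ip \<phi> (L \<psi>)"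
begin

lemma D_in_H [simp]: "\<phi> \<in> D \<Longrightarrow> \<phi> \<in> H"
  using D_subset_H by auto

lemma D_zero [simp]: "0 \<in> D"
  and D_add [simp]: "\<phi> \<in> D \<Longrightarrow> \<psi> \<in> D \<Longrightarrow> \<phi> + \<psi> \<in> D"
  and D_diff [simp]: "\<phi> \<in> D \<Longrightarrow> \<psi> \<in> D \<Longrightarrow> \<phi> - \<psi> \<in> D"
  and D_scale [simp]: "\<phi> \<in> D \<Longrightarrow> c *\<^sub>R \<phi> \<in> D"
  using subspace_D by (auto intro: subspace_0 subspace_add subspace_diff subspace_scale)

lemma L_diff: "\<phi> \<in> D \<Longrightarrow> \<psi> \<in> D \<Longrightarrow> L (\<phi> - \<psi>) = L \<phi> - L \<psi>"
  using L_add[of "\<phi> - \<psi>" \<psi>] by simp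

lemma L_zero [simp]: "L 0 = 0"
  using L_scale[of 0 0] by simp

text \<open>A relation rather than an operator, since null vectors may always be added to the second
  component. In the application its domain turns out to be \<open>H20_space\<close>.\<close>

definition graph_closure :: "('v \<times> 'v) set" where
  "graph_closure = {(u, w). u \<in> H \<and> w \<in> H \<and>
     (\<exists>\<phi>. (\<forall>m. \<phi> m \<in> D) \<and> conv \<phi> u \<and> conv (\<lambda>m. L (\<phi> m)) w)}"

lemma graph_closureI:
  "u \<in> H \<Longrightarrow> w \<in> H \<Longrightarrow> (\<And>m. \<phi> m \<in> D) \<Longrightarrow> conv \<phi> u \<Longrightarrow> conv (\<lambda>m. L (\<phi> m)) w \<Longrightarrow> (u, w) \<in> graph_closure"
  unfolding graph_closure_def by blast

lemma graph_closureE: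
  assumes "(u, w) \<in> graph_closure"
  obtains \<phi> where "u \<in> H" "w \<in> H" "\<And>m. \<phi> m \<in> D" "conv \<phi> u" "conv (\<lambda>m. L (\<phi> m)) w"
  using assms unfolding graph_closure_def by blast

lemma graph_in_H: "(u, w) \<in> graph_closure \<Longrightarrow> u \<in> H" "(u, w) \<in> graph_closure \<Longrightarrow> w \<in> H"
  unfolding graph_closure_def by auto

lemma graph_D: "\<phi> \<in> D \<Longrightarrow> (\<phi>, L \<phi>) \<in> graph_closure"
  by (rule graph_closureI[where \<phi> = "\<lambda>_. \<phi>"]) auto

lemma graph_add:
  assumes "(u, w) \<in> graph_closure" "(u', w') \<in> graph_closure"
  shows "(u + u', w + w') \<in> graph_closure"
proof -
  obtain \<phi> where \<phi>: "u \<in> H" "w \<in> H" "\<And>m. \<phi> m \<in> D" "conv \<phi> u" "conv (\<lambda>m. L (\<phi> m)) w"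
    using assms(1) by (rule graph_closureE) (rule that)
  obtain \<psi> where \<psi>: "u' \<in> H" "w' \<in> H" "\<And>m. \<psi> m \<in> D" "conv \<psi> u'" "conv (\<lambda>m. L (\<psi> m)) w'"
    using assms(2) by (rule graph_closureE) (rule that)
  show ?thesis
    by (rule graph_closureI[where \<phi> = "\<lambda>m. \<phi> m + \<psi> m"]) (use \<phi> \<psi> in \<open>auto intro!: conv_add simp: L_add\<close>)
qed

lemma graph_scale:
  assumes "(u, w) \<in> graph_closure"
  shows "(c *\<^sub>R u, c *\<^sub>R w) \<in> graph_closure"
proof -
  obtain \<phi> where \<phi>: "u \<in> H" "w \<in> H" "\<And>m. \<phi> m \<in> D" "conv \<phi> u" "conv (\<lambda>m. L (\<phi> m)) w"
    using assms(1) by (rule graph_closureE) (rule that)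
  show ?thesis
    by (rule graph_closureI[where \<phi> = "\<lambda>m. c *\<^sub>R \<phi> m"]) (use \<phi> in \<open>auto intro!: conv_scale simp: L_scale\<close>)
qed

lemma graph_diff:
  "(u, w) \<in> graph_closure \<Longrightarrow> (u', w') \<in> graph_closure \<Longrightarrow> (u - u', w - w') \<in> graph_closure"
  using graph_add[of u w "- u'" "- w'"] graph_scale[of u' w' "-1"] by simp

lemma graph_sum:
  "(\<And>i. i \<in> I \<Longrightarrow> (u i, w i) \<in> graph_closure) \<Longrightarrow> (sum u I, sum w I) \<in> graph_closure"
proof (induction I rule: infinite_finite_induct)
  case (insert i I)
  then show ?case by (simp add: graph_add)
qed (use graph_D[of 0] in auto)

lemma graph_symmetric:
  assumes "(u, w) \<in> graph_closure" "(u', w') \<in> graph_closure"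
  shows "ip w u' = ip u w'"
proof -
  obtain \<phi> where \<phi>: "u \<in> H" "w \<in> H" "\<And>m. \<phi> m \<in> D" "conv \<phi> u" "conv (\<lambda>m. L (\<phi> m)) w"
    using assms(1) by (rule graph_closureE) (rule that)
  obtain \<psi> where \<psi>: "u' \<in> H" "w' \<in> H" "\<And>m. \<psi> m \<in> D" "conv \<psi> u'" "conv (\<lambda>m. L (\<psi> m)) w'"
    using assms(2) by (rule graph_closureE) (rule that)
  have "(\<lambda>m. ip (L (\<phi> m)) (\<psi> m)) \<longlonglongrightarrow> ip w u'" using \<phi> \<psi> by (intro conv_ip) auto
  moreover have "(\<lambda>m. ip (\<phi> m) (L (\<psi> m))) \<longlonglongrightarrow> ip u w'" using \<phi> \<psi> by (intro conv_ip) auto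
  ultimately show ?thesis using \<phi>(3) \<psi>(3) LIMSEQ_unique by (simp add: L_symmetric) blast
qed

text \<open>A diagonal choice: for each \<open>m\<close> a test vector is taken at squared distance
  below 1/(m+1) from \<open>U m\<close>, with its image under \<open>L\<close> equally close to
  \<open>W m\<close>.\<close>

lemma graph_closed:
  assumes G: "\<And>m. (U m, W m) \<in> graph_closure" and c: "conv U u" "conv W w" and [simp]: "u \<in> H" "w \<in> H"
  shows "(u, w) \<in> graph_closure"
proof -
  note [simp] = graph_in_H[OF G]
  have "\<exists>\<phi>. \<phi> \<in> D \<and> sq (\<phi> - U m) < inverse (Suc m) \<and> sq (L \<phi> - W m) < inverse (Suc m)" for m
  proof -
    obtain \<phi> where \<phi>: "\<And>m. \<phi> m \<in> D" "conv \<phi> (U m)" "conv (\<lambda>m. L (\<phi> m)) (W m)"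
      using G[of m] by (rule graph_closureE) (rule that)
    have "\<forall>\<^sub>F k in sequentially. sq (\<phi> k - U m) < inverse (Suc m)"
        "\<forall>\<^sub>F k in sequentially. sq (L (\<phi> k) - W m) < inverse (Suc m)"
      using \<phi>(2,3) by (auto simp: conv_def intro!: order_tendstoD(2)[of _ 0])
    then have "\<forall>\<^sub>F k in sequentially. sq (\<phi> k - U m) < inverse (Suc m) \<and> sq (L (\<phi> k) - W m) < inverse (Suc m)"
      by eventually_elim auto
    then show ?thesis using \<phi>(1) by (auto simp: eventually_sequentially simp del: ip_diff_left ip_diff_right)
  qed
  then obtain \<phi> where \<phi>: "\<And>m. \<phi> m \<in> D" "\<And>m. sq (\<phi> m - U m) < inverse (Suc m)"
      "\<And>m. sq (L (\<phi> m) - W m) < inverse (Suc m)" by metis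
  have *: "conv X x" if "conv Y x" "\<And>m. X m \<in> H" "\<And>m. Y m \<in> H" "x \<in> H" "\<And>m. sq (X m - Y m) < inverse (Suc m)"
    for X Y x
    unfolding conv_def
  proof (rule Lim_null_comparison)
    show "\<forall>\<^sub>F m in sequentially. norm (sq (X m - x)) \<le> 2 * inverse (real (Suc m)) + 2 * sq (Y m - x)"
    proof (intro always_eventually allI)
      fix m
      have "sq (X m - x) \<le> 2 * sq (X m - Y m) + 2 * sq (Y m - x)"
        using that by (intro sq_diff_le_via) auto
      also have "\<dots> \<le> 2 * inverse (real (Suc m)) + 2 * sq (Y m - x)"
        using that(5)[of m] by linarith
      finally show "norm (sq (X m - x)) \<le> 2 * inverse (real (Suc m)) + 2 * sq (Y m - x)"
        using that by (simp del: ip_diff_left ip_diff_right)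
    qed
    have "(\<lambda>m. 2 * inverse (real (Suc m)) + 2 * sq (Y m - x)) \<longlonglongrightarrow> 2 * 0 + 2 * 0"
      using that(1) by (intro tendsto_intros LIMSEQ_inverse_real_of_nat) (simp add: conv_def)
    then show "(\<lambda>m. 2 * inverse (real (Suc m)) + 2 * sq (Y m - x)) \<longlonglongrightarrow> 0" by simp
  qed
  show ?thesis
    by (rule graph_closureI[where \<phi> = \<phi>]) (use \<phi> c in \<open>auto intro: *\<close>)
qed

text \<open>The bilinear form of \<open>L\<^sup>2\<close> is \<open>ip w z\<close> for \<open>(u, w)\<close> and \<open>(v, z)\<close> in the closed graph of \<open>L\<close>.\<close>

definition weak_eigen :: "real \<Rightarrow> 'v \<Rightarrow> 'v \<Rightarrow> bool" where
  "weak_eigen \<mu> u w \<longleftrightarrow> (u, w) \<in> graph_closure \<and> (\<forall>\<phi>\<in>D. ip w (L \<phi>) = \<mu> * ip u \<phi>)"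

text \<open>The equation is given only against test vectors, but both sides pass to the limit along
  an approximating sequence. This admits trial vectors built from eigenvectors, which need not be
  test vectors.\<close>

lemma weak_eigen_graph:
  assumes "weak_eigen \<mu> u w" "(v, z) \<in> graph_closure"
  shows "ip w z = \<mu> * ip u v"
proof -
  have u: "(u, w) \<in> graph_closure" "\<And>\<phi>. \<phi> \<in> D \<Longrightarrow> ip w (L \<phi>) = \<mu> * ip u \<phi>"
    using assms(1) by (auto simp: weak_eigen_def)
  note [simp] = graph_in_H[OF u(1)]
  obtain \<phi> where \<phi>: "v \<in> H" "z \<in> H" "\<And>m. \<phi> m \<in> D" "conv \<phi> v" "conv (\<lambda>m. L (\<phi> m)) z"
    using assms(2) by (rule graph_closureE) (rule that)
  have "(\<lambda>m. ip w (L (\<phi> m))) \<longlonglongrightarrow> ip w z" using \<phi> by (intro conv_ip) auto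
  moreover have "(\<lambda>m. \<mu> * ip u (\<phi> m)) \<longlonglongrightarrow> \<mu> * ip u v"
    using \<phi> by (intro tendsto_intros conv_ip) auto
  ultimately show ?thesis using u(2)[OF \<phi>(3)] LIMSEQ_unique by simp blast
qed

lemma weak_eigen_orthogonal:
  assumes "weak_eigen \<mu> u w" "weak_eigen \<nu> v z" "\<mu> \<noteq> \<nu>"
  shows "ip u v = 0"
proof -
  have g: "(u, w) \<in> graph_closure" "(v, z) \<in> graph_closure" using assms by (auto simp: weak_eigen_def)
  note [simp] = graph_in_H[OF g(1)] graph_in_H[OF g(2)]
  have "\<mu> * ip u v = ip w z" using weak_eigen_graph[OF assms(1) g(2)] by simp
  also have "\<dots> = ip z w" by (rule ip_commute) simp_all
  also have "\<dots> = \<nu> * ip v u" using weak_eigen_graph[OF assms(2) g(1)] .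
  also have "ip v u = ip u v" by (rule ip_commute) simp_all
  finally show ?thesis using assms(3) by simp
qed

text \<open>
  The compactness hypothesis replaces Rellich's theorem: modulo finitely many functionals, the
  norm is small compared with the graph norm. Together with the parallelogram law it makes a
  subsequence of every minimizing sequence of the Rayleigh quotient converge.
\<close>

lemma rayleigh_lower_bound:
  assumes compact: "\<And>\<delta>. \<delta> > 0 \<Longrightarrow> \<exists>(Q::nat set) \<eta>. finite Q \<and> (\<forall>k\<in>Q. \<eta> k \<in> H) \<and>
      (\<forall>\<phi>\<in>D. sq \<phi> \<le> (\<Sum>k\<in>Q. (ip \<phi> (\<eta> k))\<^sup>2) + \<delta> * (sq \<phi> + sq (L \<phi>)))"
    and I: "finite I" and e: "\<And>i. i \<in> I \<Longrightarrow> weak_eigen (l i) (u i) (w i)"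
    and on: "\<And>i j. i \<in> I \<Longrightarrow> j \<in> I \<Longrightarrow> ip (u i) (u j) = (if i = j then 1 else 0)"
    and none: "\<And>\<mu> v z. \<mu> < \<Lambda> \<Longrightarrow> weak_eigen \<mu> v z \<Longrightarrow> (\<And>i. i \<in> I \<Longrightarrow> ip v (u i) = 0) \<Longrightarrow> sq v = 0"
    and v: "(v, z) \<in> graph_closure" "\<And>i. i \<in> I \<Longrightarrow> ip v (u i) = 0"
  shows "\<Lambda> * sq v \<le> sq z"
proof (rule ccontr)
  note [simp del] = ip_diff_left ip_diff_right ip_add_left ip_add_right
  assume neg: "\<not> \<Lambda> * sq v \<le> sq z"
  have gu: "(u i, w i) \<in> graph_closure" if "i \<in> I" for i using e[OF that] by (simp add: weak_eigen_def)
  note uwH [simp] = graph_in_H[OF gu]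
  \<comment> \<open>\<open>P\<close> collects the pairs satisfying the orthogonality constraints,
    and \<mu> is the infimum of the Rayleigh quotient over them; the assumed failure for
    \<open>v\<close> makes it smaller than \<Lambda>.\<close>
  define P where "P = {(v, z). (v, z) \<in> graph_closure \<and> (\<forall>i\<in>I. ip v (u i) = 0)}"
  have PH: "x \<in> H" "y \<in> H" "(x, y) \<in> graph_closure" if "(x, y) \<in> P" for x y
    using that graph_in_H unfolding P_def by blast+
  have P_add: "(x + x', y + y') \<in> P" if "(x, y) \<in> P" "(x', y') \<in> P" for x y x' y'
    using that PH[OF that(1)] PH[OF that(2)] by (auto simp: P_def graph_add ip_add_left)
  have P_scale: "(c *\<^sub>R x, c *\<^sub>R y) \<in> P" if "(x, y) \<in> P" for c x y
    using that PH[OF that] by (auto simp: P_def graph_scale)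
  define S where "S = {sq y |x y. (x, y) \<in> P \<and> sq x = 1}"
  define \<mu> where "\<mu> = Inf S"
  have S_bdd: "bdd_below S" by (intro bdd_belowI[of _ 0]) (auto simp: S_def dest: PH(2))
  have vP: "(v, z) \<in> P" using v by (simp add: P_def)
  have v_pos: "sq v > 0"
  proof (rule ccontr)
    assume "\<not> 0 < sq v"
    then have "sq v = 0" using PH(1)[OF vP] ip_nonneg[of v] by linarith
    with neg PH(2)[OF vP] show False by simp
  qed
  have v_S: "sq z / sq v \<in> S"
    unfolding S_def
    by (intro CollectI exI[of _ "(1 / sqrt (sq v)) *\<^sub>R v"] exI[of _ "(1 / sqrt (sq v)) *\<^sub>R z"] conjI P_scale[OF vP])
       (use PH[OF vP] v_pos in auto)
  have "\<mu> \<le> sq z / sq v" unfolding \<mu>_def by (rule cInf_lower[OF v_S S_bdd])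
  also have "\<dots> < \<Lambda>" using neg v_pos by (simp add: pos_divide_less_eq)
  finally have \<mu>_less: "\<mu> < \<Lambda>" .
  have \<mu>_nonneg: "\<mu> \<ge> 0" unfolding \<mu>_def using v_S by (intro cInf_greatest) (auto simp: S_def dest: PH(2))
  have ray: "\<mu> * sq x \<le> sq y" if "(x, y) \<in> P" for x y
  proof (cases "sq x = 0")
    case False
    then have x: "sq x > 0" using PH[OF that] ip_nonneg[of x] by linarith
    have "sq y / sq x \<in> S"
      unfolding S_def
      by (intro CollectI exI[of _ "(1 / sqrt (sq x)) *\<^sub>R x"] exI[of _ "(1 / sqrt (sq x)) *\<^sub>R y"] conjI P_scale[OF that])
         (use PH[OF that] x in auto)
    then have "\<mu> \<le> sq y / sq x" unfolding \<mu>_def by (rule cInf_lower[OF _ S_bdd])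
    then show ?thesis using x by (simp add: pos_le_divide_eq)
  qed (use PH[OF that] in auto)
  have "\<exists>x y. (x, y) \<in> P \<and> sq x = 1 \<and> sq y < \<mu> + inverse (Suc m)" for m
  proof -
    have "\<exists>s\<in>S. s < \<mu> + inverse (Suc m)"
      using cInf_less_iff[of S "\<mu> + inverse (Suc m)"] v_S S_bdd unfolding \<mu>_def by auto
    then show ?thesis by (auto simp: S_def)
  qed
  then obtain X Y where XY: "\<And>m. (X m, Y m) \<in> P" "\<And>m. sq (X m) = 1" "\<And>m. sq (Y m) < \<mu> + inverse (Suc m)"
    by metis
  have Y_ge: "\<mu> \<le> sq (Y m)" for m using ray[OF XY(1)[of m]] XY(2)[of m] by simp
  note [simp] = PH[OF XY(1)]
  \<comment> \<open>The choice gives \<delta> (1 + \<mu>) = 1/2, so that half of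
    \<open>sq (X m - X n)\<close> can be absorbed on the left of the compactness inequality.\<close>
  define \<delta> where "\<delta> = 1 / (2 * (1 + \<mu>))"
  have \<delta>: "\<delta> > 0" "\<delta> * (1 + \<mu>) = 1 / 2" using \<mu>_nonneg by (auto simp: \<delta>_def)
  obtain Q :: "nat set" and \<eta> where Q: "finite Q" "\<And>k. k \<in> Q \<Longrightarrow> \<eta> k \<in> H"
      "\<And>\<phi>. \<phi> \<in> D \<Longrightarrow> sq \<phi> \<le> (\<Sum>k\<in>Q. (ip \<phi> (\<eta> k))\<^sup>2) + \<delta> * (sq \<phi> + sq (L \<phi>))"
    using compact[OF \<delta>(1)] by blast
  have QH [simp]: "\<eta> k \<in> H" if "k \<in> Q" for k using Q(2) that by auto
  have QG: "sq x \<le> (\<Sum>k\<in>Q. (ip x (\<eta> k))\<^sup>2) + \<delta> * (sq x + sq y)" if g: "(x, y) \<in> graph_closure" for x y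
  proof -
    obtain \<phi> where \<phi>: "x \<in> H" "y \<in> H" "\<And>m. \<phi> m \<in> D" "conv \<phi> x" "conv (\<lambda>m. L (\<phi> m)) y"
      using g by (rule graph_closureE) (rule that)
    have a: "(\<lambda>m. sq (\<phi> m)) \<longlonglongrightarrow> sq x" using \<phi> by (intro conv_ip) auto
    have b: "(\<lambda>m. (\<Sum>k\<in>Q. (ip (\<phi> m) (\<eta> k))\<^sup>2) + \<delta> * (sq (\<phi> m) + sq (L (\<phi> m))))
        \<longlonglongrightarrow> (\<Sum>k\<in>Q. (ip x (\<eta> k))\<^sup>2) + \<delta> * (sq x + sq y)"
      using \<phi> by (intro tendsto_intros conv_ip) auto
    show ?thesis by (rule LIMSEQ_le[OF a b]) (use Q(3)[OF \<phi>(3)] in blast)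
  qed
  have "bounded (range (\<lambda>m. ip (X m) (\<eta> k)))" if "k \<in> Q" for k
  proof -
    have "\<bar>ip (X m) (\<eta> k)\<bar> \<le> sqrt (sq (\<eta> k))" for m using abs_ip_le[of "X m" "\<eta> k"] that XY(2) by simp
    then show ?thesis by (intro boundedI[of _ "sqrt (sq (\<eta> k))"]) auto
  qed
  from finite_family_convergent_subsequence[of Q "\<lambda>k m. ip (X m) (\<eta> k)", OF Q(1) this]
  obtain r :: "nat \<Rightarrow> nat" where r: "strict_mono r" "\<And>k. k \<in> Q \<Longrightarrow> convergent (\<lambda>m. ip (X (r m)) (\<eta> k))" by blast
  \<comment> \<open>Parallelogram law: \<open>X m + X n\<close> satisfies the constraints, so
    \<open>Y m + Y n\<close> cannot be short. Hence the distance of the images is controlled by the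
    distance of the near-minimizers and their excess over \<mu>.\<close>
  have Y_diff: "sq (Y m - Y n) \<le> \<mu> * sq (X m - X n) + 2 * inverse (Suc m) + 2 * inverse (Suc n)" for m n
  proof -
    have "sq (Y m - Y n) = 2 * sq (Y m) + 2 * sq (Y n) - sq (Y m + Y n)" by (simp add: sq_diff sq_add)
    also have "\<dots> \<le> 2 * sq (Y m) + 2 * sq (Y n) - \<mu> * sq (X m + X n)"
      using ray[OF P_add[OF XY(1)[of m] XY(1)[of n]]] by simp
    also have "sq (X m + X n) = 4 - sq (X m - X n)" by (simp add: sq_diff sq_add XY(2))
    also have "2 * sq (Y m) + 2 * sq (Y n) - \<mu> * (4 - sq (X m - X n))
        \<le> \<mu> * sq (X m - X n) + 2 * inverse (Suc m) + 2 * inverse (Suc n)"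
      using XY(3)[of m] XY(3)[of n] by (simp add: algebra_simps)
    finally show ?thesis .
  qed
  have X_diff: "sq (X m - X n) \<le> 2 * (\<Sum>k\<in>Q. (ip (X m) (\<eta> k) - ip (X n) (\<eta> k))\<^sup>2)
      + 4 * \<delta> * (inverse (Suc m) + inverse (Suc n))" for m n
  proof -
    have "sq (X m - X n) \<le> (\<Sum>k\<in>Q. (ip (X m - X n) (\<eta> k))\<^sup>2) + \<delta> * (sq (X m - X n) + sq (Y m - Y n))"
      by (rule QG) (simp add: graph_diff)
    also have "(\<Sum>k\<in>Q. (ip (X m - X n) (\<eta> k))\<^sup>2) = (\<Sum>k\<in>Q. (ip (X m) (\<eta> k) - ip (X n) (\<eta> k))\<^sup>2)"
      by (rule sum.cong) (auto simp: ip_diff_left)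
    also have "\<delta> * (sq (X m - X n) + sq (Y m - Y n))
        \<le> \<delta> * (sq (X m - X n) + (\<mu> * sq (X m - X n) + 2 * inverse (Suc m) + 2 * inverse (Suc n)))"
      using Y_diff[of m n] \<delta>(1) by (intro mult_left_mono add_left_mono) auto
    also have "\<dots> = (\<delta> * (1 + \<mu>)) * sq (X m - X n) + 2 * \<delta> * (inverse (Suc m) + inverse (Suc n))"
      by (simp add: algebra_simps)
    finally show ?thesis unfolding \<delta>(2) by simp
  qed
  have inv_small: "\<exists>N. \<forall>m\<ge>N. inverse (real (Suc (r m))) < e" if e: "e > 0" for e
  proof -
    obtain N where N: "inverse (real (Suc N)) < e" using reals_Archimedean[OF e] by blast
    have "inverse (real (Suc (r m))) < e" if "m \<ge> N" for m
    proof -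
      have "N \<le> r m" using seq_suble[OF r(1), of m] that by simp
      then have "inverse (real (Suc (r m))) \<le> inverse (real (Suc N))" by simp
      with N show ?thesis by linarith
    qed
    then show ?thesis by blast
  qed
  define q where "q = (\<lambda>m n. 2 * (\<Sum>k\<in>Q. (ip (X (r m)) (\<eta> k) - ip (X (r n)) (\<eta> k))\<^sup>2))"
  have q_small: "\<exists>N. \<forall>m\<ge>N. \<forall>n\<ge>N. q m n < e" if "e > 0" for e
  proof -
    define d where "d = sqrt (e / (2 * (real (card Q) + 1)))"
    have d: "d > 0" using that by (simp add: d_def)
    have "\<forall>k\<in>Q. \<exists>N. \<forall>m\<ge>N. \<forall>n\<ge>N. \<bar>ip (X (r m)) (\<eta> k) - ip (X (r n)) (\<eta> k)\<bar> < d"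
      using r(2) d by (auto simp: Cauchy_convergent_iff[symmetric] Cauchy_def dist_real_def)
    from bchoice[OF this] obtain N
      where N: "\<And>k m n. k \<in> Q \<Longrightarrow> m \<ge> N k \<Longrightarrow> n \<ge> N k \<Longrightarrow> \<bar>ip (X (r m)) (\<eta> k) - ip (X (r n)) (\<eta> k)\<bar> < d"
      by blast
    define M where "M = Max (insert 0 (N ` Q))"
    have M: "N k \<le> M" if "k \<in> Q" for k unfolding M_def using Q(1) that by (intro Max_ge) auto
    have "q m n < e" if "m \<ge> M" "n \<ge> M" for m n
    proof -
      have "(\<Sum>k\<in>Q. (ip (X (r m)) (\<eta> k) - ip (X (r n)) (\<eta> k))\<^sup>2) \<le> (\<Sum>k\<in>Q. d\<^sup>2)"
      proof (rule sum_mono)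
        fix k assume "k \<in> Q"
        then have "\<bar>ip (X (r m)) (\<eta> k) - ip (X (r n)) (\<eta> k)\<bar> < d" using N[of k m n] M[of k] that by simp
        then show "(ip (X (r m)) (\<eta> k) - ip (X (r n)) (\<eta> k))\<^sup>2 \<le> d\<^sup>2" using d by (simp add: abs_le_square_iff[symmetric])
      qed
      also have "\<dots> = real (card Q) * (e / (2 * (real (card Q) + 1)))" using that \<open>e > 0\<close> by (simp add: d_def)
      also have "\<dots> < e / 2" using \<open>e > 0\<close> by (simp add: field_simps)
      finally show ?thesis by (simp add: q_def)
    qed
    then show ?thesis by blast
  qed
  have cX: "\<exists>N. \<forall>m\<ge>N. \<forall>n\<ge>N. sq (X (r m) - X (r n)) < \<epsilon>" if e: "\<epsilon> > 0" for \<epsilon>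
  proof -
    obtain N where N: "\<And>m n. m \<ge> N \<Longrightarrow> n \<ge> N \<Longrightarrow> q m n < \<epsilon> / 2" using q_small[of "\<epsilon> / 2"] e by auto
    obtain N' where N': "\<And>m. m \<ge> N' \<Longrightarrow> inverse (real (Suc (r m))) < \<epsilon> / (16 * \<delta>)"
      using inv_small[of "\<epsilon> / (16 * \<delta>)"] e \<delta>(1) by auto
    have "sq (X (r m) - X (r n)) < \<epsilon>" if "m \<ge> max N N'" "n \<ge> max N N'" for m n
    proof -
      have "4 * \<delta> * (inverse (real (Suc (r m))) + inverse (real (Suc (r n)))) \<le> 4 * \<delta> * (\<epsilon> / (16 * \<delta>) + \<epsilon> / (16 * \<delta>))"
        using N'[of m] N'[of n] that \<delta>(1) by (intro mult_left_mono add_mono) auto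
      also have "\<dots> = \<epsilon> / 2" using \<delta>(1) by (simp add: field_simps)
      finally show ?thesis using X_diff[of "r m" "r n"] N[of m n] that unfolding q_def by simp
    qed
    then show ?thesis by blast
  qed
  have cY: "\<exists>N. \<forall>m\<ge>N. \<forall>n\<ge>N. sq (Y (r m) - Y (r n)) < \<epsilon>" if e: "\<epsilon> > 0" for \<epsilon>
  proof -
    obtain N where N: "\<And>m n. m \<ge> N \<Longrightarrow> n \<ge> N \<Longrightarrow> sq (X (r m) - X (r n)) < \<epsilon> / (2 * (\<mu> + 1))"
      using cX[of "\<epsilon> / (2 * (\<mu> + 1))"] e \<mu>_nonneg by auto
    obtain N' where N': "\<And>m. m \<ge> N' \<Longrightarrow> inverse (real (Suc (r m))) < \<epsilon> / 8"
      using inv_small[of "\<epsilon> / 8"] e by auto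
    have "sq (Y (r m) - Y (r n)) < \<epsilon>" if "m \<ge> max N N'" "n \<ge> max N N'" for m n
    proof -
      have "\<mu> * sq (X (r m) - X (r n)) \<le> \<mu> * (\<epsilon> / (2 * (\<mu> + 1)))"
        using N[of m n] that \<mu>_nonneg by (intro mult_left_mono) auto
      also have "\<dots> < \<epsilon> / 2" using \<mu>_nonneg \<open>\<epsilon> > 0\<close> by (simp add: field_simps)
      finally show ?thesis using Y_diff[of "r m" "r n"] N'[of m] N'[of n] that by simp
    qed
    then show ?thesis by blast
  qed
  obtain x where x [simp]: "x \<in> H" and cx: "conv (\<lambda>m. X (r m)) x"
    using cauchy_imp_conv[of "\<lambda>m. X (r m)"] cX by auto
  obtain y where y [simp]: "y \<in> H" and cy: "conv (\<lambda>m. Y (r m)) y"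
    using cauchy_imp_conv[of "\<lambda>m. Y (r m)"] cY by auto
  have "(\<lambda>m. sq (X (r m))) \<longlonglongrightarrow> sq x" using cx by (intro conv_ip) auto
  then have "1 = sq x" by (simp only: XY(2) LIMSEQ_const_iff)
  then have sqx: "sq x = 1" by (rule sym)
  have sqY: "(\<lambda>m. sq (Y (r m))) \<longlonglongrightarrow> sq y" using cy by (intro conv_ip) auto
  have "(\<lambda>m. inverse (real (Suc (r m)))) \<longlonglongrightarrow> 0"
    using LIMSEQ_subseq_LIMSEQ[OF LIMSEQ_inverse_real_of_nat r(1)] by (simp add: o_def)
  then have "(\<lambda>m. \<mu> + inverse (real (Suc (r m)))) \<longlonglongrightarrow> \<mu> + 0" by (intro tendsto_intros)
  then have "sq y \<le> \<mu> + 0" by (rule LIMSEQ_le[OF sqY]) (intro exI allI impI less_imp_le XY(3))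
  then have sqy: "sq y \<le> \<mu>" by simp
  have xP: "(x, y) \<in> P"
    unfolding P_def
  proof (intro CollectI case_prodI conjI ballI)
    show "(x, y) \<in> graph_closure" by (rule graph_closed[OF _ cx cy]) auto
    fix i assume i: "i \<in> I"
    have "(\<lambda>m. ip (X (r m)) (u i)) \<longlonglongrightarrow> ip x (u i)" using cx i by (intro conv_ip) auto
    moreover have "ip (X (r m)) (u i) = 0" for m using XY(1)[of "r m"] i by (auto simp: P_def)
    ultimately have "0 = ip x (u i)" by (simp only: LIMSEQ_const_iff)
    then show "ip x (u i) = 0" by (rule sym)
  qed
  \<comment> \<open>First variation: along x + s x' the Rayleigh inequality becomes a nonnegative
    quadratic in s, whose constant term drops out because \<open>sq x = 1\<close> and
    \<open>sq y \<le> \<mu>\<close>. Its linear coefficient therefore vanishes.\<close>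
  have euler: "ip y y' = \<mu> * ip x x'" if P': "(x', y') \<in> P" for x' y'
  proof -
    note [simp] = PH[OF P']
    have "0 \<le> (2 * (ip y y' - \<mu> * ip x x')) * s + (sq y' - \<mu> * sq x') * s\<^sup>2" for s
    proof -
      have "\<mu> * sq (x + s *\<^sub>R x') \<le> sq (y + s *\<^sub>R y')" by (intro ray P_add xP P_scale P')
      then have "\<mu> * (1 + 2 * (s * ip x x') + s * s * sq x') \<le> sq y + 2 * (s * ip y y') + s * s * sq y'"
        by (simp add: sq_add sqx mult.assoc)
      also have "\<dots> \<le> \<mu> + 2 * (s * ip y y') + s * s * sq y'" using sqy by simp
      finally show ?thesis by (simp add: algebra_simps power2_eq_square)
    qed
    from quadratic_nonneg_imp_zero[OF this] show ?thesis by simp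
  qed
  have "weak_eigen \<mu> x y"
    unfolding weak_eigen_def
  proof (intro conjI ballI)
    show "(x, y) \<in> graph_closure" using PH(3)[OF xP] .
    fix \<phi> assume \<phi>: "\<phi> \<in> D"
    \<comment> \<open>A test vector may violate the constraints, so it is projected. The correction
      does not affect the equation, because \<open>ip (w i) y = l i * ip (u i) x\<close> and the
      latter is zero.\<close>
    define x' where "x' = \<phi> - (\<Sum>i\<in>I. ip \<phi> (u i) *\<^sub>R u i)"
    define y' where "y' = L \<phi> - (\<Sum>i\<in>I. ip \<phi> (u i) *\<^sub>R w i)"
    have "(x', y') \<in> P"
      unfolding P_def
    proof (intro CollectI case_prodI conjI ballI)
      show "(x', y') \<in> graph_closure" unfolding x'_def y'_def
        using \<phi> gu by (intro graph_diff graph_sum graph_scale graph_D)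
      fix i assume i: "i \<in> I"
      have "(\<Sum>j\<in>I. ip \<phi> (u j) * ip (u j) (u i)) = (\<Sum>j\<in>I. if j = i then ip \<phi> (u i) else 0)"
        using on i by (intro sum.cong) auto
      then show "ip x' (u i) = 0" using \<phi> i I
        by (simp add: x'_def ip_diff_left ip_sum_left)
    qed
    from euler[OF this] have "ip y y' = \<mu> * ip x x'" .
    moreover have "ip y y' = ip y (L \<phi>)"
    proof -
      have "ip y (w i) = 0" if "i \<in> I" for i
      proof -
        have "ip (w i) y = l i * ip (u i) x" by (rule weak_eigen_graph[OF e[OF that] PH(3)[OF xP]])
        also have "ip (u i) x = ip x (u i)" using that by (intro ip_commute) auto
        also have "\<dots> = 0" using xP that by (auto simp: P_def)
        finally show ?thesis using ip_commute that by simp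
      qed
      then show ?thesis using \<phi> by (simp add: y'_def ip_diff_right ip_sum_right)
    qed
    moreover have "ip x x' = ip x \<phi>"
      using \<phi> xP by (simp add: x'_def ip_diff_right ip_sum_right P_def)
    ultimately show "ip y (L \<phi>) = \<mu> * ip x \<phi>" by simp
  qed
  from none[OF \<mu>_less this] xP have "sq x = 0" by (auto simp: P_def)
  with sqx show False by simp
qed


section \<open>Multiplicities and orthonormal systems of eigenvectors\<close>

definition weak_eigenspace :: "real \<Rightarrow> 'v set" where
  "weak_eigenspace \<mu> = {u. \<exists>w. weak_eigen \<mu> u w}"

text \<open>Abstract counterpart of \<open>has_multiplicity\<close>: equality almost everywhere
  becomes vanishing of the squared seminorm of the difference, so independence and spanning are both
  meant modulo null vectors.\<close>

definition multiplicity_is :: "real \<Rightarrow> nat \<Rightarrow> bool" where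
  "multiplicity_is \<mu> m \<longleftrightarrow> (\<exists>e. (\<forall>i<m. e i \<in> weak_eigenspace \<mu>) \<and>
      (\<forall>c. sq (\<Sum>i<m. c i *\<^sub>R e i) = 0 \<longrightarrow> (\<forall>i<m. c i = 0)) \<and>
      (\<forall>u\<in>weak_eigenspace \<mu>. \<exists>c. sq (u - (\<Sum>i<m. c i *\<^sub>R e i)) = 0))"

lemma weak_eigenspace_in_H: "u \<in> weak_eigenspace \<mu> \<Longrightarrow> u \<in> H"
  using graph_in_H by (auto simp: weak_eigenspace_def weak_eigen_def)

lemma subspace_weak_eigenspace: "subspace (weak_eigenspace \<mu>)"
proof (rule subspaceI)
  have "weak_eigen \<mu> 0 0"
    using graph_D[of 0] by (auto simp: weak_eigen_def)
  then show "0 \<in> weak_eigenspace \<mu>" by (auto simp: weak_eigenspace_def)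
next
  fix x y assume "x \<in> weak_eigenspace \<mu>" "y \<in> weak_eigenspace \<mu>"
  then obtain w z where wz: "weak_eigen \<mu> x w" "weak_eigen \<mu> y z" by (auto simp: weak_eigenspace_def)
  then have g: "(x, w) \<in> graph_closure" "(y, z) \<in> graph_closure" by (auto simp: weak_eigen_def)
  have "weak_eigen \<mu> (x + y) (w + z)"
    using wz g graph_in_H[OF g(1)] graph_in_H[OF g(2)]
    by (auto simp: weak_eigen_def graph_add algebra_simps)
  then show "x + y \<in> weak_eigenspace \<mu>" by (auto simp: weak_eigenspace_def)
next
  fix c x assume "x \<in> weak_eigenspace \<mu>"
  then obtain w where w: "weak_eigen \<mu> x w" by (auto simp: weak_eigenspace_def)
  then have g: "(x, w) \<in> graph_closure" by (auto simp: weak_eigen_def)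
  have "weak_eigen \<mu> (c *\<^sub>R x) (c *\<^sub>R w)"
    using w g graph_in_H[OF g] by (auto simp: weak_eigen_def graph_scale)
  then show "c *\<^sub>R x \<in> weak_eigenspace \<mu>" by (auto simp: weak_eigenspace_def)
qed

lemma weak_eigenspaces_orthogonal:
  "u \<in> weak_eigenspace \<mu> \<Longrightarrow> v \<in> weak_eigenspace \<nu> \<Longrightarrow> \<mu> \<noteq> \<nu> \<Longrightarrow> ip u v = 0"
  using weak_eigen_orthogonal by (auto simp: weak_eigenspace_def)

text \<open>Orthogonality to the \<open>card I\<close> given vectors imposes fewer linear equations
  than there are coefficients in a combination of the \<open>m\<close> basis vectors. A nontrivial
  solution is not null by independence, so it can be normalized.\<close>

lemma multiplicity_extend_orthonormal:
  assumes m: "multiplicity_is \<mu> m" and I: "finite I" "card I < m"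
    and u: "\<And>i. i \<in> I \<Longrightarrow> u i \<in> weak_eigenspace \<mu>"
  shows "\<exists>v\<in>weak_eigenspace \<mu>. sq v = 1 \<and> (\<forall>i\<in>I. ip v (u i) = 0)"
proof -
  obtain e where e: "\<And>i. i < m \<Longrightarrow> e i \<in> weak_eigenspace \<mu>"
      "\<And>c. sq (\<Sum>i<m. c i *\<^sub>R e i) = 0 \<Longrightarrow> \<forall>i<m. c i = 0"
    using m unfolding multiplicity_is_def by blast
  have [simp]: "e i \<in> H" if "i < m" for i using e(1)[OF that] by (rule weak_eigenspace_in_H)
  have [simp]: "u i \<in> H" if "i \<in> I" for i using u[OF that] by (rule weak_eigenspace_in_H)
  obtain c where c: "\<exists>j<m. c j \<noteq> 0" "\<And>i. i \<in> I \<Longrightarrow> (\<Sum>j<m. ip (e j) (u i) * c j) = 0"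
    using homogeneous_system_solution[of I "{..<m}" "\<lambda>i j. ip (e j) (u i)"] I by auto
  define v where "v = (\<Sum>j<m. c j *\<^sub>R e j)"
  have v: "v \<in> weak_eigenspace \<mu>" unfolding v_def
    using e(1) by (intro subspace_sum[OF subspace_weak_eigenspace] subspace_scale[OF subspace_weak_eigenspace]) auto
  have [simp]: "v \<in> H" using v by (rule weak_eigenspace_in_H)
  have "sq v \<noteq> 0" using e(2)[of c] c(1) unfolding v_def by blast
  then have pos: "sq v > 0" using ip_nonneg[of v] by (simp add: less_le del: ip_nonneg)
  have orth: "ip v (u i) = 0" if "i \<in> I" for i
    using c(2)[OF that] that unfolding v_def by (subst ip_sum_left) (auto simp: mult.commute)
  show ?thesis
    by (rule bexI[of _ "(1 / sqrt (sq v)) *\<^sub>R v"])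
       (use pos orth v in \<open>auto intro: subspace_scale[OF subspace_weak_eigenspace]\<close>)
qed

text \<open>A non-null \<open>v\<close> would yield \<open>card I + 1\<close> mutually orthogonal
  non-null vectors in the span of \<open>card I\<close> vectors. A linear relation between their
  coefficient rows makes a combination of them null, and pairing it with each of them kills the
  corresponding coefficient.\<close>

lemma multiplicity_orthonormal_complete:
  assumes m: "multiplicity_is \<mu> (card I)" and I: "finite I"
    and u: "\<And>i. i \<in> I \<Longrightarrow> u i \<in> weak_eigenspace \<mu>"
    and on: "\<And>i j. i \<in> I \<Longrightarrow> j \<in> I \<Longrightarrow> ip (u i) (u j) = (if i = j then 1 else 0)"
    and v: "v \<in> weak_eigenspace \<mu>" "\<And>i. i \<in> I \<Longrightarrow> ip v (u i) = 0"
  shows "sq v = 0"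
proof (rule ccontr)
  assume v0: "sq v \<noteq> 0"
  note [simp del] = ip_diff_left ip_diff_right
  obtain e where e: "\<And>l. l < card I \<Longrightarrow> e l \<in> weak_eigenspace \<mu>"
      "\<And>u. u \<in> weak_eigenspace \<mu> \<Longrightarrow> \<exists>c. sq (u - (\<Sum>l<card I. c l *\<^sub>R e l)) = 0"
    using m unfolding multiplicity_is_def by blast
  have [simp]: "e l \<in> H" if "l < card I" for l using e(1)[OF that] by (rule weak_eigenspace_in_H)
  have [simp]: "(\<Sum>l<card I. k l *\<^sub>R e l) \<in> H" for k by (rule H_sum) simp
  \<comment> \<open>The extra vector \<open>v\<close> receives the index \<open>None\<close>, which
    cannot clash with the indices of \<open>I\<close>.\<close>
  define b where "b = (\<lambda>x. case x of None \<Rightarrow> v | Some i \<Rightarrow> u i)"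
  define J where "J = insert None (Some ` I)"
  have J: "finite J" "card J = Suc (card I)"
    using I by (auto simp: J_def card_image)
  have b: "b j \<in> weak_eigenspace \<mu>" if "j \<in> J" for j
    using that u v(1) by (auto simp: J_def b_def)
  have [simp]: "b j \<in> H" if "j \<in> J" for j using b[OF that] by (rule weak_eigenspace_in_H)
  have b_orth: "ip (b j) (b j') = 0" if "j \<in> J" "j' \<in> J" "j \<noteq> j'" for j j'
  proof -
    have "ip (u i) v = 0" if "i \<in> I" for i
      using v(2)[OF that] ip_commute[of v "u i"] v(1) u[OF that] weak_eigenspace_in_H by simp
    then show ?thesis using that v(2) on by (auto simp: J_def b_def split: option.splits)
  qed
  have b_pos: "sq (b j) \<noteq> 0" if "j \<in> J" for j
    using that on v0 by (auto simp: J_def b_def)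
  have "\<forall>j\<in>J. \<exists>c. sq (b j - (\<Sum>l<card I. c l *\<^sub>R e l)) = 0" using e(2) b by blast
  from bchoice[OF this] obtain c where c: "\<And>j. j \<in> J \<Longrightarrow> sq (b j - (\<Sum>l<card I. c j l *\<^sub>R e l)) = 0"
    by blast
  obtain d where d: "\<exists>j\<in>J. d j \<noteq> 0" "\<And>l. l < card I \<Longrightarrow> (\<Sum>j\<in>J. c j l * d j) = 0"
    using homogeneous_system_solution[of "{..<card I}" J "\<lambda>l j. c j l"] J by auto
  have "d i = 0" if i: "i \<in> J" for i
  proof -
    have "(\<Sum>j\<in>J. d j *\<^sub>R (\<Sum>l<card I. c j l *\<^sub>R e l)) = (\<Sum>l<card I. (\<Sum>j\<in>J. c j l * d j) *\<^sub>R e l)"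
      unfolding scaleR_sum_right scaleR_sum_left by (subst sum.swap) (simp add: mult.commute)
    also have "\<dots> = 0" using d(2) by simp
    finally have "(\<Sum>j\<in>J. d j *\<^sub>R b j) = (\<Sum>j\<in>J. d j *\<^sub>R (b j - (\<Sum>l<card I. c j l *\<^sub>R e l)))"
      by (simp add: scaleR_diff_right sum_subtractf)
    then have "ip (\<Sum>j\<in>J. d j *\<^sub>R b j) (b i) = (\<Sum>j\<in>J. d j * ip (b j - (\<Sum>l<card I. c j l *\<^sub>R e l)) (b i))"
      using i by (simp add: ip_sum_left)
    also have "\<dots> = 0" using c i by (intro sum.neutral ballI) (simp add: ip_null)
    finally have "0 = (\<Sum>j\<in>J. d j * ip (b j) (b i))" using i by (simp add: ip_sum_left)
    also have "\<dots> = (\<Sum>j\<in>J. if j = i then d i * sq (b i) else 0)"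
      using b_orth i by (intro sum.cong) auto
    also have "\<dots> = d i * sq (b i)" using i J(1) by simp
    finally show ?thesis using b_pos[OF i] by simp
  qed
  with d(1) show False by blast
qed

text \<open>Vectors are added one index at a time. Earlier indices with the same eigenvalue are
  fewer than its multiplicity, since \<open>Suc k\<close> itself is counted there too, so the
  eigenspace has room for one more; different eigenspaces are orthogonal anyway.\<close>

lemma eigenvalue_list_orthonormal:
  fixes lam :: "nat \<Rightarrow> real"
  assumes mult: "\<And>\<mu>. multiplicity_is \<mu> (card {i. 1 \<le> i \<and> lam i = \<mu>})"
    and lim: "filterlim lam at_top sequentially"
  shows "\<exists>u. (\<forall>i\<in>{1..k}. u i \<in> weak_eigenspace (lam i)) \<and>
    (\<forall>i\<in>{1..k}. \<forall>j\<in>{1..k}. ip (u i) (u j) = (if i = j then 1 else 0))"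
proof (induction k)
  case 0
  show ?case by simp
next
  case (Suc k)
  then obtain u where u: "\<And>i. i \<in> {1..k} \<Longrightarrow> u i \<in> weak_eigenspace (lam i)"
      "\<And>i j. i \<in> {1..k} \<Longrightarrow> j \<in> {1..k} \<Longrightarrow> ip (u i) (u j) = (if i = j then 1 else 0)" by blast
  define \<mu> where "\<mu> = lam (Suc k)"
  define I where "I = {i\<in>{1..k}. lam i = \<mu>}"
  \<comment> \<open>An infinite set has \<open>card\<close> 0, so the strict comparison of
    cardinalities below depends on finiteness, which comes from the divergence of
    \<open>lam\<close>.\<close>
  have fin: "finite {i. 1 \<le> i \<and> lam i = \<mu>}"
  proof -
    obtain N where "\<forall>i\<ge>N. \<mu> + 1 \<le> lam i"
      using lim by (auto simp: filterlim_at_top eventually_sequentially)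
    then have "{i. 1 \<le> i \<and> lam i = \<mu>} \<subseteq> {..<N}" by (force simp: not_le[symmetric])
    then show ?thesis by (rule finite_subset) simp
  qed
  have "I \<subseteq> {i. 1 \<le> i \<and> lam i = \<mu>}" "Suc k \<in> {i. 1 \<le> i \<and> lam i = \<mu>}" "Suc k \<notin> I"
    by (auto simp: I_def \<mu>_def)
  then have "I \<subset> {i. 1 \<le> i \<and> lam i = \<mu>}" by blast
  then have "card I < card {i. 1 \<le> i \<and> lam i = \<mu>}" by (rule psubset_card_mono[OF fin])
  from multiplicity_extend_orthonormal[OF mult _ this, of u] u(1) obtain v
    where v: "v \<in> weak_eigenspace \<mu>" "sq v = 1" "\<And>i. i \<in> I \<Longrightarrow> ip v (u i) = 0"
    by (auto simp: I_def)
  have orth: "ip v (u i) = 0" "ip (u i) v = 0" if "i \<in> {1..k}" for i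
  proof -
    show *: "ip v (u i) = 0"
    proof (cases "lam i = \<mu>")
      case True
      then show ?thesis using v(3) that by (auto simp: I_def)
    next
      case False
      then show ?thesis using weak_eigenspaces_orthogonal[OF v(1) u(1)[OF that]] by simp
    qed
    then show "ip (u i) v = 0"
      using ip_commute[of v "u i"] v(1) u(1)[OF that] weak_eigenspace_in_H by simp
  qed
  have Suc_set: "{1..Suc k} = insert (Suc k) {1..k}" by auto
  show ?case
    unfolding Suc_set
    by (rule exI[of _ "u(Suc k := v)"]) (use u v orth in \<open>auto simp: \<mu>_def\<close>)
qed

text \<open>By monotonicity every index with eigenvalue \<mu> below \<open>lam (Suc k)\<close> lies
  in \<open>{1..k}\<close>, so the \<open>u i\<close> already exhaust that eigenspace. For a \<mu>
  outside the list the index set is empty and the eigenspace consists of null vectors.\<close>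

lemma eigenvalue_list_complete:
  fixes lam :: "nat \<Rightarrow> real"
  assumes mult: "\<And>\<mu>. multiplicity_is \<mu> (card {i. 1 \<le> i \<and> lam i = \<mu>})"
    and mono: "mono_on {1..} lam"
    and u: "\<And>i. i \<in> {1..k} \<Longrightarrow> u i \<in> weak_eigenspace (lam i)"
    and on: "\<And>i j. i \<in> {1..k} \<Longrightarrow> j \<in> {1..k} \<Longrightarrow> ip (u i) (u j) = (if i = j then 1 else 0)"
    and v: "\<mu> < lam (Suc k)" "v \<in> weak_eigenspace \<mu>" "\<And>i. i \<in> {1..k} \<Longrightarrow> ip v (u i) = 0"
  shows "sq v = 0"
proof -
  define I where "I = {i. 1 \<le> i \<and> lam i = \<mu>}"
  have sub: "I \<subseteq> {1..k}"
  proof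
    fix i assume i: "i \<in> I"
    have "i \<le> k"
    proof (rule ccontr)
      assume "\<not> i \<le> k"
      then have "lam (Suc k) \<le> lam i" by (intro mono_onD[OF mono]) auto
      with i v(1) show False by (simp add: I_def)
    qed
    then show "i \<in> {1..k}" using i by (auto simp: I_def)
  qed
  show ?thesis
  proof (rule multiplicity_orthonormal_complete[where I = I and u = u and \<mu> = \<mu>])
    show "multiplicity_is \<mu> (card I)" using mult by (simp add: I_def)
    show "finite I" using sub by (rule finite_subset) simp
    show "u i \<in> weak_eigenspace \<mu>" if "i \<in> I" for i using u[of i] sub that by (auto simp: I_def)
    show "ip (u i) (u j) = (if i = j then 1 else 0)" if "i \<in> I" "j \<in> I" for i j
      using on sub that by blast
    show "v \<in> weak_eigenspace \<mu>" by fact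
    show "ip v (u i) = 0" if "i \<in> I" for i using v(3) sub that by blast
  qed
qed

end

text \<open>
  The weights enter only through the defining inequality of the class of couples: it says that the
  quadratic form collecting the off-diagonal terms \<open>a i j\<close>, \<open>t i j\<close> is semidefinite.
\<close>

lemma weighted_sum_inequality:
  fixes a t :: "nat \<Rightarrow> nat \<Rightarrow> real" and l W S N X Y f g :: "nat \<Rightarrow> real"
  assumes I: "finite I"
    and asym: "\<And>i j. i \<in> I \<Longrightarrow> j \<in> I \<Longrightarrow> a j i = a i j"
    and tskew: "\<And>i j. i \<in> I \<Longrightarrow> j \<in> I \<Longrightarrow> t j i = - t i j"
    and l: "\<And>i. i \<in> I \<Longrightarrow> l i < \<Lambda>"
    and pos: "\<And>i. i \<in> I \<Longrightarrow> 0 < f i" "\<And>i. i \<in> I \<Longrightarrow> 0 < g i"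
    and couple: "\<And>i j. i \<in> I \<Longrightarrow> j \<in> I \<Longrightarrow>
      (f i - f j)\<^sup>2 + ((f i)\<^sup>2 / (g i * (\<Lambda> - l i)) + (f j)\<^sup>2 / (g j * (\<Lambda> - l j))) * ((g i - g j) * (l i - l j)) \<le> 0"
    and N: "\<And>i. i \<in> I \<Longrightarrow> 0 \<le> N i"
      "\<And>i. i \<in> I \<Longrightarrow> (\<Lambda> - l i) * N i \<le> W i + (\<Sum>j\<in>I. (l i - l j) * (a i j)\<^sup>2)"
    and X: "\<And>i. i \<in> I \<Longrightarrow> 0 \<le> S i - (\<Sum>j\<in>I. (t i j)\<^sup>2)"
      "\<And>i. i \<in> I \<Longrightarrow> (1 + (\<Sum>j\<in>I. a i j * t i j))\<^sup>2 \<le> N i * (S i - (\<Sum>j\<in>I. (t i j)\<^sup>2))"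
    and W: "\<And>i. i \<in> I \<Longrightarrow> 0 \<le> W i" "\<And>i. i \<in> I \<Longrightarrow> W i \<le> W' i"
    and S: "\<And>i. i \<in> I \<Longrightarrow> 0 \<le> S i" "\<And>i. i \<in> I \<Longrightarrow> S i \<le> S' i"
  shows "(\<Sum>i\<in>I. f i) \<le> sqrt (\<Sum>i\<in>I. g i * W' i) * sqrt (\<Sum>i\<in>I. (f i)\<^sup>2 / (g i * (\<Lambda> - l i)) * S' i)"
proof -
  define h where "h = (\<lambda>i. (f i)\<^sup>2 / (g i * (\<Lambda> - l i)))"
  have gl: "0 < g i * (\<Lambda> - l i)" if "i \<in> I" for i using l[OF that] pos(2)[OF that] by simp
  have h: "0 < h i" if "i \<in> I" for i
    using gl[OF that] pos(1)[OF that] by (simp add: h_def)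
  have key: "2 * (\<Sum>i\<in>I. f i) \<le> \<alpha> * (\<Sum>i\<in>I. g i * W i) + (\<Sum>i\<in>I. h i * S i) / \<alpha>" if \<alpha>: "\<alpha> > 0" for \<alpha>
  proof -
    \<comment> \<open>AM-GM applied to the pairing estimate \<open>X(2)\<close>. Splitting
      \<open>(f i)\<^sup>2\<close> as \<open>h i\<close> times
      \<open>g i * (\<Lambda> - l i)\<close> attaches to \<open>N i\<close> exactly the factor
      \<open>\<Lambda> - l i\<close> for which an upper bound is known.\<close>
    have row: "2 * f i + 2 * f i * (\<Sum>j\<in>I. a i j * t i j)
        \<le> \<alpha> * (g i * W i) + \<alpha> * (\<Sum>j\<in>I. g i * (l i - l j) * (a i j)\<^sup>2) + h i * S i / \<alpha> - (\<Sum>j\<in>I. h i * (t i j)\<^sup>2) / \<alpha>"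
      if i: "i \<in> I" for i
    proof -
      have "(f i * (1 + (\<Sum>j\<in>I. a i j * t i j)))\<^sup>2 \<le> (f i)\<^sup>2 * (N i * (S i - (\<Sum>j\<in>I. (t i j)\<^sup>2)))"
        unfolding power_mult_distrib using X(2)[OF i] by (intro mult_left_mono) auto
      also have "(f i)\<^sup>2 = h i * (g i * (\<Lambda> - l i))"
        using l[OF i] pos(2)[OF i] by (simp add: h_def)
      finally have "(f i * (1 + (\<Sum>j\<in>I. a i j * t i j)))\<^sup>2
          \<le> (g i * ((\<Lambda> - l i) * N i)) * (h i * (S i - (\<Sum>j\<in>I. (t i j)\<^sup>2)))"
        by (simp add: mult_ac)
      then have "2 * (f i * (1 + (\<Sum>j\<in>I. a i j * t i j)))
          \<le> \<alpha> * (g i * ((\<Lambda> - l i) * N i)) + (h i * (S i - (\<Sum>j\<in>I. (t i j)\<^sup>2))) / \<alpha>"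
        using \<alpha> N(1)[OF i] X(1)[OF i] h[OF i] pos(2)[OF i] l[OF i]
        by (intro two_mult_le_of_square_le) auto
      also have "\<dots> \<le> \<alpha> * (g i * (W i + (\<Sum>j\<in>I. (l i - l j) * (a i j)\<^sup>2))) + (h i * (S i - (\<Sum>j\<in>I. (t i j)\<^sup>2))) / \<alpha>"
        using \<alpha> N(2)[OF i] pos(2)[OF i] by (intro add_right_mono mult_left_mono) auto
      finally show ?thesis
        by (simp add: algebra_simps sum_distrib_left diff_divide_distrib)
    qed
    have sym: "2 * (\<Sum>i\<in>I. \<Sum>j\<in>I. B i j) = (\<Sum>i\<in>I. \<Sum>j\<in>I. B i j + B j i)" for B :: "nat \<Rightarrow> nat \<Rightarrow> real"
      using sum.swap[of "\<lambda>i j. B j i" I I] by (simp add: sum.distrib)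
    \<comment> \<open>Adding the terms for (i, j) and (j, i), the symmetry of \<open>a\<close> and
      skewness of \<open>t\<close> leave 2 (f i - f j) a t + \<alpha> G a^2 + K t^2 / \<alpha>. The
      inequality of the couple says \<open>(f i - f j)\<^sup>2 \<le> G * K\<close>, the discriminant
      condition for this form to be nonnegative.\<close>
    have pair: "0 \<le> (2 * f i * (a i j * t i j) - \<alpha> * (g i * (l i - l j) * (a i j)\<^sup>2) + h i * (t i j)\<^sup>2 / \<alpha>)
        + (2 * f j * (a j i * t j i) - \<alpha> * (g j * (l j - l i) * (a j i)\<^sup>2) + h j * (t j i)\<^sup>2 / \<alpha>)"
      if i: "i \<in> I" and j: "j \<in> I" for i j
    proof -
      define G where "G = - ((g i - g j) * (l i - l j))"
      define K where "K = h i + h j"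
      have K: "K > 0" using h i j by (simp add: K_def add_pos_pos)
      have fGK: "(f i - f j)\<^sup>2 \<le> G * K" using couple[OF i j] by (simp add: G_def K_def h_def algebra_simps)
      then have "0 \<le> G * K" using zero_le_power2 order_trans by blast
      then have G: "G \<ge> 0" using K by (simp add: zero_le_mult_iff)
      have "2 * \<bar>(f i - f j) * (a i j * t i j)\<bar> \<le> \<alpha> * (G * (a i j)\<^sup>2) + K * (t i j)\<^sup>2 / \<alpha>"
      proof (rule two_mult_le_of_square_le)
        have "(\<bar>(f i - f j) * (a i j * t i j)\<bar>)\<^sup>2 = (f i - f j)\<^sup>2 * ((a i j)\<^sup>2 * (t i j)\<^sup>2)"
          by (simp add: power_mult_distrib)
        also have "\<dots> \<le> (G * K) * ((a i j)\<^sup>2 * (t i j)\<^sup>2)" using fGK by (intro mult_right_mono) auto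
        finally show "(\<bar>(f i - f j) * (a i j * t i j)\<bar>)\<^sup>2 \<le> G * (a i j)\<^sup>2 * (K * (t i j)\<^sup>2)"
          by (simp add: mult_ac)
      qed (use G K \<alpha> in auto)
      then have "0 \<le> 2 * ((f i - f j) * (a i j * t i j)) + \<alpha> * (G * (a i j)\<^sup>2) + K * (t i j)\<^sup>2 / \<alpha>"
        by linarith
      then show ?thesis using asym[OF i j] tskew[OF i j]
        by (simp add: G_def K_def algebra_simps add_divide_distrib)
    qed
    have "0 \<le> (\<Sum>i\<in>I. \<Sum>j\<in>I. (2 * f i * (a i j * t i j) - \<alpha> * (g i * (l i - l j) * (a i j)\<^sup>2) + h i * (t i j)\<^sup>2 / \<alpha>)
        + (2 * f j * (a j i * t j i) - \<alpha> * (g j * (l j - l i) * (a j i)\<^sup>2) + h j * (t j i)\<^sup>2 / \<alpha>))"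
      by (intro sum_nonneg pair)
    also have "\<dots> = 2 * (\<Sum>i\<in>I. \<Sum>j\<in>I. 2 * f i * (a i j * t i j) - \<alpha> * (g i * (l i - l j) * (a i j)\<^sup>2) + h i * (t i j)\<^sup>2 / \<alpha>)"
      by (rule sym[symmetric])
    finally have off: "0 \<le> (\<Sum>i\<in>I. \<Sum>j\<in>I. 2 * f i * (a i j * t i j) - \<alpha> * (g i * (l i - l j) * (a i j)\<^sup>2) + h i * (t i j)\<^sup>2 / \<alpha>)"
      by simp
    have "(\<Sum>i\<in>I. 2 * f i + 2 * f i * (\<Sum>j\<in>I. a i j * t i j))
        \<le> (\<Sum>i\<in>I. \<alpha> * (g i * W i) + \<alpha> * (\<Sum>j\<in>I. g i * (l i - l j) * (a i j)\<^sup>2) + h i * S i / \<alpha> - (\<Sum>j\<in>I. h i * (t i j)\<^sup>2) / \<alpha>)"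
      by (intro sum_mono row)
    with off show ?thesis
      by (simp add: sum.distrib sum_subtractf sum_distrib_left sum_divide_distrib mult.assoc)
  qed
  have "(\<Sum>i\<in>I. f i) \<le> sqrt (\<Sum>i\<in>I. g i * W i) * sqrt (\<Sum>i\<in>I. h i * S i)"
    using key W(1) S(1) h pos
    by (intro le_sqrt_mult_sqrt_if_AM_bounds) (auto intro!: sum_nonneg mult_nonneg_nonneg simp: less_imp_le)
  also have "\<dots> \<le> sqrt (\<Sum>i\<in>I. g i * W' i) * sqrt (\<Sum>i\<in>I. h i * S' i)"
    using W S h pos order_trans[OF W(1) W(2)]
    by (intro mult_mono real_sqrt_le_mono sum_mono mult_left_mono) (auto intro!: sum_nonneg mult_nonneg_nonneg simp: less_imp_le)
  finally show ?thesis by (simp add: h_def)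
qed

text \<open>In the application \<open>F\<close> is multiplication by ln x_n, bounded on all of L2
  with squared norm at most \<open>B\<close>; \<open>T\<close> is its commutator with the Laplacian,
  a first-order operator used on test vectors only; and \<open>c\<close> is (n - 1)^2.\<close>

locale commutator_pair = symmetric_operator H ip D L
  for H :: "'v::real_vector set" and ip D L +
  fixes F T :: "'v \<Rightarrow> 'v" and B c :: real
  assumes F_in_H [simp]: "u \<in> H \<Longrightarrow> F u \<in> H"
    and F_diff: "u \<in> H \<Longrightarrow> v \<in> H \<Longrightarrow> F (u - v) = F u - F v"
    and F_bounded: "u \<in> H \<Longrightarrow> ip (F u) (F u) \<le> B * ip u u"
    and F_symmetric: "u \<in> H \<Longrightarrow> v \<in> H \<Longrightarrow> ip (F u) v = ip u (F v)"
    and F_in_D [simp]: "\<phi> \<in> D \<Longrightarrow> F \<phi> \<in> D"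
    and T_in_D [simp]: "\<phi> \<in> D \<Longrightarrow> T \<phi> \<in> D"
    and T_diff: "\<phi> \<in> D \<Longrightarrow> \<psi> \<in> D \<Longrightarrow> T (\<phi> - \<psi>) = T \<phi> - T \<psi>"
    and commutator_LF: "\<phi> \<in> D \<Longrightarrow> L (F \<phi>) = F (L \<phi>) + T \<phi>"
    and commutator_TF: "\<phi> \<in> D \<Longrightarrow> T (F \<phi>) = F (T \<phi>) + 2 *\<^sub>R \<phi>"
    and T_bound: "\<phi> \<in> D \<Longrightarrow> ip (T \<phi>) (T \<phi>) \<le> - 4 * ip \<phi> (L \<phi>) - c * ip \<phi> \<phi>"
    and c_nonneg: "0 \<le> c"
begin

text \<open>\<open>T\<close> is the commutator of the two symmetric operators \<open>L\<close> and
  \<open>F\<close>.\<close>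

lemma T_skew:
  assumes "\<phi> \<in> D" "\<psi> \<in> D"
  shows "ip (T \<phi>) \<psi> = - ip \<phi> (T \<psi>)"
proof -
  have T: "T \<theta> = L (F \<theta>) - F (L \<theta>)" if "\<theta> \<in> D" for \<theta> using commutator_LF[OF that] by simp
  show ?thesis using assms by (simp add: T F_symmetric L_symmetric)
qed

text \<open>Skewness moves \<open>T\<close> onto \<open>F \<phi>\<close>, where the commutator
  relation contributes 2 \<phi>: the inner product equals minus itself minus twice the squared
  norm.\<close>

lemma T_F_inner:
  assumes "\<phi> \<in> D"
  shows "ip (T \<phi>) (F \<phi>) = - ip \<phi> \<phi>"
proof -
  have "ip (T \<phi>) (F \<phi>) = - ip \<phi> (F (T \<phi>) + 2 *\<^sub>R \<phi>)" using T_skew[of \<phi> "F \<phi>"] assms by (simp add: commutator_TF)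
  also have "\<dots> = - ip (F \<phi>) (T \<phi>) - 2 * ip \<phi> \<phi>" using assms by (simp add: F_symmetric)
  also have "ip (F \<phi>) (T \<phi>) = ip (T \<phi>) (F \<phi>)" using assms by (intro ip_commute) auto
  finally show ?thesis by simp
qed

lemma conv_F:
  assumes "conv X x" and [simp]: "\<And>m. X m \<in> H" "x \<in> H"
  shows "conv (\<lambda>m. F (X m)) (F x)"
  unfolding conv_def
proof (rule Lim_null_comparison)
  show "\<forall>\<^sub>F m in sequentially. norm (sq (F (X m) - F x)) \<le> B * sq (X m - x)"
    using F_bounded[of "X _ - x"] by (simp add: F_diff[symmetric] del: ip_diff_left ip_diff_right)
  have "(\<lambda>m. B * sq (X m - x)) \<longlonglongrightarrow> B * 0"
    using assms(1) by (intro tendsto_intros) (simp add: conv_def)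
  then show "(\<lambda>m. B * sq (X m - x)) \<longlonglongrightarrow> 0" by simp
qed

text \<open>The bound on \<open>T\<close> together with \<open>- 4 * ip \<psi> (L \<psi>) \<le> 2 *
  sq \<psi> + 2 * sq (L \<psi>)\<close> controls \<open>T\<close> by the graph norm. So a sequence
  approximating \<open>u\<close> and \<open>w\<close> makes \<open>T\<close> converge as well, and
  the limit \<open>t\<close> plays the role of T u.\<close>

lemma graph_commutator:
  assumes "(u, w) \<in> graph_closure"
  obtains t \<phi> where "u \<in> H" "w \<in> H" "t \<in> H" "\<And>m. \<phi> m \<in> D"
    "conv \<phi> u" "conv (\<lambda>m. L (\<phi> m)) w" "conv (\<lambda>m. T (\<phi> m)) t"
proof -
  note [simp del] = ip_diff_left ip_diff_right ip_add_left ip_add_right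
  obtain \<phi> where \<phi>: "u \<in> H" "w \<in> H" "\<And>m. \<phi> m \<in> D" "conv \<phi> u" "conv (\<lambda>m. L (\<phi> m)) w"
    using assms by (rule graph_closureE) (rule that)
  note [simp] = \<phi>(1-3)
  have "\<exists>N. \<forall>m\<ge>N. \<forall>n\<ge>N. sq (T (\<phi> m) - T (\<phi> n)) < e" if e: "e > 0" for e
  proof -
    obtain N1 where N1: "\<And>m n. m \<ge> N1 \<Longrightarrow> n \<ge> N1 \<Longrightarrow> sq (\<phi> m - \<phi> n) < e / 4"
      using conv_imp_cauchy[OF \<phi>(4), of "e / 4"] e by auto
    obtain N2 where N2: "\<And>m n. m \<ge> N2 \<Longrightarrow> n \<ge> N2 \<Longrightarrow> sq (L (\<phi> m) - L (\<phi> n)) < e / 4"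
      using conv_imp_cauchy[OF \<phi>(5), of "e / 4"] e by auto
    have "sq (T (\<phi> m) - T (\<phi> n)) < e" if "m \<ge> max N1 N2" "n \<ge> max N1 N2" for m n
    proof -
      define \<psi> where "\<psi> = \<phi> m - \<phi> n"
      have [simp]: "\<psi> \<in> D" by (simp add: \<psi>_def)
      have "sq (T (\<phi> m) - T (\<phi> n)) = sq (T \<psi>)" by (simp add: \<psi>_def T_diff)
      also have "\<dots> \<le> - 4 * ip \<psi> (L \<psi>)"
        using T_bound[of \<psi>] mult_nonneg_nonneg[OF c_nonneg ip_nonneg[of \<psi>]] by simp
      also have "\<dots> \<le> 2 * sq \<psi> + 2 * sq (L \<psi>)"
        using ip_nonneg[of "\<psi> + L \<psi>"] by (simp add: sq_add)
      also have "\<dots> < e"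
        using N1[of m n] N2[of m n] that by (simp add: \<psi>_def L_diff)
      finally show ?thesis .
    qed
    then show ?thesis by blast
  qed
  then obtain t where "t \<in> H" "conv (\<lambda>m. T (\<phi> m)) t"
    by (rule cauchy_imp_conv[of "\<lambda>m. T (\<phi> m)", rotated]) auto
  with \<phi> show ?thesis by (intro that)
qed

text \<open>
  The argument of Ilias and Makhoul: the trial vectors \<open>F u\<^sub>i - (\<Sum>j. a\<^sub>i\<^sub>j u\<^sub>j)\<close> are orthogonal to
  all the \<open>u\<^sub>j\<close>, and pairing them with \<open>T u\<^sub>i\<close> produces the constant \<open>1\<close> because \<open>[T, F] = 2\<close>.
\<close>

theorem clamped_commutator_inequality:
  fixes u w :: "nat \<Rightarrow> 'v" and l f g :: "nat \<Rightarrow> real"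
  assumes I: "finite I" and e: "\<And>i. i \<in> I \<Longrightarrow> weak_eigen (l i) (u i) (w i)"
    and on: "\<And>i j. i \<in> I \<Longrightarrow> j \<in> I \<Longrightarrow> ip (u i) (u j) = (if i = j then 1 else 0)"
    and ray: "\<And>v z. (v, z) \<in> graph_closure \<Longrightarrow> (\<And>i. i \<in> I \<Longrightarrow> ip v (u i) = 0) \<Longrightarrow> \<Lambda> * sq v \<le> sq z"
    and l: "\<And>i. i \<in> I \<Longrightarrow> l i < \<Lambda>"
    and pos: "\<And>i. i \<in> I \<Longrightarrow> 0 < f i" "\<And>i. i \<in> I \<Longrightarrow> 0 < g i"
    and couple: "\<And>i j. i \<in> I \<Longrightarrow> j \<in> I \<Longrightarrow>
      (f i - f j)\<^sup>2 + ((f i)\<^sup>2 / (g i * (\<Lambda> - l i)) + (f j)\<^sup>2 / (g j * (\<Lambda> - l j))) * ((g i - g j) * (l i - l j)) \<le> 0"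
  shows "(\<Sum>i\<in>I. f i) \<le> sqrt (\<Sum>i\<in>I. g i * (6 * sqrt (l i) - c))
      * sqrt (\<Sum>i\<in>I. (f i)\<^sup>2 / (g i * (\<Lambda> - l i)) * (4 * sqrt (l i) - c))"
proof -
  note [simp del] = ip_diff_left ip_diff_right ip_add_left ip_add_right
  have gu: "(u i, w i) \<in> graph_closure" if "i \<in> I" for i using e[OF that] by (simp add: weak_eigen_def)
  note [simp] = graph_in_H[OF gu]
  have "\<forall>i\<in>I. \<exists>t \<phi>. t \<in> H \<and> (\<forall>m. \<phi> m \<in> D) \<and>
      conv \<phi> (u i) \<and> conv (\<lambda>m. L (\<phi> m)) (w i) \<and> conv (\<lambda>m. T (\<phi> m)) t"
    using graph_commutator[OF gu] by metis
  then obtain t \<phi> where t [simp]: "\<And>i. i \<in> I \<Longrightarrow> t i \<in> H"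
    and \<phi> [simp]: "\<And>i m. i \<in> I \<Longrightarrow> \<phi> i m \<in> D"
    and c\<phi>: "\<And>i. i \<in> I \<Longrightarrow> conv (\<phi> i) (u i)" "\<And>i. i \<in> I \<Longrightarrow> conv (\<lambda>m. L (\<phi> i m)) (w i)"
      "\<And>i. i \<in> I \<Longrightarrow> conv (\<lambda>m. T (\<phi> i m)) (t i)"
    by metis
  have t_skew: "ip (t i) (u j) = - ip (u i) (t j)" if i: "i \<in> I" and j: "j \<in> I" for i j
  proof -
    have "(\<lambda>m. ip (T (\<phi> i m)) (\<phi> j m)) \<longlonglongrightarrow> ip (t i) (u j)"
      using c\<phi> i j by (intro conv_ip) auto
    moreover have "(\<lambda>m. - ip (\<phi> i m) (T (\<phi> j m))) \<longlonglongrightarrow> - ip (u i) (t j)"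
      using c\<phi> i j by (intro tendsto_minus conv_ip) auto
    ultimately show ?thesis using i j LIMSEQ_unique by (simp add: T_skew) blast
  qed
  have tF: "ip (t i) (F (u i)) = - 1" if i: "i \<in> I" for i
  proof -
    have "(\<lambda>m. ip (T (\<phi> i m)) (F (\<phi> i m))) \<longlonglongrightarrow> ip (t i) (F (u i))"
      using c\<phi> i by (intro conv_ip conv_F) auto
    moreover have "(\<lambda>m. - ip (\<phi> i m) (\<phi> i m)) \<longlonglongrightarrow> - ip (u i) (u i)"
      using c\<phi> i by (intro tendsto_minus conv_ip) auto
    ultimately show ?thesis using i LIMSEQ_unique on by (simp add: T_F_inner) blast
  qed
  have tt: "sq (t i) \<le> - 4 * ip (u i) (w i) - c" if i: "i \<in> I" for i
  proof -
    have a: "(\<lambda>m. sq (T (\<phi> i m))) \<longlonglongrightarrow> sq (t i)" using c\<phi> i by (intro conv_ip) auto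
    have b: "(\<lambda>m. - 4 * ip (\<phi> i m) (L (\<phi> i m)) - c * sq (\<phi> i m)) \<longlonglongrightarrow> - 4 * ip (u i) (w i) - c * sq (u i)"
      using c\<phi> i by (intro tendsto_intros conv_ip) auto
    have "sq (t i) \<le> - 4 * ip (u i) (w i) - c * sq (u i)"
      by (rule LIMSEQ_le[OF a b]) (use T_bound i in auto)
    then show ?thesis using on i by simp
  qed
  have gF: "(F (u i), F (w i) + t i) \<in> graph_closure" if i: "i \<in> I" for i
    by (rule graph_closureI[where \<phi> = "\<lambda>m. F (\<phi> i m)"])
       (use c\<phi> i in \<open>auto simp: commutator_LF intro!: conv_F conv_add\<close>)
  \<comment> \<open>On test vectors L F F = F F L + 2 F T + 2. The limit puts F^2 u into the domain
    of the closure, so the eigenvalue equation may be tested against it.\<close>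
  have gFF: "(F (F (u i)), F (F (w i)) + F (t i) + (F (t i) + 2 *\<^sub>R u i)) \<in> graph_closure" if i: "i \<in> I" for i
  proof (rule graph_closureI[where \<phi> = "\<lambda>m. F (F (\<phi> i m))"])
    have "L (F (F (\<phi> i m))) = F (F (L (\<phi> i m))) + F (T (\<phi> i m)) + (F (T (\<phi> i m)) + 2 *\<^sub>R \<phi> i m)" for m
    proof -
      have "L (F (F (\<phi> i m))) = F (L (F (\<phi> i m))) + T (F (\<phi> i m))" using i by (simp add: commutator_LF)
      also have "F (L (F (\<phi> i m))) = F (F (L (\<phi> i m))) + F (T (\<phi> i m))"
        using F_diff[of "L (F (\<phi> i m))" "T (\<phi> i m)"] i by (simp add: commutator_LF)
      finally show ?thesis using i by (simp add: commutator_TF)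
    qed
    then show "conv (\<lambda>m. L (F (F (\<phi> i m)))) (F (F (w i)) + F (t i) + (F (t i) + 2 *\<^sub>R u i))"
      using c\<phi> i by (auto intro!: conv_F conv_add conv_scale)
  qed (use c\<phi> i in \<open>auto intro!: conv_F\<close>)
  \<comment> \<open>The equation tested against \<open>u i\<close> itself gives energy
    \<open>l i\<close>; Cauchy-Schwarz then bounds the Dirichlet integral
    \<open>- ip (u i) (w i)\<close> by the square root.\<close>
  have ww: "sq (w i) = l i" if i: "i \<in> I" for i using weak_eigen_graph[OF e gu] on i by simp
  have uw: "- ip (u i) (w i) \<le> sqrt (l i)" if i: "i \<in> I" for i
    using abs_ip_le[of "u i" "w i"] ww on i by simp
  define a where "a = (\<lambda>i j. ip (F (u i)) (u j))"
  define \<tau> where "\<tau> = (\<lambda>i j. ip (t i) (u j))"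
  have a_sym: "a j i = a i j" if "i \<in> I" "j \<in> I" for i j
    unfolding a_def using that ip_commute[of "F (u j)" "u i"] F_symmetric[of "u i" "u j"] by simp
  define x where "x = (\<lambda>i. F (u i) - (\<Sum>j\<in>I. a i j *\<^sub>R u j))"
  define y where "y = (\<lambda>i. F (w i) + t i - (\<Sum>j\<in>I. a i j *\<^sub>R w j))"
  \<comment> \<open>\<open>t i\<close> is projected as well: its inner product with
    \<open>x i\<close> does not change, while its squared norm drops by the squares of the
    \<open>\<tau> i j\<close>, which later balance the off-diagonal terms.\<close>
  define y' where "y' = (\<lambda>i. t i - (\<Sum>j\<in>I. \<tau> i j *\<^sub>R u j))"
  have xH [simp]: "x i \<in> H" "y' i \<in> H" if "i \<in> I" for i using that by (auto simp: x_def y'_def)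
  have gx: "(x i, y i) \<in> graph_closure" if "i \<in> I" for i
    unfolding x_def y_def using that gu by (intro graph_diff graph_sum graph_scale gF)
  have delta: "(\<Sum>j\<in>I. b j * ip (u j) (u k)) = b k" "(\<Sum>j\<in>I. b j * ip (u k) (u j)) = b k" if "k \<in> I" for b k
  proof -
    have "(\<Sum>j\<in>I. b j * ip (u j) (u k)) = (\<Sum>j\<in>I. if j = k then b k else 0)"
      using on that by (intro sum.cong) auto
    then show "(\<Sum>j\<in>I. b j * ip (u j) (u k)) = b k" using that I by simp
    have "(\<Sum>j\<in>I. b j * ip (u k) (u j)) = (\<Sum>j\<in>I. if j = k then b k else 0)"
      using on that by (intro sum.cong) auto
    then show "(\<Sum>j\<in>I. b j * ip (u k) (u j)) = b k" using that I by simp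
  qed
  have x_orth: "ip (x i) (u k) = 0" if "i \<in> I" "k \<in> I" for i k
    using that by (simp add: x_def ip_diff_left ip_sum_left delta) (simp add: a_def)
  have x_orth': "ip (u k) (x i) = 0" if "i \<in> I" "k \<in> I" for i k
    using x_orth[OF that] ip_commute[of "u k" "x i"] that by simp
  have sqx: "sq (x i) = sq (F (u i)) - (\<Sum>j\<in>I. (a i j)\<^sup>2)" if i: "i \<in> I" for i
  proof -
    have "sq (x i) = ip (x i) (F (u i)) - (\<Sum>j\<in>I. a i j * ip (x i) (u j))"
      using i by (subst (2) x_def) (simp add: ip_diff_right ip_sum_right)
    also have "\<dots> = ip (x i) (F (u i))" using x_orth i by simp
    also have "\<dots> = sq (F (u i)) - (\<Sum>j\<in>I. a i j * ip (u j) (F (u i)))"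
      using i by (simp add: x_def ip_diff_left ip_sum_left)
    also have "(\<Sum>j\<in>I. a i j * ip (u j) (F (u i))) = (\<Sum>j\<in>I. (a i j)\<^sup>2)"
      using i ip_commute[of "F (u i)"] by (intro sum.cong) (auto simp: a_def power2_eq_square)
    finally show ?thesis .
  qed
  \<comment> \<open>The excess of the energy of \<open>F (u i)\<close> over \<open>l i\<close> times
    its squared norm; it is computed by testing the equation against F^2 u.\<close>
  define W where "W = (\<lambda>i. sq (t i) - 2 * ip (u i) (w i))"
  have FF: "sq (F (w i) + t i) = W i + l i * sq (F (u i))" if i: "i \<in> I" for i
  proof -
    have "ip (w i) (F (F (w i)) + F (t i) + (F (t i) + 2 *\<^sub>R u i)) = l i * ip (u i) (F (F (u i)))"
      by (rule weak_eigen_graph[OF e gFF]) (use i in auto)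
    moreover have "ip (w i) (F (F (w i)) + F (t i) + (F (t i) + 2 *\<^sub>R u i))
        = sq (F (w i)) + 2 * ip (F (w i)) (t i) + 2 * ip (u i) (w i)"
      using i by (simp add: ip_add_right F_symmetric ip_commute[of "w i" "u i"])
    moreover have "ip (u i) (F (F (u i))) = sq (F (u i))" using i by (simp add: F_symmetric)
    ultimately show ?thesis using i by (simp add: W_def sq_add)
  qed
  \<comment> \<open>The eigenvalue equation turns orthogonality of \<open>x i\<close> to
    \<open>u j\<close> into orthogonality of \<open>y i\<close> to \<open>w j\<close>, so the
    projection lowers the energy by exactly \<open>l j * (a i j)\<^sup>2\<close> for each
    \<open>j\<close>.\<close>
  have sqy: "sq (y i) = sq (F (w i) + t i) - (\<Sum>j\<in>I. l j * (a i j)\<^sup>2)" if i: "i \<in> I" for i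
  proof -
    have y_in [simp]: "y i \<in> H" using graph_in_H[OF gx[OF i]] by simp
    have wy: "ip (y i) (w j) = 0" if j: "j \<in> I" for j
      using weak_eigen_graph[OF e[OF j] gx[OF i]] x_orth'[OF i j] ip_commute[of "y i" "w j"] i j by simp
    have wF: "ip (w j) (F (w i) + t i) = l j * a i j" if j: "j \<in> I" for j
      using weak_eigen_graph[OF e[OF j] gF[OF i]] ip_commute[of "u j" "F (u i)"] i j by (simp add: a_def)
    have "sq (y i) = ip (y i) (F (w i) + t i) - (\<Sum>j\<in>I. a i j * ip (y i) (w j))"
      using i by (subst (2) y_def) (simp add: ip_diff_right ip_sum_right)
    also have "\<dots> = ip (y i) (F (w i) + t i)" using wy by simp
    also have "\<dots> = sq (F (w i) + t i) - (\<Sum>j\<in>I. a i j * ip (w j) (F (w i) + t i))"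
      using i by (simp add: y_def ip_diff_left ip_sum_left)
    also have "(\<Sum>j\<in>I. a i j * ip (w j) (F (w i) + t i)) = (\<Sum>j\<in>I. l j * (a i j)\<^sup>2)"
      by (intro sum.cong) (auto simp: wF power2_eq_square)
    finally show ?thesis .
  qed
  have sqy': "sq (y' i) = sq (t i) - (\<Sum>j\<in>I. (\<tau> i j)\<^sup>2)" if i: "i \<in> I" for i
  proof -
    have o: "ip (y' i) (u k) = 0" if "k \<in> I" for k
      using that i by (simp add: y'_def ip_diff_left ip_sum_left delta) (simp add: \<tau>_def)
    have "sq (y' i) = ip (y' i) (t i) - (\<Sum>j\<in>I. \<tau> i j * ip (y' i) (u j))"
      using i by (subst (2) y'_def) (simp add: ip_diff_right ip_sum_right)
    also have "\<dots> = ip (y' i) (t i)" using o by simp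
    also have "\<dots> = sq (t i) - (\<Sum>j\<in>I. \<tau> i j * ip (u j) (t i))"
      using i by (simp add: y'_def ip_diff_left ip_sum_left)
    also have "(\<Sum>j\<in>I. \<tau> i j * ip (u j) (t i)) = (\<Sum>j\<in>I. (\<tau> i j)\<^sup>2)"
      using i ip_commute[of "t i"] by (intro sum.cong) (auto simp: \<tau>_def power2_eq_square)
    finally show ?thesis .
  qed
  have pairing: "(1 + (\<Sum>j\<in>I. a i j * \<tau> i j))\<^sup>2 \<le> sq (x i) * (sq (t i) - (\<Sum>j\<in>I. (\<tau> i j)\<^sup>2))" if i: "i \<in> I" for i
  proof -
    have "ip (y' i) (x i) = ip (t i) (x i)"
      using i x_orth' by (simp add: y'_def ip_diff_left ip_sum_left)
    also have "\<dots> = - 1 - (\<Sum>j\<in>I. a i j * \<tau> i j)"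
      using i tF by (simp add: x_def ip_diff_right ip_sum_right \<tau>_def)
    finally have "1 + (\<Sum>j\<in>I. a i j * \<tau> i j) = - ip (y' i) (x i)" by simp
    then have "(1 + (\<Sum>j\<in>I. a i j * \<tau> i j))\<^sup>2 = (ip (y' i) (x i))\<^sup>2" by simp
    also have "\<dots> \<le> sq (y' i) * sq (x i)" using i by (intro cauchy_schwarz) auto
    finally show ?thesis using sqy'[OF i] by (simp add: mult.commute)
  qed
  show ?thesis
  proof (rule weighted_sum_inequality[OF I, where a = a and t = \<tau> and N = "\<lambda>i. sq (x i)" and W = W and S = "\<lambda>i. sq (t i)"])
    fix i assume i: "i \<in> I"
    show "0 \<le> sq (x i)" using i by simp
    show "0 \<le> sq (t i) - (\<Sum>j\<in>I. (\<tau> i j)\<^sup>2)" using sqy'[OF i] i ip_nonneg[of "y' i"] by simp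
    show "(1 + (\<Sum>j\<in>I. a i j * \<tau> i j))\<^sup>2 \<le> sq (x i) * (sq (t i) - (\<Sum>j\<in>I. (\<tau> i j)\<^sup>2))" using pairing[OF i] .
    show "0 \<le> sq (t i)" using i by simp
    show "sq (t i) \<le> 4 * sqrt (l i) - c" using tt[OF i] uw[OF i] by simp
    \<comment> \<open>Four Dirichlet integrals come from the bound on \<open>T\<close> and two from
      \<open>W\<close> itself, each at most \<open>sqrt (l i)\<close>.\<close>
    show "W i \<le> 6 * sqrt (l i) - c" using tt[OF i] uw[OF i] by (simp add: W_def)
    \<comment> \<open>The Dirichlet integral is nonnegative because the bound on \<open>T\<close>
      dominates a squared norm and \<open>c\<close> is nonnegative.\<close>
    have "- 4 * ip (u i) (w i) \<ge> 0" using tt[OF i] c_nonneg ip_nonneg[OF t[OF i]] by linarith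
    then show "0 \<le> W i" unfolding W_def using ip_nonneg[OF t[OF i]] by linarith
    have "\<Lambda> * sq (x i) \<le> sq (y i)" using gx[OF i] x_orth[OF i] by (intro ray)
    then have "(\<Lambda> - l i) * sq (x i) \<le> W i + l i * (\<Sum>j\<in>I. (a i j)\<^sup>2) - (\<Sum>j\<in>I. l j * (a i j)\<^sup>2)"
      unfolding sqy[OF i] FF[OF i] sqx[OF i] by (simp add: algebra_simps)
    then show "(\<Lambda> - l i) * sq (x i) \<le> W i + (\<Sum>j\<in>I. (l i - l j) * (a i j)\<^sup>2)"
      by (simp add: left_diff_distrib sum_subtractf sum_distrib_left)
  next
    fix i j assume ij: "i \<in> I" "j \<in> I"
    show "a j i = a i j" using a_sym ij .
    show "\<tau> j i = - \<tau> i j" unfolding \<tau>_def using t_skew[OF ij(2,1)] ij ip_commute[of "u j" "t i"] by simp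
  qed (use l pos couple in auto)
qed

end

section \<open>Square-integrable functions\<close>

text \<open>With the pointwise structure the abstract locales apply to functions themselves instead
  of equivalence classes.\<close>

instantiation "fun" :: (type, real_vector) real_vector
begin

definition "c *\<^sub>R f = (\<lambda>x. c *\<^sub>R f x)"

instance
  by standard (auto simp: scaleR_fun_def fun_eq_iff algebra_simps)

end

lemma scaleR_fun_apply [simp]: "(c *\<^sub>R f) x = c *\<^sub>R f x"
  by (simp add: scaleR_fun_def)

lemma sum_fun_apply: "(\<Sum>i\<in>I. f i) x = (\<Sum>i\<in>I. f i x)"
  by (induction I rule: infinite_finite_induct) auto

definition L2 :: "'a measure \<Rightarrow> ('a \<Rightarrow> real) set" where
  "L2 M = {u. u \<in> borel_measurable M \<and> integrable M (\<lambda>x. (u x)\<^sup>2)}"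

definition l2_inner :: "'a measure \<Rightarrow> ('a \<Rightarrow> real) \<Rightarrow> ('a \<Rightarrow> real) \<Rightarrow> real" where
  "l2_inner M u v = (\<integral>x. u x * v x \<partial>M)"

lemma L2_measurable [measurable_dest]: "u \<in> L2 M \<Longrightarrow> u \<in> borel_measurable M"
  by (simp add: L2_def)

lemma L2_integrable_square: "u \<in> L2 M \<Longrightarrow> integrable M (\<lambda>x. (u x)\<^sup>2)"
  by (simp add: L2_def)

lemma L2_integrable_mult:
  assumes "u \<in> L2 M" "v \<in> L2 M"
  shows "integrable M (\<lambda>x. u x * v x)"
proof (rule Bochner_Integration.integrable_bound)
  show "integrable M (\<lambda>x. (u x)\<^sup>2 + (v x)\<^sup>2)"
    using assms by (intro Bochner_Integration.integrable_add L2_integrable_square)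
  show "(\<lambda>x. u x * v x) \<in> borel_measurable M" using assms by measurable
  have "\<bar>a * b\<bar> \<le> a\<^sup>2 + b\<^sup>2" for a b :: real
  proof -
    have "2 * \<bar>a * b\<bar> \<le> a\<^sup>2 + b\<^sup>2"
      using zero_le_power2[of "\<bar>a\<bar> - \<bar>b\<bar>"] by (simp add: power2_diff abs_mult)
    then show ?thesis using zero_le_power2[of a] zero_le_power2[of b] by linarith
  qed
  then show "AE x in M. norm (u x * v x) \<le> norm ((u x)\<^sup>2 + (v x)\<^sup>2)" by simp
qed

lemma L2_bounded_mult:
  assumes "u \<in> L2 M" "h \<in> borel_measurable M" "\<And>x. x \<in> space M \<Longrightarrow> \<bar>h x\<bar> \<le> B"
  shows "(\<lambda>x. h x * u x) \<in> L2 M" "l2_inner M (\<lambda>x. h x * u x) (\<lambda>x. h x * u x) \<le> B\<^sup>2 * l2_inner M u u"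
proof -
  have le: "(h x * u x)\<^sup>2 \<le> B\<^sup>2 * (u x)\<^sup>2" if "x \<in> space M" for x
  proof -
    have "(h x)\<^sup>2 \<le> B\<^sup>2"
      using power_mono[OF assms(3)[OF that] abs_ge_zero, of 2] by simp
    then show ?thesis by (simp add: power_mult_distrib mult_right_mono)
  qed
  have i: "integrable M (\<lambda>x. (h x * u x)\<^sup>2)"
  proof (rule Bochner_Integration.integrable_bound)
    show "integrable M (\<lambda>x. B\<^sup>2 * (u x)\<^sup>2)" using assms(1) by (intro integrable_mult_right L2_integrable_square)
    show "(\<lambda>x. (h x * u x)\<^sup>2) \<in> borel_measurable M" using assms(1,2) by measurable
    show "AE x in M. norm ((h x * u x)\<^sup>2) \<le> norm (B\<^sup>2 * (u x)\<^sup>2)" using le by simp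
  qed
  have "(\<lambda>x. h x * u x) \<in> borel_measurable M" using assms(1,2) by measurable
  with i show "(\<lambda>x. h x * u x) \<in> L2 M" unfolding L2_def by (intro CollectI conjI)
  have "(\<integral>x. (h x * u x)\<^sup>2 \<partial>M) \<le> (\<integral>x. B\<^sup>2 * (u x)\<^sup>2 \<partial>M)"
    using i le L2_integrable_square[OF assms(1)] by (intro integral_mono) auto
  then show "l2_inner M (\<lambda>x. h x * u x) (\<lambda>x. h x * u x) \<le> B\<^sup>2 * l2_inner M u u"
    by (simp add: l2_inner_def power2_eq_square)
qed

lemma L2_add:
  assumes "u \<in> L2 M" "v \<in> L2 M"
  shows "u + v \<in> L2 M"
proof -
  have "integrable M (\<lambda>x. (u x)\<^sup>2 + 2 * (u x * v x) + (v x)\<^sup>2)"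
    using assms by (intro Bochner_Integration.integrable_add integrable_mult_right L2_integrable_square L2_integrable_mult)
  also have "(\<lambda>x. (u x)\<^sup>2 + 2 * (u x * v x) + (v x)\<^sup>2) = (\<lambda>x. ((u + v) x)\<^sup>2)"
    by (auto simp: power2_sum)
  finally show ?thesis using assms by (auto simp: L2_def plus_fun_def)
qed

lemma L2_scale: "u \<in> L2 M \<Longrightarrow> c *\<^sub>R u \<in> L2 M"
  by (auto simp: L2_def scaleR_fun_def power_mult_distrib)

lemma L2_diff: "u \<in> L2 M \<Longrightarrow> v \<in> L2 M \<Longrightarrow> u - v \<in> L2 M"
  using L2_add[of u M "- v"] L2_scale[of v M "-1"] by simp

lemma subspace_L2: "subspace (L2 M)"
  by (intro subspaceI L2_add L2_scale) (auto simp: L2_def zero_fun_def)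

lemma l2_inner_eq_nn_integral:
  assumes "u \<in> L2 M"
  shows "(\<integral>\<^sup>+x. ennreal ((u x)\<^sup>2) \<partial>M) = ennreal (l2_inner M u u)"
  using nn_integral_eq_integral[OF L2_integrable_square[OF assms]]
  by (simp add: l2_inner_def power2_eq_square)

lemma L2I_nn_integral:
  assumes "u \<in> borel_measurable M" "(\<integral>\<^sup>+x. ennreal ((u x)\<^sup>2) \<partial>M) \<le> ennreal e" "e \<ge> 0"
  shows "u \<in> L2 M" "l2_inner M u u \<le> e"
proof -
  have "(\<integral>\<^sup>+x. ennreal ((u x)\<^sup>2) \<partial>M) \<noteq> top" using assms(2) by (auto simp: top_unique)
  then obtain r where "(\<integral>\<^sup>+x. ennreal ((u x)\<^sup>2) \<partial>M) = ennreal r" "r \<ge> 0"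
    by (cases "\<integral>\<^sup>+x. ennreal ((u x)\<^sup>2) \<partial>M" rule: ennreal_cases) auto
  then have "integrable M (\<lambda>x. (u x)\<^sup>2)"
    using assms(1) by (intro integrableI_nn_integral_finite) auto
  then show u: "u \<in> L2 M" using assms(1) by (simp add: L2_def)
  show "l2_inner M u u \<le> e"
    using assms(2,3) unfolding l2_inner_eq_nn_integral[OF u] by simp
qed

text \<open>
  Along a subsequence with \<open>\<parallel>X\<^sub>m\<^sub>+\<^sub>1 - X\<^sub>m\<parallel>\<^sup>2 < 4\<^sup>-\<^sup>m\<close> the increments are almost everywhere summable, since
  \<open>2 \<bar>d\<bar> \<le> 2\<^sup>m d\<^sup>2 + 2\<^sup>-\<^sup>m\<close>; Fatou's lemma identifies the pointwise limit as the limit in mean.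
\<close>

lemma L2_complete:
  fixes X :: "nat \<Rightarrow> 'a \<Rightarrow> real"
  assumes X: "\<And>m. X m \<in> L2 M"
    and cauchy: "\<And>e. e > 0 \<Longrightarrow> \<exists>N. \<forall>m\<ge>N. \<forall>n\<ge>N. l2_inner M (X m - X n) (X m - X n) < e"
  shows "\<exists>x\<in>L2 M. (\<lambda>m. l2_inner M (X m - x) (X m - x)) \<longlonglongrightarrow> 0"
proof -
  note [measurable] = L2_measurable[OF X]
  define q where "q = (\<lambda>m n. l2_inner M (X m - X n) (X m - X n))"
  have qn: "(\<integral>\<^sup>+x. ennreal ((X m x - X n x)\<^sup>2) \<partial>M) = ennreal (q m n)" for m n
    using l2_inner_eq_nn_integral[OF L2_diff[OF X X], of m n] by (simp add: q_def)
  have "\<exists>N. \<forall>m\<ge>N. \<forall>n\<ge>N. q m n < (1/4)^k" for k using cauchy[of "(1/4)^k"] by (simp add: q_def)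
  then obtain N where N: "\<And>k m n. m \<ge> N k \<Longrightarrow> n \<ge> N k \<Longrightarrow> q m n < (1/4)^k" by metis
  \<comment> \<open>Adding \<open>k\<close> and all \<open>N i\<close> up to \<open>k\<close> gives
    an explicit index beyond both \<open>k\<close> and \<open>N k\<close>, and likewise
    \<open>r (Suc k) \<ge> N k\<close>.\<close>
  define r where "r = (\<lambda>k. k + (\<Sum>i\<le>k. N i))"
  have r_ge: "N k \<le> r k" for k
    using member_le_sum[of k "{..k}" N] by (simp add: r_def)
  have r_Suc: "N k \<le> r (Suc k)" for k
    using r_ge[of k] by (simp add: r_def)
  have r_id: "k \<le> r k" for k by (simp add: r_def)
  define d where "d = (\<lambda>k x. X (r (Suc k)) x - X (r k) x)"
  have [measurable]: "d k \<in> borel_measurable M" for k unfolding d_def by measurable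
  have d_int: "(\<integral>\<^sup>+x. ennreal (2^k * (d k x)\<^sup>2) \<partial>M) \<le> ennreal ((1/2)^k)" for k
  proof -
    have "(\<integral>\<^sup>+x. ennreal (2^k * (d k x)\<^sup>2) \<partial>M) = (\<integral>\<^sup>+x. ennreal (2^k) * ennreal ((d k x)\<^sup>2) \<partial>M)"
      by (simp add: ennreal_mult)
    also have "\<dots> = ennreal (2^k) * (\<integral>\<^sup>+x. ennreal ((d k x)\<^sup>2) \<partial>M)" by (rule nn_integral_cmult) measurable
    also have "\<dots> = ennreal (2^k * q (r (Suc k)) (r k))" by (simp add: d_def qn ennreal_mult')
    also have "\<dots> \<le> ennreal (2^k * (1/4)^k)"
      using N[OF r_Suc r_ge] by (intro ennreal_leI mult_left_mono) (auto simp: less_imp_le)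
    also have "(2::real)^k * (1/4)^k = (1/2)^k" by (simp add: power_mult_distrib[symmetric])
    finally show ?thesis .
  qed
  have "(\<integral>\<^sup>+x. (\<Sum>k. ennreal (2^k * (d k x)\<^sup>2)) \<partial>M) = (\<Sum>k. \<integral>\<^sup>+x. ennreal (2^k * (d k x)\<^sup>2) \<partial>M)"
    by (rule nn_integral_suminf) measurable
  also have "\<dots> \<le> (\<Sum>k. ennreal ((1/2)^k))" by (intro suminf_le d_int) auto
  also have "\<dots> = ennreal (\<Sum>k. (1/2)^k)" by (rule suminf_ennreal2) (auto intro: summable_geometric)
  also have "\<dots> < \<infinity>" by simp
  finally have "AE x in M. (\<Sum>k. ennreal (2^k * (d k x)\<^sup>2)) \<noteq> \<infinity>"
    by (intro nn_integral_PInf_AE) auto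
  then have conv: "AE x in M. convergent (\<lambda>k. X (r k) x)"
  proof eventually_elim
    case (elim x)
    have "summable (\<lambda>k. 2^k * (d k x)\<^sup>2)" by (rule summable_suminf_not_top) (use elim in auto)
    then have sm: "summable (\<lambda>k. 2^k * (d k x)\<^sup>2 + (1/2)^k)" by (intro summable_add summable_geometric) auto
    have le: "norm (d k x) \<le> 2^k * (d k x)\<^sup>2 + (1/2)^k" for k
    proof -
      have "0 \<le> 2^k * (\<bar>d k x\<bar> - (1/2)^k)\<^sup>2" by simp
      also have "\<dots> = 2^k * (d k x)\<^sup>2 + 2^k * ((1/2)^k * (1/2)^k) - 2 * \<bar>d k x\<bar> * (2^k * (1/2)^k)"
        by (simp add: power2_diff power2_eq_square algebra_simps)
      also have "(2::real)^k * (1/2)^k = 1" by (simp add: power_mult_distrib[symmetric])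
      also have "(2::real)^k * ((1/2)^k * (1/2)^k) = (1/2)^k" by (simp add: power_mult_distrib[symmetric] mult.assoc[symmetric])
      finally show ?thesis by simp
    qed
    have "summable (\<lambda>k. d k x)" by (rule summable_comparison_test'[OF sm, of 0]) (rule le)
    then have "convergent (\<lambda>n. \<Sum>k<n. d k x)" by (simp add: summable_iff_convergent)
    then have "convergent (\<lambda>n. (\<Sum>k<n. d k x) + X (r 0) x)" by (intro convergent_add convergent_const)
    moreover have "(\<Sum>k<n. d k x) = X (r n) x - X (r 0) x" for n
      unfolding d_def by (rule sum_lessThan_telescope)
    ultimately show ?case by simp
  qed
  define x where "x = (\<lambda>p. lim (\<lambda>k. X (r k) p))"
  have [measurable]: "x \<in> borel_measurable M" unfolding x_def by measurable
  have lim: "AE p in M. (\<lambda>k. X (r k) p) \<longlonglongrightarrow> x p"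
    using conv by eventually_elim (simp add: x_def convergent_LIMSEQ_iff)
  \<comment> \<open>Stated for every \<open>n \<ge> N k\<close>, not only along the subsequence, so
    that the whole sequence converges to \<open>x\<close>.\<close>
  have close: "X n - x \<in> L2 M \<and> l2_inner M (X n - x) (X n - x) \<le> (1/4)^k" if n: "n \<ge> N k" for n k
  proof -
    have "(\<integral>\<^sup>+p. ennreal ((X n p - x p)\<^sup>2) \<partial>M) = (\<integral>\<^sup>+p. liminf (\<lambda>m. ennreal ((X n p - X (r m) p)\<^sup>2)) \<partial>M)"
    proof (rule nn_integral_cong_AE)
      show "AE p in M. ennreal ((X n p - x p)\<^sup>2) = liminf (\<lambda>m. ennreal ((X n p - X (r m) p)\<^sup>2))"
        using lim
      proof eventually_elim
        case (elim p)
        have "(\<lambda>m. ennreal ((X n p - X (r m) p)\<^sup>2)) \<longlonglongrightarrow> ennreal ((X n p - x p)\<^sup>2)"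
          by (intro tendsto_ennrealI tendsto_intros elim)
        then show ?case by (intro lim_imp_Liminf[symmetric]) auto
      qed
    qed
    also have "\<dots> \<le> liminf (\<lambda>m. \<integral>\<^sup>+p. ennreal ((X n p - X (r m) p)\<^sup>2) \<partial>M)"
      by (rule nn_integral_liminf) measurable
    also have "\<dots> \<le> ennreal ((1/4)^k)"
    proof (rule Liminf_le)
      have "ennreal (q n (r m)) \<le> ennreal ((1/4)^k)" if "m \<ge> N k" for m
        using N[OF n order_trans[OF that r_id]] by (intro ennreal_leI) simp
      then show "\<forall>\<^sub>F m in sequentially. (\<integral>\<^sup>+p. ennreal ((X n p - X (r m) p)\<^sup>2) \<partial>M) \<le> ennreal ((1/4)^k)"
        unfolding qn eventually_sequentially by blast
    qed simp
    finally have "(\<integral>\<^sup>+p. ennreal (((X n - x) p)\<^sup>2) \<partial>M) \<le> ennreal ((1/4)^k)" by simp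
    moreover have "X n - x \<in> borel_measurable M" unfolding fun_diff_def by measurable
    ultimately show ?thesis by (auto dest: L2I_nn_integral)
  qed
  have "x = X (N 0) - (X (N 0) - x)" by simp
  then have xL: "x \<in> L2 M" using L2_diff[OF X, of "X (N 0) - x" "N 0"] close[of 0 "N 0"] by simp
  have "(\<lambda>m. l2_inner M (X m - x) (X m - x)) \<longlonglongrightarrow> 0"
  proof (rule LIMSEQ_I)
    fix e :: real assume "e > 0"
    then obtain k where k: "(1/4)^k < e" using real_arch_pow_inv[of e "1/4"] by auto
    have nn: "0 \<le> l2_inner M v v" for v unfolding l2_inner_def by (intro Bochner_Integration.integral_nonneg) auto
    then have "norm (l2_inner M (X m - x) (X m - x) - 0) < e" if "m \<ge> N k" for m
      using close[OF that] k nn[of "X m - x"] by simp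
    then show "\<exists>no. \<forall>m\<ge>no. norm (l2_inner M (X m - x) (X m - x) - 0) < e" by blast
  qed
  with xL show ?thesis by blast
qed

lemma l2_inner_add_left:
  assumes "u \<in> L2 M" "v \<in> L2 M" "w \<in> L2 M"
  shows "l2_inner M (u + v) w = l2_inner M u w + l2_inner M v w"
proof -
  have "(\<lambda>x. (u + v) x * w x) = (\<lambda>x. u x * w x + v x * w x)" by (auto simp: algebra_simps)
  then show ?thesis
    unfolding l2_inner_def
    by (simp only: Bochner_Integration.integral_add[OF L2_integrable_mult[OF assms(1,3)] L2_integrable_mult[OF assms(2,3)]])
qed

lemma l2_inner_scale_left: "l2_inner M (c *\<^sub>R u) w = c * l2_inner M u w"
  by (simp add: l2_inner_def mult.assoc)

lemma semi_hilbert_L2: "semi_hilbert (L2 M) (l2_inner M)"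
  unfolding semi_hilbert_def
proof (intro conjI allI impI)
  show "subspace (L2 M)" by (rule subspace_L2)
  fix u v w :: "'a \<Rightarrow> real" and c :: real
  show "l2_inner M u v = l2_inner M v u" by (simp add: l2_inner_def mult.commute)
  show "0 \<le> l2_inner M u u" unfolding l2_inner_def by (intro Bochner_Integration.integral_nonneg) auto
  show "l2_inner M (c *\<^sub>R u) w = c * l2_inner M u w" by (rule l2_inner_scale_left)
  assume "u \<in> L2 M" "v \<in> L2 M" "w \<in> L2 M"
  then show "l2_inner M (u + v) w = l2_inner M u w + l2_inner M v w" by (rule l2_inner_add_left)
next
  fix X :: "nat \<Rightarrow> 'a \<Rightarrow> real"
  assume "\<forall>m. X m \<in> L2 M"
    "\<forall>e. 0 < e \<longrightarrow> (\<exists>N. \<forall>m\<ge>N. \<forall>n\<ge>N. l2_inner M (X m - X n) (X m - X n) < e)"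
  then show "\<exists>x\<in>L2 M. (\<lambda>m. l2_inner M (X m - x) (X m - x)) \<longlonglongrightarrow> 0"
    by (intro L2_complete) auto
qed

lemma l2_inner_zero_iff:
  assumes "u \<in> L2 M"
  shows "l2_inner M u u = 0 \<longleftrightarrow> (AE x in M. u x = 0)"
  using integral_nonneg_eq_0_iff_AE[OF L2_integrable_square[OF assms]]
  by (simp add: l2_inner_def power2_eq_square)

section \<open>Smooth functions\<close>

lemma frechet_derivative_eqI: "(f has_derivative f') (at x) \<Longrightarrow> frechet_derivative f (at x) = f'"
  using frechet_derivative_at by metis

text \<open>\<open>frechet_derivative\<close> is a choice depending only on which maps are
  derivatives at the point, so functions that agree near \<open>x\<close> get the same value even
  where neither is differentiable.\<close>

lemma partial_deriv_cong:
  assumes "open U" "x \<in> U" "\<And>y. y \<in> U \<Longrightarrow> f y = g y"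
  shows "partial_deriv j f x = partial_deriv j g x"
proof -
  have "(f has_derivative f') (at x) \<longleftrightarrow> (g has_derivative f') (at x)" for f'
    using assms has_derivative_transform_within_open[of _ f' x UNIV U] by metis
  then show ?thesis by (simp add: partial_deriv_def frechet_derivative_def)
qed

lemma partial_derivI: "(f has_derivative f') (at x) \<Longrightarrow> partial_deriv j f x = f' (axis j 1)"
  by (simp add: partial_deriv_def frechet_derivative_eqI)

lemma partial_deriv_const [simp]: "partial_deriv j (\<lambda>x. c) x = 0"
  by (rule partial_derivI[OF has_derivative_const])

lemma partial_deriv_add:
  assumes "f differentiable at x" "g differentiable at x"
  shows "partial_deriv j (\<lambda>x. f x + g x) x = partial_deriv j f x + partial_deriv j g x"
  using assms by (subst partial_derivI[OF has_derivative_add])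
    (auto simp: frechet_derivative_works partial_deriv_def)

lemma partial_deriv_mult:
  assumes "f differentiable at x" "g differentiable at x"
  shows "partial_deriv j (\<lambda>x. f x * g x) x = f x * partial_deriv j g x + partial_deriv j f x * g x"
  using assms by (subst partial_derivI[OF has_derivative_mult])
    (auto simp: frechet_derivative_works partial_deriv_def)

lemma partial_deriv_cmult:
  assumes "f differentiable at x"
  shows "partial_deriv j (\<lambda>x. c * f x) x = c * partial_deriv j f x"
  using partial_deriv_mult[of "\<lambda>_. c" x f j] assms by simp

lemma partial_deriv_nth: "partial_deriv j (\<lambda>x. x $ i) x = (if i = j then 1 else 0)"
proof -
  have "((\<lambda>x. x $ i) has_derivative (\<lambda>h. h $ i)) (at x)"
    using bounded_linear_vec_nth by (rule bounded_linear_imp_has_derivative)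
  from partial_derivI[OF this, of j] show ?thesis by (simp add: axis_def)
qed

lemma differentiable_nth [simp]: "(\<lambda>x. x $ i) differentiable at x"
  using bounded_linear_vec_nth by (rule bounded_linear_imp_differentiable)

lemma differentiable_on_eq:
  assumes "\<And>x. x \<in> U \<Longrightarrow> f x = g x" "f differentiable_on U"
  shows "g differentiable_on U"
  unfolding differentiable_on_def differentiable_def
proof
  fix x assume x: "x \<in> U"
  then obtain f' where "(f has_derivative f') (at x within U)"
    using assms(2) by (auto simp: differentiable_on_def differentiable_def)
  with x assms(1) have "(g has_derivative f') (at x within U)"
    by (intro has_derivative_transform[of x U g f f']) auto
  then show "\<exists>f'. (g has_derivative f') (at x within U)" by blast
qed

text \<open>The recursion peels off the innermost derivative, opposite to
  \<open>iter_partial\<close>, so that an induction on the order may replace the function by one of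
  its partial derivatives; this is how the sum and product rules are iterated. The set
  \<open>U\<close> is meant to be open.\<close>

primrec smooth_order :: "nat \<Rightarrow> (real ^ 'n::finite) set \<Rightarrow> (real ^ 'n \<Rightarrow> real) \<Rightarrow> bool" where
  "smooth_order 0 U f \<longleftrightarrow> f differentiable_on U"
| "smooth_order (Suc k) U f \<longleftrightarrow> f differentiable_on U \<and> (\<forall>j. smooth_order k U (partial_deriv j f))"

definition smooth :: "(real ^ 'n::finite) set \<Rightarrow> (real ^ 'n \<Rightarrow> real) \<Rightarrow> bool" where
  "smooth U f \<longleftrightarrow> (\<forall>k. smooth_order k U f)"

lemma iter_partial_snoc: "iter_partial (js @ [j]) f = iter_partial js (partial_deriv j f)"
  by (induction js) auto

lemma smooth_order_iff_iter_partial: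
  "smooth_order k U f \<longleftrightarrow> (\<forall>js. length js \<le> k \<longrightarrow> iter_partial js f differentiable_on U)"
proof (induction k arbitrary: f)
  case (Suc k)
  show ?case
  proof
    assume s: "smooth_order (Suc k) U f"
    show "\<forall>js. length js \<le> Suc k \<longrightarrow> iter_partial js f differentiable_on U"
    proof (intro allI impI)
      fix js :: "'a list" assume "length js \<le> Suc k"
      then show "iter_partial js f differentiable_on U"
        using s Suc by (cases js rule: rev_cases) (auto simp: iter_partial_snoc)
    qed
  next
    assume s: "\<forall>js. length js \<le> Suc k \<longrightarrow> iter_partial js f differentiable_on U"
    have "f differentiable_on U" using s[rule_format, of "[]"] by simp
    moreover have "iter_partial js (partial_deriv j f) differentiable_on U" if "length js \<le> k" for js j
      using s[rule_format, of "js @ [j]"] that by (simp add: iter_partial_snoc)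
    then have "smooth_order k U (partial_deriv j f)" for j
      unfolding Suc.IH by blast
    ultimately show "smooth_order (Suc k) U f" by simp
  qed
qed auto

lemma smooth_iff_iter_partial: "smooth U f \<longleftrightarrow> (\<forall>js. iter_partial js f differentiable_on U)"
  unfolding smooth_def smooth_order_iff_iter_partial by blast

lemma smooth_order_differentiable:
  "smooth_order k U f \<Longrightarrow> open U \<Longrightarrow> x \<in> U \<Longrightarrow> f differentiable at x"
  by (cases k) (auto simp: differentiable_on_eq_differentiable_at)

lemma smooth_differentiable: "smooth U f \<Longrightarrow> open U \<Longrightarrow> x \<in> U \<Longrightarrow> f differentiable at x"
  by (auto simp: smooth_def intro: smooth_order_differentiable)

lemma smooth_partial_deriv: "smooth U f \<Longrightarrow> smooth U (partial_deriv j f)"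
  unfolding smooth_def by (metis smooth_order.simps(2))

lemma smooth_order_lower: "smooth_order (Suc k) U f \<Longrightarrow> smooth_order k U f"
  unfolding smooth_order_iff_iter_partial by auto

lemma smooth_order_cong:
  assumes "open U" "\<And>x. x \<in> U \<Longrightarrow> f x = g x" "smooth_order k U f"
  shows "smooth_order k U g"
  using assms(2,3)
proof (induction k arbitrary: f g)
  case (Suc k)
  have eq: "partial_deriv j f x = partial_deriv j g x" if "x \<in> U" for x j
    using assms(1) that Suc.prems(1) by (rule partial_deriv_cong)
  have "smooth_order k U (partial_deriv j g)" for j
    by (rule Suc.IH[of "partial_deriv j f", OF eq]) (use Suc.prems in auto)
  moreover have "g differentiable_on U"
    using Suc.prems differentiable_on_eq[of U f g] by auto
  ultimately show ?case by simp
qed (simp, rule differentiable_on_eq)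

lemma smooth_order_add:
  assumes "open U" "smooth_order k U f" "smooth_order k U g"
  shows "smooth_order k U (\<lambda>x. f x + g x)"
  using assms(2,3)
proof (induction k arbitrary: f g)
  case (Suc k)
  have "smooth_order k U (partial_deriv j (\<lambda>x. f x + g x))" for j
  proof (rule smooth_order_cong[OF assms(1)])
    show "smooth_order k U (\<lambda>x. partial_deriv j f x + partial_deriv j g x)"
      using Suc by auto
    show "partial_deriv j f x + partial_deriv j g x = partial_deriv j (\<lambda>x. f x + g x) x" if "x \<in> U" for x
      using smooth_order_differentiable[OF _ assms(1) that] Suc.prems by (intro partial_deriv_add[symmetric]) blast+
  qed
  then show ?case using Suc.prems by (auto intro: differentiable_on_add)
qed (auto intro: differentiable_on_add)

lemma smooth_order_mult:
  assumes "open U" "smooth_order k U f" "smooth_order k U g"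
  shows "smooth_order k U (\<lambda>x. f x * g x)"
  using assms(2,3)
proof (induction k arbitrary: f g)
  case (Suc k)
  have "smooth_order k U (partial_deriv j (\<lambda>x. f x * g x))" for j
  proof (rule smooth_order_cong[OF assms(1)])
    show "smooth_order k U (\<lambda>x. f x * partial_deriv j g x + partial_deriv j f x * g x)"
      using Suc.prems smooth_order_lower[OF Suc.prems(1)] smooth_order_lower[OF Suc.prems(2)]
      by (intro smooth_order_add[OF assms(1)] Suc.IH) auto
    show "f x * partial_deriv j g x + partial_deriv j f x * g x = partial_deriv j (\<lambda>x. f x * g x) x" if "x \<in> U" for x
      using smooth_order_differentiable[OF _ assms(1) that] Suc.prems by (intro partial_deriv_mult[symmetric]) blast+
  qed
  then show ?case using Suc.prems by (auto intro: differentiable_on_mult)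
qed (auto intro: differentiable_on_mult)

lemma smooth_order_const: "smooth_order k U (\<lambda>x. c)"
proof (induction k arbitrary: c)
  case (Suc k)
  have eq: "partial_deriv j (\<lambda>x. c) = (\<lambda>x. 0)" for j by auto
  show ?case unfolding smooth_order.simps eq using Suc by (auto simp: differentiable_on_def)
qed (auto simp: differentiable_on_def)

text \<open>Differentiability on open sets is local. The lemma later glues a product to the zero
  function off the support.\<close>

lemma smooth_order_union:
  assumes "open U" "open V" "smooth_order k U f" "smooth_order k V f"
  shows "smooth_order k (U \<union> V) f"
  using assms(3,4)
proof (induction k arbitrary: f)
  case 0
  then show ?case using assms by (auto simp: differentiable_on_eq_differentiable_at open_Un)
next
  case (Suc k)
  then show ?case using assms by (auto simp: differentiable_on_eq_differentiable_at open_Un)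
qed

lemma smooth_cong: "open U \<Longrightarrow> (\<And>x. x \<in> U \<Longrightarrow> f x = g x) \<Longrightarrow> smooth U f \<Longrightarrow> smooth U g"
  unfolding smooth_def using smooth_order_cong by blast

lemma smooth_add: "open U \<Longrightarrow> smooth U f \<Longrightarrow> smooth U g \<Longrightarrow> smooth U (\<lambda>x. f x + g x)"
  unfolding smooth_def using smooth_order_add by blast

lemma smooth_mult: "open U \<Longrightarrow> smooth U f \<Longrightarrow> smooth U g \<Longrightarrow> smooth U (\<lambda>x. f x * g x)"
  unfolding smooth_def using smooth_order_mult by blast

lemma smooth_const: "smooth U (\<lambda>x. c)"
  unfolding smooth_def using smooth_order_const by blast

lemma smooth_union: "open U \<Longrightarrow> open V \<Longrightarrow> smooth U f \<Longrightarrow> smooth V f \<Longrightarrow> smooth (U \<union> V) f"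
  unfolding smooth_def using smooth_order_union by blast

lemma smooth_subset: "smooth U f \<Longrightarrow> V \<subseteq> U \<Longrightarrow> smooth V f"
  unfolding smooth_iff_iter_partial using differentiable_on_subset by blast

lemma smooth_nth: "smooth U (\<lambda>x. x $ i)"
  unfolding smooth_def
proof
  fix k show "smooth_order k U (\<lambda>x. x $ i)"
  proof (cases k)
    case (Suc l)
    have "partial_deriv j (\<lambda>x. x $ i) = (\<lambda>x. if i = j then 1 else 0)" for j
      using partial_deriv_nth by blast
    then show ?thesis using Suc smooth_order_const
      by (auto simp: differentiable_on_def intro: differentiable_at_withinI)
  qed (auto simp: differentiable_on_def intro: differentiable_at_withinI)
qed

lemma open_hyp_space: "open (hyp_space p)"
  unfolding hyp_space_def by (intro open_Collect_less continuous_intros)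

lemma has_derivative_nth_compose:
  assumes "(h has_real_derivative h') (at (x $ p))"
  shows "((\<lambda>x. h (x $ p)) has_derivative (\<lambda>y. y $ p * h')) (at x)"
proof -
  have "((\<lambda>x. x $ p) has_derivative (\<lambda>h. h $ p)) (at x)"
    using bounded_linear_vec_nth by (rule bounded_linear_imp_has_derivative)
  from has_derivative_compose[OF this, of h "(*) h'"] assms show ?thesis
    by (simp add: has_field_derivative_def mult.commute)
qed

lemma partial_deriv_nth_compose:
  assumes "(h has_real_derivative h') (at (x $ p))"
  shows "partial_deriv j (\<lambda>x. h (x $ p)) x = (if j = p then h' else 0)"
  using partial_derivI[OF has_derivative_nth_compose[OF assms], of j] by (simp add: axis_def)

text \<open>Each partial derivative of 1/x_p is zero or minus the square of 1/x_p, so the induction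
  on the order closes with the product rule.\<close>

lemma smooth_inverse_nth: "smooth (hyp_space p) (\<lambda>x. 1 / x $ p)"
  unfolding smooth_def
proof
  fix k show "smooth_order k (hyp_space p) (\<lambda>x. 1 / x $ p)"
  proof (induction k)
    case 0
    have "(\<lambda>x. 1 / x $ p) differentiable at x" if "x \<in> hyp_space p" for x
      using that by (auto simp: hyp_space_def)
    then show ?case by (auto simp: differentiable_on_eq_differentiable_at[OF open_hyp_space])
  next
    case (Suc k)
    have "smooth_order k (hyp_space p) (partial_deriv j (\<lambda>x. 1 / x $ p))" for j
    proof (rule smooth_order_cong[OF open_hyp_space])
      show "smooth_order k (hyp_space p) (\<lambda>x. (if j = p then - 1 else 0) * (1 / x $ p * (1 / x $ p)))"
        by (intro smooth_order_mult open_hyp_space smooth_order_const Suc)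
      fix x :: "real ^ 'a" assume x: "x \<in> hyp_space p"
      have "((\<lambda>t. 1 / t) has_real_derivative - (1 / (x $ p * x $ p))) (at (x $ p))"
        using x by (auto intro!: derivative_eq_intros simp: hyp_space_def)
      from partial_deriv_nth_compose[OF this, of j]
      show "(if j = p then - 1 else 0) * (1 / x $ p * (1 / x $ p)) = partial_deriv j (\<lambda>x. 1 / x $ p) x" by simp
    qed
    then show ?case using smooth_order_differentiable[OF Suc open_hyp_space]
      by (auto simp: differentiable_on_eq_differentiable_at[OF open_hyp_space])
  qed
qed

lemma partial_deriv_ln_nth: "x \<in> hyp_space p \<Longrightarrow> partial_deriv j (\<lambda>x. ln (x $ p)) x = (if j = p then 1 / x $ p else 0)"
  by (rule partial_deriv_nth_compose) (auto intro!: derivative_eq_intros simp: hyp_space_def)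

lemma smooth_ln_nth: "smooth (hyp_space p) (\<lambda>x. ln (x $ p))"
  unfolding smooth_def
proof
  have d: "(\<lambda>x. ln (x $ p)) differentiable_on hyp_space p"
  proof -
    have "(\<lambda>x. ln (x $ p)) differentiable at x" if "x \<in> hyp_space p" for x
    proof -
      have "(ln has_real_derivative 1 / x $ p) (at (x $ p))"
        using that by (auto intro!: derivative_eq_intros simp: hyp_space_def)
      from has_derivative_nth_compose[OF this] show ?thesis by (auto simp: differentiable_def)
    qed
    then show ?thesis by (auto simp: differentiable_on_eq_differentiable_at[OF open_hyp_space])
  qed
  fix k show "smooth_order k (hyp_space p) (\<lambda>x. ln (x $ p))"
  proof (cases k)
    case (Suc l)
    have "smooth_order l (hyp_space p) (partial_deriv j (\<lambda>x. ln (x $ p)))" for j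
    proof (rule smooth_order_cong[OF open_hyp_space])
      show "smooth_order l (hyp_space p) (\<lambda>x. (if j = p then 1 else 0) * (1 / x $ p))"
        using smooth_inverse_nth by (intro smooth_order_mult open_hyp_space smooth_order_const) (auto simp: smooth_def)
      show "(if j = p then 1 else 0) * (1 / x $ p) = partial_deriv j (\<lambda>x. ln (x $ p)) x" if "x \<in> hyp_space p" for x
        using partial_deriv_ln_nth[OF that, of j] by simp
    qed
    with d Suc show ?thesis by simp
  qed (use d in auto)
qed

section \<open>Derivatives along lines and commuting partial derivatives\<close>

lemma has_real_derivative_line:
  fixes f :: "real ^ 'n::finite \<Rightarrow> real"
  assumes "f differentiable at (x + t *\<^sub>R h)"
  shows "((\<lambda>t. f (x + t *\<^sub>R h)) has_real_derivative (\<Sum>j\<in>UNIV. h $ j * partial_deriv j f (x + t *\<^sub>R h))) (at t)"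
proof -
  let ?D = "frechet_derivative f (at (x + t *\<^sub>R h))"
  have f: "(f has_derivative ?D) (at (x + t *\<^sub>R h))" using assms by (simp add: frechet_derivative_works)
  have "((\<lambda>t. x + t *\<^sub>R h) has_derivative (\<lambda>t. t *\<^sub>R h)) (at t)"
    by (auto intro!: derivative_eq_intros)
  from has_derivative_compose[OF this f]
  have d: "((\<lambda>t. f (x + t *\<^sub>R h)) has_derivative (\<lambda>t. ?D (t *\<^sub>R h))) (at t)" .
  have lin: "linear ?D" using f has_derivative_linear by blast
  have "?D h = ?D (\<Sum>j\<in>UNIV. h $ j *\<^sub>R axis j 1)"
    using basis_expansion[of h] by (simp add: scalar_mult_eq_scaleR)
  also have "\<dots> = (\<Sum>j\<in>UNIV. h $ j * partial_deriv j f (x + t *\<^sub>R h))"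
    by (simp add: linear_sum[OF lin] linear_scale[OF lin] partial_deriv_def)
  finally have "?D (s *\<^sub>R h) = (\<Sum>j\<in>UNIV. h $ j * partial_deriv j f (x + t *\<^sub>R h)) * s" for s
    by (simp add: linear_scale[OF lin])
  with d show ?thesis by (simp add: has_field_derivative_def)
qed

lemma has_real_derivative_axis:
  assumes "f differentiable at (x + t *\<^sub>R axis i 1)"
  shows "((\<lambda>t. f (x + t *\<^sub>R axis i 1)) has_real_derivative partial_deriv i f (x + t *\<^sub>R axis i 1)) (at t)"
proof -
  have "(\<Sum>j\<in>UNIV. axis i 1 $ j * partial_deriv j f (x + t *\<^sub>R axis i 1))
      = (\<Sum>j\<in>UNIV. if j = i then partial_deriv i f (x + t *\<^sub>R axis i 1) else 0)"
    by (intro sum.cong) (auto simp: axis_def)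
  also have "\<dots> = partial_deriv i f (x + t *\<^sub>R axis i 1)" by simp
  finally show ?thesis using has_real_derivative_line[OF assms] by simp
qed

lemma smooth_isCont: "smooth UNIV f \<Longrightarrow> isCont f x"
  using smooth_differentiable[of UNIV f x] differentiable_imp_continuous_within by auto

text \<open>The double difference is a difference in direction \<open>i\<close> of a difference in
  direction \<open>j\<close>; the mean value theorem in each of the two directions turns it into a
  second derivative at a nearby point.\<close>

lemma mixed_difference_mean_value:
  fixes f :: "real ^ 'n::finite \<Rightarrow> real"
  assumes f: "smooth UNIV f" and h: "h > 0"
  shows "\<exists>y. dist y x \<le> 2 * h \<and>
    f (x + h *\<^sub>R axis i 1 + h *\<^sub>R axis j 1) - f (x + h *\<^sub>R axis i 1) - f (x + h *\<^sub>R axis j 1) + f x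
    = h * h * partial_deriv j (partial_deriv i f) y"
proof -
  note d = smooth_differentiable[OF f open_UNIV UNIV_I]
  note d' = smooth_differentiable[OF smooth_partial_deriv[OF f] open_UNIV UNIV_I]
  have comm: "x + s *\<^sub>R axis i 1 + h *\<^sub>R axis j 1 = (x + h *\<^sub>R axis j 1) + s *\<^sub>R axis i 1" for s by simp
  have "((\<lambda>s. f (x + s *\<^sub>R axis i 1 + h *\<^sub>R axis j 1) - f (x + s *\<^sub>R axis i 1)) has_real_derivative
      partial_deriv i f (x + s *\<^sub>R axis i 1 + h *\<^sub>R axis j 1) - partial_deriv i f (x + s *\<^sub>R axis i 1)) (at s)" for s
    unfolding comm by (intro DERIV_diff has_real_derivative_axis d)
  from MVT2[OF h this] obtain s where s: "0 < s" "s < h"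
    "f (x + h *\<^sub>R axis i 1 + h *\<^sub>R axis j 1) - f (x + h *\<^sub>R axis i 1) - (f (x + h *\<^sub>R axis j 1) - f x)
      = h * (partial_deriv i f (x + s *\<^sub>R axis i 1 + h *\<^sub>R axis j 1) - partial_deriv i f (x + s *\<^sub>R axis i 1))"
    by auto
  have "((\<lambda>t. partial_deriv i f (x + s *\<^sub>R axis i 1 + t *\<^sub>R axis j 1)) has_real_derivative
      partial_deriv j (partial_deriv i f) (x + s *\<^sub>R axis i 1 + t *\<^sub>R axis j 1)) (at t)" for t
    by (intro has_real_derivative_axis d')
  from MVT2[OF h this] obtain t where t: "0 < t" "t < h"
    "partial_deriv i f (x + s *\<^sub>R axis i 1 + h *\<^sub>R axis j 1) - partial_deriv i f (x + s *\<^sub>R axis i 1)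
      = h * partial_deriv j (partial_deriv i f) (x + s *\<^sub>R axis i 1 + t *\<^sub>R axis j 1)"
    by auto
  have "dist (x + s *\<^sub>R axis i 1 + t *\<^sub>R axis j 1) x = norm (s *\<^sub>R axis i (1::real) + t *\<^sub>R axis j 1)"
    by (simp add: dist_norm algebra_simps)
  also have "\<dots> \<le> norm (s *\<^sub>R axis i (1::real)) + norm (t *\<^sub>R axis j (1::real))" by (rule norm_triangle_ineq)
  also have "\<dots> \<le> 2 * h" using s t by simp
  finally show ?thesis using s t by (intro exI[of _ "x + s *\<^sub>R axis i 1 + t *\<^sub>R axis j 1"]) simp
qed

text \<open>The double difference is symmetric in \<open>i\<close> and \<open>j\<close>, so at every
  scale the two mixed derivatives share a value, taken at two points near \<open>x\<close>; their
  continuity carries the equality to \<open>x\<close>.\<close>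

lemma partial_deriv_commute:
  fixes f :: "real ^ 'n::finite \<Rightarrow> real"
  assumes f: "smooth UNIV f"
  shows "partial_deriv i (partial_deriv j f) x = partial_deriv j (partial_deriv i f) x"
proof -
  define a where "a = (\<lambda>n. inverse (real (Suc n)))"
  have a: "a n > 0" for n by (simp add: a_def)
  have "\<exists>y z. dist y x \<le> 2 * a n \<and> dist z x \<le> 2 * a n \<and>
      partial_deriv j (partial_deriv i f) y = partial_deriv i (partial_deriv j f) z" for n
  proof -
    obtain y where y: "dist y x \<le> 2 * a n" "f (x + a n *\<^sub>R axis i 1 + a n *\<^sub>R axis j 1)
        - f (x + a n *\<^sub>R axis i 1) - f (x + a n *\<^sub>R axis j 1) + f x
        = a n * a n * partial_deriv j (partial_deriv i f) y"
      using mixed_difference_mean_value[OF f a] by blast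
    obtain z where z: "dist z x \<le> 2 * a n" "f (x + a n *\<^sub>R axis j 1 + a n *\<^sub>R axis i 1)
        - f (x + a n *\<^sub>R axis j 1) - f (x + a n *\<^sub>R axis i 1) + f x
        = a n * a n * partial_deriv i (partial_deriv j f) z"
      using mixed_difference_mean_value[OF f a] by blast
    have eq: "x + a n *\<^sub>R axis j 1 + a n *\<^sub>R axis i 1 = x + a n *\<^sub>R axis i 1 + a n *\<^sub>R axis j 1" by simp
    have "a n * a n * partial_deriv j (partial_deriv i f) y = a n * a n * partial_deriv i (partial_deriv j f) z"
      using y(2) z(2)[unfolded eq] by linarith
    then show ?thesis using y(1) z(1) a[of n] by auto
  qed
  then obtain y z where yz: "\<And>n. dist (y n) x \<le> 2 * a n" "\<And>n. dist (z n) x \<le> 2 * a n"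
      "\<And>n. partial_deriv j (partial_deriv i f) (y n) = partial_deriv i (partial_deriv j f) (z n)" by metis
  have a0: "(\<lambda>n. 2 * a n) \<longlonglongrightarrow> 0"
    unfolding a_def using tendsto_mult_right_zero[OF LIMSEQ_inverse_real_of_nat] by blast
  have lim: "w \<longlonglongrightarrow> x" if "\<And>n. dist (w n) x \<le> 2 * a n" for w
  proof (rule metric_tendsto_imp_tendsto[OF a0])
    have "dist (w n) x \<le> dist (2 * a n) 0" for n using that[of n] a[of n] by (simp add: dist_real_def)
    then show "\<forall>\<^sub>F n in sequentially. dist (w n) x \<le> dist (2 * a n) 0" by simp
  qed
  have "(\<lambda>n. partial_deriv j (partial_deriv i f) (y n)) \<longlonglongrightarrow> partial_deriv j (partial_deriv i f) x"
    by (rule isCont_tendsto_compose[OF smooth_isCont lim[OF yz(1)]]) (intro smooth_partial_deriv f)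
  moreover have "(\<lambda>n. partial_deriv i (partial_deriv j f) (z n)) \<longlonglongrightarrow> partial_deriv i (partial_deriv j f) x"
    by (rule isCont_tendsto_compose[OF smooth_isCont lim[OF yz(2)]]) (intro smooth_partial_deriv f)
  ultimately show ?thesis using yz(3) LIMSEQ_unique by simp
qed

section \<open>Test functions and integration by parts\<close>

abbreviation tsupport :: "(real ^ 'n::finite \<Rightarrow> real) \<Rightarrow> (real ^ 'n) set" where
  "tsupport \<phi> \<equiv> closure {x. \<phi> x \<noteq> 0}"

lemma test_functions_iff:
  "\<phi> \<in> test_functions \<Omega> \<longleftrightarrow> smooth UNIV \<phi> \<and> compact (tsupport \<phi>) \<and> tsupport \<phi> \<subseteq> \<Omega>"
  by (auto simp: test_functions_def smooth_iff_iter_partial)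

lemma zero_outside_tsupport: "x \<notin> tsupport \<phi> \<Longrightarrow> \<phi> x = 0"
  using closure_subset[of "{x. \<phi> x \<noteq> 0}"] by blast

lemma test_function_zero: "\<phi> \<in> test_functions \<Omega> \<Longrightarrow> x \<notin> \<Omega> \<Longrightarrow> \<phi> x = 0"
  using zero_outside_tsupport[of x \<phi>] by (auto simp: test_functions_iff)

lemma test_function_smooth: "\<phi> \<in> test_functions \<Omega> \<Longrightarrow> smooth UNIV \<phi>"
  by (simp add: test_functions_iff)

lemma test_function_differentiable [simp]: "\<phi> \<in> test_functions \<Omega> \<Longrightarrow> \<phi> differentiable at x"
  using smooth_differentiable[OF test_function_smooth open_UNIV UNIV_I] .

lemma test_function_continuous: "\<phi> \<in> test_functions \<Omega> \<Longrightarrow> continuous_on S \<phi>"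
  using smooth_isCont[OF test_function_smooth] by (intro continuous_at_imp_continuous_on) blast

lemma test_function_measurable [measurable_dest]: "\<phi> \<in> test_functions \<Omega> \<Longrightarrow> \<phi> \<in> borel_measurable borel"
  by (intro borel_measurable_continuous_onI test_function_continuous)

lemma test_functionI:
  assumes "smooth UNIV \<psi>" "compact K" "K \<subseteq> \<Omega>" "\<And>x. x \<notin> K \<Longrightarrow> \<psi> x = 0"
  shows "\<psi> \<in> test_functions \<Omega>"
proof -
  have "tsupport \<psi> \<subseteq> K" using assms by (intro closure_minimal) (auto intro: compact_imp_closed)
  moreover from this have "compact (tsupport \<psi>)"
    using compact_Int_closed[OF assms(2) closed_closure, of "{x. \<psi> x \<noteq> 0}"] by (simp add: inf.absorb2)
  ultimately show ?thesis using assms(1,3) unfolding test_functions_iff by blast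
qed

lemma test_function_zero_const: "(\<lambda>x. 0) \<in> test_functions \<Omega>"
  by (rule test_functionI[of _ "{}"]) (auto intro: smooth_const)

lemma test_function_add:
  assumes "\<phi> \<in> test_functions \<Omega>" "\<psi> \<in> test_functions \<Omega>"
  shows "(\<lambda>x. \<phi> x + \<psi> x) \<in> test_functions \<Omega>"
proof (rule test_functionI)
  show "smooth UNIV (\<lambda>x. \<phi> x + \<psi> x)" "compact (tsupport \<phi> \<union> tsupport \<psi>)" "tsupport \<phi> \<union> tsupport \<psi> \<subseteq> \<Omega>"
    using assms by (auto simp: test_functions_iff intro: smooth_add)
  show "\<phi> x + \<psi> x = 0" if "x \<notin> tsupport \<phi> \<union> tsupport \<psi>" for x
    using that zero_outside_tsupport[of x \<phi>] zero_outside_tsupport[of x \<psi>] by simp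
qed

text \<open>The factor, for instance ln x_p, is smooth only on a neighbourhood \<open>U\<close> of
  the domain. The product is smooth on \<open>U\<close> and zero off the support of \<phi>, and
  these two open sets cover the space.\<close>

lemma test_function_mult_smooth:
  assumes \<phi>: "\<phi> \<in> test_functions \<Omega>" and U: "open U" "\<Omega> \<subseteq> U" and \<rho>: "smooth U \<rho>"
  shows "(\<lambda>x. \<rho> x * \<phi> x) \<in> test_functions \<Omega>"
proof (rule test_functionI)
  have s: "smooth UNIV \<phi>" "compact (tsupport \<phi>)" "tsupport \<phi> \<subseteq> \<Omega>" using \<phi> by (auto simp: test_functions_iff)
  show "compact (tsupport \<phi>)" "tsupport \<phi> \<subseteq> \<Omega>" by fact+
  show "\<rho> x * \<phi> x = 0" if "x \<notin> tsupport \<phi>" for x using zero_outside_tsupport[OF that] by simp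
  have "smooth U (\<lambda>x. \<rho> x * \<phi> x)"
    using smooth_subset[OF s(1)] by (intro smooth_mult U \<rho>) auto
  moreover have "smooth (- tsupport \<phi>) (\<lambda>x. \<rho> x * \<phi> x)"
    by (rule smooth_cong[OF _ _ smooth_const[of _ 0]]) (use zero_outside_tsupport in force)+
  ultimately have "smooth (U \<union> - tsupport \<phi>) (\<lambda>x. \<rho> x * \<phi> x)"
    using U by (intro smooth_union) auto
  also have "U \<union> - tsupport \<phi> = UNIV" using U s by auto
  finally show "smooth UNIV (\<lambda>x. \<rho> x * \<phi> x)" .
qed

lemma test_function_mult:
  "\<phi> \<in> test_functions \<Omega> \<Longrightarrow> \<psi> \<in> test_functions \<Omega> \<Longrightarrow> (\<lambda>x. \<phi> x * \<psi> x) \<in> test_functions \<Omega>"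
  using test_function_mult_smooth[OF _ open_UNIV subset_UNIV test_function_smooth] .

lemma test_function_cmult: "\<phi> \<in> test_functions \<Omega> \<Longrightarrow> (\<lambda>x. c * \<phi> x) \<in> test_functions \<Omega>"
  using test_function_mult_smooth[OF _ open_UNIV subset_UNIV smooth_const] .

lemma test_function_nth_mult: "\<phi> \<in> test_functions \<Omega> \<Longrightarrow> (\<lambda>x. x $ i * \<phi> x) \<in> test_functions \<Omega>"
  using test_function_mult_smooth[OF _ open_UNIV subset_UNIV smooth_nth] .

lemma test_function_sum:
  "(\<And>i. i \<in> I \<Longrightarrow> \<phi> i \<in> test_functions \<Omega>) \<Longrightarrow> (\<lambda>x. \<Sum>i\<in>I. \<phi> i x) \<in> test_functions \<Omega>"
  by (induction I rule: infinite_finite_induct) (auto intro: test_function_add test_function_zero_const)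

lemma test_function_partial_deriv:
  assumes \<phi>: "\<phi> \<in> test_functions \<Omega>"
  shows "partial_deriv j \<phi> \<in> test_functions \<Omega>"
proof (rule test_functionI)
  have s: "smooth UNIV \<phi>" "compact (tsupport \<phi>)" "tsupport \<phi> \<subseteq> \<Omega>" using \<phi> by (auto simp: test_functions_iff)
  show "compact (tsupport \<phi>)" "tsupport \<phi> \<subseteq> \<Omega>" by fact+
  show "smooth UNIV (partial_deriv j \<phi>)" using s(1) by (rule smooth_partial_deriv)
  show "partial_deriv j \<phi> x = 0" if "x \<notin> tsupport \<phi>" for x
  proof -
    have "partial_deriv j \<phi> x = partial_deriv j (\<lambda>_. 0) x"
      by (rule partial_deriv_cong[of "- tsupport \<phi>"]) (use that zero_outside_tsupport in auto)
    then show ?thesis by simp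
  qed
qed

lemma test_function_bounded:
  assumes "\<phi> \<in> test_functions \<Omega>"
  obtains B where "\<And>x. \<bar>\<phi> x\<bar> \<le> B"
proof -
  have "compact (\<phi> ` tsupport \<phi>)"
    using assms by (intro compact_continuous_image test_function_continuous) (auto simp: test_functions_iff)
  then obtain B where "\<forall>y\<in>\<phi> ` tsupport \<phi>. norm y \<le> B"
    using compact_imp_bounded bounded_iff by metis
  then have B: "\<bar>\<phi> x\<bar> \<le> B" if "x \<in> tsupport \<phi>" for x using that by auto
  have "\<bar>\<phi> x\<bar> \<le> max 0 B" for x
    using B[of x] zero_outside_tsupport[of x \<phi>] by (cases "x \<in> tsupport \<phi>") auto
  then show ?thesis by (rule that)
qed

lemma test_function_integrable:
  assumes "\<phi> \<in> test_functions \<Omega>"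
  shows "integrable lborel \<phi>"
proof -
  have "integrable lborel (\<lambda>x. indicator (tsupport \<phi>) x *\<^sub>R \<phi> x)"
    using assms by (intro borel_integrable_compact test_function_continuous) (auto simp: test_functions_iff)
  also have "(\<lambda>x. indicator (tsupport \<phi>) x *\<^sub>R \<phi> x) = \<phi>"
  proof
    fix x show "indicator (tsupport \<phi>) x *\<^sub>R \<phi> x = \<phi> x"
      using zero_outside_tsupport[of x \<phi>] by (cases "x \<in> tsupport \<phi>") simp_all
  qed
  finally show ?thesis .
qed

lemma lborel_translation:
  fixes f :: "'a::euclidean_space \<Rightarrow> real"
  assumes "integrable lborel f"
  shows "integrable lborel (\<lambda>x. f (x + c))" "(\<integral>x. f (x + c) \<partial>lborel) = (\<integral>x. f x \<partial>lborel)"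
proof -
  have i: "integrable (distr lborel borel ((+) c)) f" using assms by (simp add: lborel_distr_plus)
  have m: "f \<in> borel_measurable borel" using assms by auto
  show "integrable lborel (\<lambda>x. f (x + c))"
    using i m by (subst (asm) integrable_distr_eq) (auto simp: add.commute)
  have "(\<integral>x. f x \<partial>lborel) = (\<integral>x. f x \<partial>distr lborel borel ((+) c))" by (simp add: lborel_distr_plus)
  also have "\<dots> = (\<integral>x. f (x + c) \<partial>lborel)"
    using m by (subst integral_distr) (auto simp: add.commute)
  finally show "(\<integral>x. f (x + c) \<partial>lborel) = (\<integral>x. f x \<partial>lborel)" by simp
qed

text \<open>Difference quotients have integral zero by translation invariance and converge dominatedly.\<close>

lemma integral_partial_deriv_zero:
  assumes \<phi>: "\<phi> \<in> test_functions \<Omega>"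
  shows "(\<integral>x. partial_deriv j \<phi> x \<partial>lborel) = 0"
proof -
  define a where "a = (\<lambda>m. inverse (real (Suc m)))"
  have a: "0 < a m" "a m \<le> 1" for m by (auto simp: a_def field_simps)
  define s where "s = (\<lambda>m x. (\<phi> (x + a m *\<^sub>R axis j 1) - \<phi> x) / a m)"
  obtain B where B: "\<And>x. \<bar>partial_deriv j \<phi> x\<bar> \<le> B"
    using test_function_bounded[OF test_function_partial_deriv[OF \<phi>]] by blast
  have "bounded (tsupport \<phi>)" using \<phi> by (intro compact_imp_bounded) (simp add: test_functions_iff)
  then obtain r where "\<forall>x\<in>tsupport \<phi>. norm x \<le> r" unfolding bounded_iff by blast
  then have r: "norm x \<le> r" if "x \<in> tsupport \<phi>" for x using that by blast
  \<comment> \<open>Inside the ball the mean value theorem applies; outside, both values of \<phi>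
    vanish because the shift has length at most 1.\<close>
  have s_bound: "\<bar>s m x\<bar> \<le> B * indicator (cball 0 (r + 1)) x" for m x
  proof (cases "norm x \<le> r + 1")
    case True
    have "((\<lambda>t. \<phi> (x + t *\<^sub>R axis j 1)) has_real_derivative partial_deriv j \<phi> (x + t *\<^sub>R axis j 1)) (at t)" for t
      using \<phi> by (intro has_real_derivative_axis) simp
    from MVT2[OF a(1)[of m] this] obtain t where
      "\<phi> (x + a m *\<^sub>R axis j 1) - \<phi> x = a m * partial_deriv j \<phi> (x + t *\<^sub>R axis j 1)" by auto
    then have "s m x = partial_deriv j \<phi> (x + t *\<^sub>R axis j 1)" using a(1)[of m] by (simp add: s_def)
    then show ?thesis using B True by (simp add: indicator_def)
  next
    case False
    have "norm x \<le> norm (x + a m *\<^sub>R axis j 1) + norm (a m *\<^sub>R axis j (1::real))"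
      using norm_triangle_ineq4[of "x + a m *\<^sub>R axis j 1" "a m *\<^sub>R axis j 1"] by simp
    also have "norm (a m *\<^sub>R axis j (1::real)) \<le> 1" using a[of m] by simp
    finally have "\<not> norm (x + a m *\<^sub>R axis j 1) \<le> r" using False by simp
    then have "\<phi> (x + a m *\<^sub>R axis j 1) = 0" using r zero_outside_tsupport by blast
    moreover have "\<phi> x = 0" using False r[of x] zero_outside_tsupport[of x \<phi>] by auto
    ultimately show ?thesis using False by (simp add: s_def)
  qed
  have a0: "a \<longlonglongrightarrow> 0" unfolding a_def by (rule LIMSEQ_inverse_real_of_nat)
  have s_lim: "(\<lambda>m. s m x) \<longlonglongrightarrow> partial_deriv j \<phi> x" for x
  proof -
    have "((\<lambda>t. \<phi> (x + t *\<^sub>R axis j 1)) has_real_derivative partial_deriv j \<phi> (x + 0 *\<^sub>R axis j 1)) (at 0)"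
      using \<phi> by (intro has_real_derivative_axis) simp
    then have "((\<lambda>t. (\<phi> (x + t *\<^sub>R axis j 1) - \<phi> x) / t) \<longlongrightarrow> partial_deriv j \<phi> x) (at 0)"
      by (simp add: DERIV_def)
    moreover have "filterlim a (at 0) sequentially"
      using a0 a(1) by (auto simp: filterlim_at less_imp_neq[symmetric])
    ultimately show ?thesis unfolding s_def by (rule filterlim_compose)
  qed
  note [measurable] = test_function_measurable[OF \<phi>] test_function_measurable[OF test_function_partial_deriv[OF \<phi>]]
  have "(\<lambda>m. \<integral>x. s m x \<partial>lborel) \<longlonglongrightarrow> (\<integral>x. partial_deriv j \<phi> x \<partial>lborel)"
  proof (rule integral_dominated_convergence)
    show "integrable lborel (\<lambda>x. B * indicator (cball 0 (r + 1)) x)"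
      by (intro integrable_mult_right integrable_real_indicator emeasure_lborel_cball_finite) simp
  qed (use s_bound s_lim in \<open>auto simp: s_def\<close>)
  moreover have "(\<integral>x. s m x \<partial>lborel) = 0" for m
    using lborel_translation[OF test_function_integrable[OF \<phi>], of "a m *\<^sub>R axis j 1"] test_function_integrable[OF \<phi>]
    by (simp add: s_def)
  ultimately show ?thesis by (simp add: LIMSEQ_const_iff)
qed

section \<open>Bounded hyperbolic domains and their volume measure\<close>

locale hyp_domain =
  fixes p :: "'n::finite" and \<Omega> :: "(real ^ 'n) set"
  assumes bounded_domain: "bounded_hyp_domain p \<Omega>"
begin

abbreviation D :: "(real ^ 'n \<Rightarrow> real) set" where "D \<equiv> test_functions \<Omega>"
abbreviation M :: "(real ^ 'n) measure" where "M \<equiv> hyp_volume p \<Omega>"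
abbreviation ip :: "(real ^ 'n \<Rightarrow> real) \<Rightarrow> (real ^ 'n \<Rightarrow> real) \<Rightarrow> real" where "ip \<equiv> l2_inner M"

lemma open_domain: "open \<Omega>" and domain_subset: "\<Omega> \<subseteq> hyp_space p" and domain_nonempty: "\<Omega> \<noteq> {}"
  using bounded_domain by (auto simp: bounded_hyp_domain_def)

lemma domain_pos: "x \<in> \<Omega> \<Longrightarrow> 0 < x $ p"
  using domain_subset by (auto simp: hyp_space_def)

text \<open>For a fixed point y the distance bound reads |x - y|^2 \<le> 2 C x_p y_p with C = cosh R
  - 1. For the coordinate p this gives x_p^2 + y_p^2 \<le> 2 (1 + C) x_p y_p, which bounds x_p from
  above and away from 0; the upper bound in turn bounds |x|.\<close>

lemma domain_bounds:
  obtains a b r where "0 < a" "\<And>x. x \<in> \<Omega> \<Longrightarrow> a \<le> x $ p" "\<And>x. x \<in> \<Omega> \<Longrightarrow> x $ p \<le> b"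
    "\<And>x. x \<in> \<Omega> \<Longrightarrow> norm x \<le> r"
proof -
  obtain R where R: "\<And>x y. x \<in> \<Omega> \<Longrightarrow> y \<in> \<Omega> \<Longrightarrow> hyp_dist p x y \<le> R"
    using bounded_domain by (auto simp: bounded_hyp_domain_def)
  obtain y where y: "y \<in> \<Omega>" using domain_nonempty by blast
  have yp: "0 < y $ p" using domain_pos[OF y] .
  define C where "C = cosh R - 1"
  have C0: "C \<ge> 0" using cosh_real_ge_1[of R] by (simp add: C_def)
  have R0: "R \<ge> 0" using R[OF y y] by (simp add: hyp_dist_def)
  have key: "(dist x y)\<^sup>2 \<le> 2 * C * x $ p * y $ p" if x: "x \<in> \<Omega>" for x
  proof -
    have xp: "0 < x $ p" using domain_pos[OF x] .
    define z where "z = 1 + (dist x y)\<^sup>2 / (2 * x $ p * y $ p)"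
    have z: "1 \<le> z" using xp yp by (simp add: z_def)
    have "arcosh z \<le> R" using R[OF x y] by (simp add: hyp_dist_def z_def)
    then have "cosh (arcosh z) \<le> cosh R" using z R0 by (subst cosh_real_nonneg_le_iff) auto
    then have "z \<le> cosh R" using z by simp
    then show ?thesis using xp yp by (simp add: z_def C_def field_simps)
  qed
  have coord: "(x $ p - y $ p)\<^sup>2 \<le> 2 * C * x $ p * y $ p" if x: "x \<in> \<Omega>" for x
  proof -
    have "\<bar>x $ p - y $ p\<bar> \<le> dist x y"
      using component_le_norm_cart[of "x - y" p] by (simp add: dist_norm)
    from power_mono[OF this abs_ge_zero, of 2] have "(x $ p - y $ p)\<^sup>2 \<le> (dist x y)\<^sup>2" by simp
    then show ?thesis using key[OF x] by linarith
  qed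
  have expand: "x $ p * x $ p + y $ p * y $ p \<le> 2 * (1 + C) * (x $ p * y $ p)" if x: "x \<in> \<Omega>" for x
    using coord[OF x] by (simp add: power2_eq_square algebra_simps)
  have up: "x $ p \<le> 2 * (1 + C) * y $ p" if x: "x \<in> \<Omega>" for x
  proof -
    have "x $ p * x $ p \<le> x $ p * (2 * (1 + C) * y $ p)"
    proof -
      have "x $ p * (2 * (1 + C) * y $ p) = 2 * (1 + C) * (x $ p * y $ p)" by simp
      then show ?thesis using expand[OF x] zero_le_square[of "y $ p"] by linarith
    qed
    then show ?thesis using domain_pos[OF x] by simp
  qed
  have low: "y $ p / (2 * (1 + C)) \<le> x $ p" if x: "x \<in> \<Omega>" for x
  proof -
    have "y $ p * y $ p \<le> y $ p * (2 * (1 + C) * x $ p)"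
    proof -
      have "y $ p * (2 * (1 + C) * x $ p) = 2 * (1 + C) * (x $ p * y $ p)" by simp
      then show ?thesis using expand[OF x] zero_le_square[of "x $ p"] by linarith
    qed
    then have "y $ p \<le> 2 * (1 + C) * x $ p" using yp by simp
    then show ?thesis using C0 by (simp add: field_simps)
  qed
  have "norm x \<le> norm y + sqrt (2 * C * (2 * (1 + C) * y $ p) * y $ p)" if x: "x \<in> \<Omega>" for x
  proof -
    have "(dist x y)\<^sup>2 \<le> 2 * C * (2 * (1 + C) * y $ p) * y $ p"
      using key[OF x] mult_right_mono[OF mult_left_mono[OF up[OF x], of "2 * C"], of "y $ p"] C0 yp by simp
    then have "dist x y \<le> sqrt (2 * C * (2 * (1 + C) * y $ p) * y $ p)" by (rule real_le_rsqrt)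
    then show ?thesis using norm_triangle_sub[of x y] by (simp add: dist_norm)
  qed
  moreover have "0 < y $ p / (2 * (1 + C))" using yp C0 by simp
  ultimately show ?thesis using that low up by blast
qed

lemma space_M [simp]: "space M = \<Omega>"
  by (simp add: hyp_volume_def space_restrict_space)

lemma borel_measurable_M [measurable (raw)]: "f \<in> borel_measurable borel \<Longrightarrow> f \<in> borel_measurable M"
  by (simp add: hyp_volume_def measurable_restrict_space1)

lemma integral_M:
  fixes f :: "real ^ 'n \<Rightarrow> real"
  assumes [measurable]: "f \<in> borel_measurable borel" and "\<And>x. x \<notin> \<Omega> \<Longrightarrow> f x = 0"
  shows "(\<integral>x. f x \<partial>M) = (\<integral>x. (1 / x $ p) ^ CARD('n) * f x \<partial>lborel)"
proof -
  have [measurable]: "f \<in> borel_measurable (restrict_space lborel \<Omega>)"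
    "(\<lambda>x. 1 / x $ p ^ CARD('n)) \<in> borel_measurable (restrict_space lborel \<Omega>)"
    by (auto intro: measurable_restrict_space1)
  have "(\<integral>x. f x \<partial>M) = (\<integral>x. (1 / x $ p ^ CARD('n)) *\<^sub>R f x \<partial>restrict_space lborel \<Omega>)"
    unfolding hyp_volume_def
    by (rule integral_density) (auto intro!: AE_I2 simp: space_restrict_space domain_pos less_imp_le)
  also have "\<dots> = (\<integral>x. indicator \<Omega> x *\<^sub>R ((1 / x $ p ^ CARD('n)) *\<^sub>R f x) \<partial>lborel)"
    using open_domain by (subst integral_restrict_space) auto
  also have "\<dots> = (\<integral>x. (1 / x $ p) ^ CARD('n) * f x \<partial>lborel)"
    using assms(2) by (intro Bochner_Integration.integral_cong) (auto simp: indicator_def power_divide)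
  finally show ?thesis .
qed

lemma finite_measure_M: "finite_measure M"
proof
  obtain a b r where ab: "0 < a" "\<And>x. x \<in> \<Omega> \<Longrightarrow> a \<le> x $ p" "\<And>x. x \<in> \<Omega> \<Longrightarrow> x $ p \<le> b"
      "\<And>x. x \<in> \<Omega> \<Longrightarrow> norm x \<le> r"
    by (rule domain_bounds) (rule that)
  have "emeasure M (space M) = (\<integral>\<^sup>+x. 1 \<partial>M)" by simp
  also have "\<dots> = (\<integral>\<^sup>+x. ennreal (1 / x $ p ^ CARD('n)) * 1 \<partial>restrict_space lborel \<Omega>)"
    unfolding hyp_volume_def by (rule nn_integral_density) (auto intro: measurable_restrict_space1)
  also have "\<dots> \<le> (\<integral>\<^sup>+x. ennreal (1 / a ^ CARD('n)) \<partial>restrict_space lborel \<Omega>)"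
    using ab domain_pos
    by (intro nn_integral_mono) (auto simp: space_restrict_space intro!: ennreal_leI divide_left_mono power_mono)
  also have "\<dots> = ennreal (1 / a ^ CARD('n)) * emeasure lborel \<Omega>"
    using open_domain by (simp add: space_restrict_space emeasure_restrict_space)
  also have "\<dots> < \<infinity>"
  proof -
    have "\<Omega> \<subseteq> cball 0 r" using ab by auto
    then have "emeasure lborel \<Omega> \<le> emeasure lborel (cball (0::real ^ 'n) r)" by (intro emeasure_mono) auto
    also have "\<dots> < \<infinity>" by (rule emeasure_lborel_cball_finite)
    finally show ?thesis by (simp add: ennreal_mult_less_top)
  qed
  finally show "emeasure M (space M) \<noteq> \<infinity>" by simp
qed

lemma bounded_integrable_M:
  fixes f :: "real ^ 'n \<Rightarrow> real"
  assumes "f \<in> borel_measurable M" "\<And>x. x \<in> \<Omega> \<Longrightarrow> \<bar>f x\<bar> \<le> B"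
  shows "integrable M f"
  using assms by (intro finite_measure.integrable_const_bound[OF finite_measure_M, of _ B]) auto

lemma bounded_L2_M:
  assumes "f \<in> borel_measurable M" "\<And>x. x \<in> \<Omega> \<Longrightarrow> \<bar>f x\<bar> \<le> B"
  shows "f \<in> L2 M"
proof -
  have "integrable M (\<lambda>x. (f x)\<^sup>2)"
    using assms power_mono[OF assms(2) abs_ge_zero, of _ 2] by (intro bounded_integrable_M[of _ "B\<^sup>2"]) auto
  then show ?thesis using assms(1) by (simp add: L2_def)
qed

lemma D_L2 [simp]: "\<phi> \<in> D \<Longrightarrow> \<phi> \<in> L2 M"
  by (metis bounded_L2_M borel_measurable_M test_function_bounded test_function_measurable)

lemma D_add [simp]: "\<phi> \<in> D \<Longrightarrow> \<psi> \<in> D \<Longrightarrow> \<phi> + \<psi> \<in> D"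
  using test_function_add by (simp add: plus_fun_def)

lemma D_scale [simp]: "\<phi> \<in> D \<Longrightarrow> c *\<^sub>R \<phi> \<in> D"
  using test_function_cmult by (simp add: scaleR_fun_def)

lemma subspace_D: "subspace D"
  using test_function_zero_const by (intro subspaceI) (auto simp: zero_fun_def)

lemma D_diff [simp]: "\<phi> \<in> D \<Longrightarrow> \<psi> \<in> D \<Longrightarrow> \<phi> - \<psi> \<in> D"
  using subspace_D by (rule subspace_diff)

lemma D_partial [simp]: "\<phi> \<in> D \<Longrightarrow> partial_deriv j \<phi> \<in> D"
  by (rule test_function_partial_deriv)

lemma D_mult_smooth: "smooth (hyp_space p) \<rho> \<Longrightarrow> \<phi> \<in> D \<Longrightarrow> (\<lambda>x. \<rho> x * \<phi> x) \<in> D"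
  by (rule test_function_mult_smooth[OF _ open_hyp_space domain_subset])

lemma D_nth_mult [simp]: "\<phi> \<in> D \<Longrightarrow> (\<lambda>x. x $ i * \<phi> x) \<in> D"
  by (rule test_function_nth_mult)

lemma D_eqI:
  "\<phi> \<in> D \<Longrightarrow> \<psi> \<in> D \<Longrightarrow> (\<And>x. x \<in> \<Omega> \<Longrightarrow> \<phi> x = \<psi> x) \<Longrightarrow> \<phi> = \<psi>"
  using test_function_zero by (metis ext)

lemma inverse_power_deriv:
  assumes "x \<in> \<Omega>"
  shows "partial_deriv j (\<lambda>x. (1 / x $ p) ^ k) x = (if j = p then - real k * (1 / x $ p) ^ Suc k else 0)"
proof -
  define q where "q = 1 / x $ p"
  have "((\<lambda>t. 1 / t) has_real_derivative - (q * q)) (at (x $ p))"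
    using domain_pos[OF assms] by (auto intro!: derivative_eq_intros simp: q_def)
  from DERIV_power[OF this, of k]
  have "((\<lambda>t. (1 / t) ^ k) has_real_derivative real k * (- (q * q) * q ^ (k - Suc 0))) (at (x $ p))"
    by (simp only: q_def)
  moreover have "real k * (- (q * q) * q ^ (k - Suc 0)) = - real k * q ^ Suc k"
    by (cases k) (auto simp: algebra_simps)
  ultimately show ?thesis
    using partial_deriv_nth_compose[of "\<lambda>t. (1 / t) ^ k" "- real k * q ^ Suc k" x p j] by (simp only: q_def)
qed

lemma smooth_inverse_power: "smooth (hyp_space p) (\<lambda>x. (1 / x $ p) ^ k)"
proof (induction k)
  case (Suc k)
  then show ?case by (simp only: power_Suc) (intro smooth_mult open_hyp_space smooth_inverse_nth)
qed (simp add: smooth_const)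

text \<open>The Lebesgue integral of a derivative of w \<theta> vanishes, where w = (1/x_p)^n is the
  volume density; differentiating w in direction p produces the factor n/x_p.\<close>

lemma integral_M_partial_deriv:
  assumes \<theta>: "\<theta> \<in> D"
  shows "(\<integral>x. partial_deriv j \<theta> x \<partial>M) = (if j = p then real CARD('n) else 0) * (\<integral>x. 1 / x $ p * \<theta> x \<partial>M)"
proof -
  define n where "n = CARD('n)"
  define w where "w = (\<lambda>x::real ^ 'n. (1 / x $ p) ^ n)"
  have w: "smooth (hyp_space p) w" unfolding w_def by (rule smooth_inverse_power)
  have w\<theta>: "(\<lambda>x. w x * \<theta> x) \<in> D" using w \<theta> by (rule D_mult_smooth)
  have w\<theta>': "(\<lambda>x. w x * partial_deriv j \<theta> x) \<in> D" using w \<theta> by (intro D_mult_smooth) auto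
  have x\<theta>: "(\<lambda>x. 1 / x $ p * \<theta> x) \<in> D" using smooth_inverse_nth \<theta> by (rule D_mult_smooth)
  have wx\<theta>: "(\<lambda>x. w x * (1 / x $ p * \<theta> x)) \<in> D" using w x\<theta> by (rule D_mult_smooth)
  have "partial_deriv j (\<lambda>x. w x * \<theta> x) x
      = w x * partial_deriv j \<theta> x - (if j = p then real CARD('n) else 0) * (w x * (1 / x $ p * \<theta> x))" for x
  proof (cases "x \<in> \<Omega>")
    case True
    have "w differentiable at x" using smooth_differentiable[OF w open_hyp_space] True domain_subset by auto
    then have "partial_deriv j (\<lambda>x. w x * \<theta> x) x = w x * partial_deriv j \<theta> x + partial_deriv j w x * \<theta> x"
      using \<theta> by (intro partial_deriv_mult) auto
    then show ?thesis using inverse_power_deriv[OF True, of j n] by (simp add: w_def n_def)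
  next
    case False
    have "\<theta> x = 0" "partial_deriv j \<theta> x = 0" "partial_deriv j (\<lambda>x. w x * \<theta> x) x = 0"
      by (intro test_function_zero[OF _ False] \<theta> w\<theta> D_partial)+
    then show ?thesis by simp
  qed
  then have "(\<integral>x. partial_deriv j (\<lambda>x. w x * \<theta> x) x \<partial>lborel)
      = (\<integral>x. w x * partial_deriv j \<theta> x - (if j = p then real CARD('n) else 0) * (w x * (1 / x $ p * \<theta> x)) \<partial>lborel)"
    by simp
  also have "\<dots> = (\<integral>x. w x * partial_deriv j \<theta> x \<partial>lborel)
      - (if j = p then real CARD('n) else 0) * (\<integral>x. w x * (1 / x $ p * \<theta> x) \<partial>lborel)"
    using Bochner_Integration.integral_diff[OF test_function_integrable[OF w\<theta>']
        integrable_mult_right[OF test_function_integrable[OF wx\<theta>], of "if j = p then real CARD('n) else 0"]]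
    unfolding integral_mult_right_zero by simp
  also have "(\<integral>x. w x * partial_deriv j \<theta> x \<partial>lborel) = (\<integral>x. partial_deriv j \<theta> x \<partial>M)"
    using \<theta> test_function_zero[OF D_partial[OF \<theta>]] unfolding w_def n_def
    by (intro integral_M[symmetric] test_function_measurable[OF D_partial[OF \<theta>]]) auto
  also have "(\<integral>x. w x * (1 / x $ p * \<theta> x) \<partial>lborel) = (\<integral>x. 1 / x $ p * \<theta> x \<partial>M)"
    using test_function_zero[OF x\<theta>] unfolding w_def n_def
    by (intro integral_M[symmetric] test_function_measurable[OF x\<theta>]) auto
  finally show ?thesis using integral_partial_deriv_zero[OF w\<theta>, of j] by simp
qed

lemma integration_by_parts_M:
  assumes "\<phi> \<in> D" "\<psi> \<in> D"
  shows "ip (partial_deriv j \<phi>) \<psi> + ip \<phi> (partial_deriv j \<psi>)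
    = (if j = p then real CARD('n) else 0) * ip \<phi> (\<lambda>x. 1 / x $ p * \<psi> x)"
proof -
  have p: "partial_deriv j (\<lambda>x. \<phi> x * \<psi> x) x = partial_deriv j \<phi> x * \<psi> x + \<phi> x * partial_deriv j \<psi> x" for x
    using assms by (subst partial_deriv_mult) auto
  have "ip (partial_deriv j \<phi>) \<psi> + ip \<phi> (partial_deriv j \<psi>) = (\<integral>x. partial_deriv j (\<lambda>x. \<phi> x * \<psi> x) x \<partial>M)"
    unfolding p l2_inner_def using assms
    by (intro Bochner_Integration.integral_add[symmetric] L2_integrable_mult) auto
  also have "\<dots> = (if j = p then real CARD('n) else 0) * (\<integral>x. 1 / x $ p * (\<phi> x * \<psi> x) \<partial>M)"
    using assms by (intro integral_M_partial_deriv test_function_mult)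
  also have "(\<integral>x. 1 / x $ p * (\<phi> x * \<psi> x) \<partial>M) = ip \<phi> (\<lambda>x. 1 / x $ p * \<psi> x)"
    unfolding l2_inner_def by (intro Bochner_Integration.integral_cong) auto
  finally show ?thesis .
qed

end

section \<open>The hyperbolic Laplacian\<close>

context hyp_domain
begin

abbreviation L :: "(real ^ 'n \<Rightarrow> real) \<Rightarrow> real ^ 'n \<Rightarrow> real" where "L \<equiv> hyp_laplacian p"

abbreviation xm :: "(real ^ 'n \<Rightarrow> real) \<Rightarrow> real ^ 'n \<Rightarrow> real" where "xm f \<equiv> (\<lambda>x. x $ p * f x)"

lemma partial_deriv_xm:
  "f differentiable at x \<Longrightarrow> partial_deriv j (xm f) x = x $ p * partial_deriv j f x + (if j = p then f x else 0)"
  by (subst partial_deriv_mult) (auto simp: partial_deriv_nth)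

lemma D_differentiable [simp]: "\<phi> \<in> D \<Longrightarrow> \<phi> differentiable at x"
  by (rule test_function_differentiable)

lemma partial_deriv_diff:
  assumes "\<phi> \<in> D" "\<psi> \<in> D"
  shows "partial_deriv j (\<phi> - \<psi>) = partial_deriv j \<phi> - partial_deriv j \<psi>"
proof
  fix x
  have e: "\<phi> - \<psi> = (\<lambda>x. \<phi> x + (- 1) * \<psi> x)" by auto
  show "partial_deriv j (\<phi> - \<psi>) x = (partial_deriv j \<phi> - partial_deriv j \<psi>) x"
    using partial_deriv_add[of \<phi> x "\<lambda>x. (- 1) * \<psi> x" j] partial_deriv_cmult[of \<psi> x j "- 1"]
      test_function_cmult[OF assms(2), of "- 1"] assms unfolding e by simp
qed

lemma sum_delta_mult: "(\<Sum>j\<in>UNIV. (if j = p then c else 0) * g j) = c * g p" for c :: real and g :: "'n \<Rightarrow> real"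
proof -
  have "(\<Sum>j\<in>UNIV. (if j = p then c else 0) * g j) = (\<Sum>j\<in>UNIV. if j = p then c * g p else 0)"
    by (intro sum.cong) auto
  then show ?thesis by simp
qed

text \<open>Differentiating the factor (x_p)^2 produces 2 x_p \<partial>_p, and n x_p \<partial>_p
  is subtracted. In this shape the subtracted term cancels the density term of
  \<open>integration_by_parts_M\<close>.\<close>

lemma laplacian_divergence_form:
  assumes "\<psi> \<in> D"
  shows "L \<psi> = (\<Sum>j\<in>UNIV. partial_deriv j (xm (xm (partial_deriv j \<psi>)))
      - (if j = p then real CARD('n) else 0) *\<^sub>R xm (partial_deriv j \<psi>))"
proof
  fix x
  have "partial_deriv j (xm (xm (partial_deriv j \<psi>))) x
      = x $ p * x $ p * partial_deriv j (partial_deriv j \<psi>) x + (if j = p then 2 else 0) * (x $ p * partial_deriv j \<psi> x)" for j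
    using assms partial_deriv_xm[of "xm (partial_deriv j \<psi>)" x j] partial_deriv_xm[of "partial_deriv j \<psi>" x j]
    by (auto simp: algebra_simps)
  then have "(\<Sum>j\<in>UNIV. partial_deriv j (xm (xm (partial_deriv j \<psi>)))
      - (if j = p then real CARD('n) else 0) *\<^sub>R xm (partial_deriv j \<psi>)) x
    = (\<Sum>j\<in>UNIV. x $ p * x $ p * partial_deriv j (partial_deriv j \<psi>) x)
      + (\<Sum>j\<in>UNIV. (if j = p then 2 else 0) * (x $ p * partial_deriv j \<psi> x))
      - (\<Sum>j\<in>UNIV. (if j = p then real CARD('n) else 0) * (x $ p * partial_deriv j \<psi> x))"
    by (simp add: sum_fun_apply sum.distrib sum_subtractf)
  also have "\<dots> = L \<psi> x"
    unfolding sum_delta_mult by (simp add: hyp_laplacian_def sum_distrib_left power2_eq_square algebra_simps)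
  finally show "L \<psi> x = (\<Sum>j\<in>UNIV. partial_deriv j (xm (xm (partial_deriv j \<psi>)))
      - (if j = p then real CARD('n) else 0) *\<^sub>R xm (partial_deriv j \<psi>)) x" by simp
qed

lemma L_in_D [simp]:
  assumes "\<psi> \<in> D"
  shows "L \<psi> \<in> D"
  unfolding laplacian_divergence_form[OF assms] using assms
  by (intro subspace_sum[OF subspace_D] D_diff D_scale D_partial D_nth_mult)

sublocale HS: semi_hilbert "L2 M" ip
  by (rule semi_hilbert_L2)

lemma ip_cong: "(\<And>x. x \<in> \<Omega> \<Longrightarrow> u x * v x = u' x * v' x) \<Longrightarrow> ip u v = ip u' v'"
  unfolding l2_inner_def by (intro Bochner_Integration.integral_cong) auto

text \<open>Green's formula. The hyperbolic gradient has squared length (x_p)^2 times the Euclidean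
  one, hence the factors \<open>xm\<close> on the derivatives.\<close>

lemma dirichlet_form:
  assumes \<phi>: "\<phi> \<in> D" and \<psi>: "\<psi> \<in> D"
  shows "ip \<phi> (L \<psi>) = - (\<Sum>j\<in>UNIV. ip (xm (partial_deriv j \<phi>)) (xm (partial_deriv j \<psi>)))"
proof -
  have j: "ip \<phi> (partial_deriv j (xm (xm (partial_deriv j \<psi>))) - (if j = p then real CARD('n) else 0) *\<^sub>R xm (partial_deriv j \<psi>))
      = - ip (xm (partial_deriv j \<phi>)) (xm (partial_deriv j \<psi>))" for j
  proof -
    have "ip (partial_deriv j \<phi>) (xm (xm (partial_deriv j \<psi>))) + ip \<phi> (partial_deriv j (xm (xm (partial_deriv j \<psi>))))
        = (if j = p then real CARD('n) else 0) * ip \<phi> (\<lambda>x. 1 / x $ p * xm (xm (partial_deriv j \<psi>)) x)"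
      using assms by (intro integration_by_parts_M) auto
    also have "ip \<phi> (\<lambda>x. 1 / x $ p * xm (xm (partial_deriv j \<psi>)) x) = ip \<phi> (xm (partial_deriv j \<psi>))"
      using domain_pos by (intro ip_cong) force
    also have "ip (partial_deriv j \<phi>) (xm (xm (partial_deriv j \<psi>))) = ip (xm (partial_deriv j \<phi>)) (xm (partial_deriv j \<psi>))"
      by (intro ip_cong) simp
    finally show ?thesis using assms by (simp add: algebra_simps)
  qed
  show ?thesis
    unfolding laplacian_divergence_form[OF \<psi>]
    by (subst HS.ip_sum_right) (use assms in \<open>simp_all only: j sum_negf, auto intro!: L2_diff L2_scale D_L2\<close>)
qed

sublocale HS: symmetric_operator "L2 M" ip D L
proof
  show "subspace D" by (rule subspace_D)
  show "D \<subseteq> L2 M" by auto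
  fix \<phi> \<psi> :: "real ^ 'n \<Rightarrow> real" and c :: real assume \<phi>: "\<phi> \<in> D"
  show "L \<phi> \<in> D" using \<phi> by simp
  have c: "partial_deriv j (c *\<^sub>R \<phi>) = c *\<^sub>R partial_deriv j \<phi>" if "\<phi> \<in> D" for j \<phi>
    using partial_deriv_cmult[of \<phi> _ j c] that by (auto simp: scaleR_fun_def)
  show "L (c *\<^sub>R \<phi>) = c *\<^sub>R L \<phi>"
    using \<phi> by (auto simp: hyp_laplacian_def c fun_eq_iff sum_distrib_left algebra_simps)
  assume \<psi>: "\<psi> \<in> D"
  have a: "partial_deriv j (\<phi> + \<psi>) = partial_deriv j \<phi> + partial_deriv j \<psi>" if "\<phi> \<in> D" "\<psi> \<in> D" for j \<phi> \<psi>
    using partial_deriv_add[of \<phi> _ \<psi> j] that by (auto simp: plus_fun_def)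
  show "L (\<phi> + \<psi>) = L \<phi> + L \<psi>"
    using \<phi> \<psi> by (auto simp: hyp_laplacian_def a fun_eq_iff sum.distrib algebra_simps)
  have "ip (L \<phi>) \<psi> = ip \<psi> (L \<phi>)" using \<phi> \<psi> by (intro HS.ip_commute) auto
  also have "\<dots> = ip \<phi> (L \<psi>)"
    using \<phi> \<psi> by (simp add: dirichlet_form HS.ip_commute[of "xm (partial_deriv _ \<psi>)"])
  finally show "ip (L \<phi>) \<psi> = ip \<phi> (L \<psi>)" .
qed

text \<open>
  The function \<open>F = ln x\<^sub>n\<close> has \<open>\<bar>\<nabla>F\<bar> = 1\<close> and \<open>\<Delta>F = 1 - n\<close>, so the commutator of \<open>\<Delta>\<close> with
  multiplication by \<open>F\<close> is \<open>2 \<nabla>F \<cdot> \<nabla> + \<Delta>F = 2 x\<^sub>n \<partial>\<^sub>n - (n - 1)\<close>.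
\<close>

definition lnm :: "(real ^ 'n \<Rightarrow> real) \<Rightarrow> real ^ 'n \<Rightarrow> real" where
  "lnm u = (\<lambda>x. ln (x $ p) * u x)"

definition drift :: "(real ^ 'n \<Rightarrow> real) \<Rightarrow> real ^ 'n \<Rightarrow> real" where
  "drift u = (\<lambda>x. 2 * (x $ p * partial_deriv p u x) - (real CARD('n) - 1) * u x)"

lemma drift_eq: "drift \<phi> = 2 *\<^sub>R xm (partial_deriv p \<phi>) - (real CARD('n) - 1) *\<^sub>R \<phi>"
  by (auto simp: drift_def)

lemma lnm_in_D [simp]: "\<phi> \<in> D \<Longrightarrow> lnm \<phi> \<in> D"
  unfolding lnm_def using smooth_ln_nth by (rule D_mult_smooth)

lemma inverse_mult_in_D [simp]: "\<phi> \<in> D \<Longrightarrow> (\<lambda>x. 1 / x $ p * \<phi> x) \<in> D"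
  using smooth_inverse_nth by (rule D_mult_smooth)

lemma drift_in_D [simp]: "\<phi> \<in> D \<Longrightarrow> drift \<phi> \<in> D"
  unfolding drift_eq by (intro D_diff D_scale D_nth_mult D_partial)

lemma partial_deriv_lnm:
  assumes "\<phi> \<in> D" "x \<in> \<Omega>"
  shows "partial_deriv j (lnm \<phi>) x = ln (x $ p) * partial_deriv j \<phi> x + (if j = p then 1 else 0) * (1 / x $ p * \<phi> x)"
proof -
  have x: "x \<in> hyp_space p" using assms domain_subset by auto
  show ?thesis
    unfolding lnm_def using assms smooth_differentiable[OF smooth_ln_nth open_hyp_space x] partial_deriv_ln_nth[OF x, of j]
    by (subst partial_deriv_mult) auto
qed

lemma partial_deriv_inverse_mult:
  assumes "\<phi> \<in> D" "x \<in> \<Omega>"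
  shows "partial_deriv j (\<lambda>x. 1 / x $ p * \<phi> x) x
    = 1 / x $ p * partial_deriv j \<phi> x - (if j = p then 1 else 0) * ((1 / x $ p)\<^sup>2 * \<phi> x)"
proof -
  have x: "x \<in> hyp_space p" using assms domain_subset by auto
  show ?thesis
    using assms smooth_differentiable[OF smooth_inverse_nth open_hyp_space x] inverse_power_deriv[OF assms(2), of j 1]
    by (subst partial_deriv_mult) (auto simp: power2_eq_square)
qed

lemma laplacian_lnm:
  assumes \<phi>: "\<phi> \<in> D"
  shows "L (lnm \<phi>) = lnm (L \<phi>) + drift \<phi>"
proof (rule D_eqI)
  show "L (lnm \<phi>) \<in> D" "lnm (L \<phi>) + drift \<phi> \<in> D" using \<phi> by auto
  fix x assume x: "x \<in> \<Omega>"
  have xp: "0 < x $ p" using domain_pos[OF x] .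
  have second: "partial_deriv j (partial_deriv j (lnm \<phi>)) x
      = ln (x $ p) * partial_deriv j (partial_deriv j \<phi>) x
        + (if j = p then 1 else 0) * (2 / x $ p * partial_deriv j \<phi> x - (1 / x $ p)\<^sup>2 * \<phi> x)" for j
  proof -
    have "partial_deriv j (partial_deriv j (lnm \<phi>)) x
        = partial_deriv j (\<lambda>x. lnm (partial_deriv j \<phi>) x + (if j = p then 1 else 0) * (1 / x $ p * \<phi> x)) x"
      by (rule partial_deriv_cong[OF open_domain x]) (use \<phi> partial_deriv_lnm in \<open>auto simp: lnm_def\<close>)
    also have "\<dots> = partial_deriv j (lnm (partial_deriv j \<phi>)) x
        + (if j = p then 1 else 0) * partial_deriv j (\<lambda>x. 1 / x $ p * \<phi> x) x"
    proof -
      define d :: real where "d = (if j = p then 1 else 0)"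
      define h where "h = (\<lambda>x. 1 / x $ p * \<phi> x)"
      have h: "h \<in> D" "(\<lambda>x. d * h x) \<in> D"
        using inverse_mult_in_D[OF \<phi>] test_function_cmult unfolding h_def by blast+
      have "partial_deriv j (\<lambda>x. lnm (partial_deriv j \<phi>) x + d * h x) x
          = partial_deriv j (lnm (partial_deriv j \<phi>)) x + d * partial_deriv j h x"
        using partial_deriv_add[of "lnm (partial_deriv j \<phi>)" x "\<lambda>x. d * h x" j] partial_deriv_cmult[of h x j d] h \<phi>
        by simp
      then show ?thesis unfolding h_def d_def .
    qed
    finally show ?thesis
      unfolding partial_deriv_inverse_mult[OF \<phi> x] partial_deriv_lnm[OF D_partial[OF \<phi>] x]
      by (cases "j = p") (simp_all add: algebra_simps)
  qed
  have "L (lnm \<phi>) x = (x $ p)\<^sup>2 * ((\<Sum>j\<in>UNIV. ln (x $ p) * partial_deriv j (partial_deriv j \<phi>) x)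
      + (2 / x $ p * partial_deriv p \<phi> x - (1 / x $ p)\<^sup>2 * \<phi> x))
    + (2 - real CARD('n)) * x $ p * (ln (x $ p) * partial_deriv p \<phi> x + 1 / x $ p * \<phi> x)"
    unfolding hyp_laplacian_def second sum.distrib sum_delta_mult using \<phi> x by (simp add: partial_deriv_lnm)
  also have "\<dots> = (lnm (L \<phi>) + drift \<phi>) x"
    using xp by (simp add: lnm_def drift_def hyp_laplacian_def sum_distrib_left[symmetric] field_simps power2_eq_square)
  finally show "L (lnm \<phi>) x = (lnm (L \<phi>) + drift \<phi>) x" .
qed

text \<open>The constant is 2 x_p \<partial>_p (ln x_p) = 2; multiplications commute.\<close>

lemma drift_lnm:
  assumes \<phi>: "\<phi> \<in> D"
  shows "drift (lnm \<phi>) = lnm (drift \<phi>) + 2 *\<^sub>R \<phi>"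
proof (rule D_eqI)
  show "drift (lnm \<phi>) \<in> D" "lnm (drift \<phi>) + 2 *\<^sub>R \<phi> \<in> D" using \<phi> by auto
  fix x assume x: "x \<in> \<Omega>"
  show "drift (lnm \<phi>) x = (lnm (drift \<phi>) + 2 *\<^sub>R \<phi>) x"
    using domain_pos[OF x] partial_deriv_lnm[OF \<phi> x, of p]
    unfolding drift_def by (simp add: lnm_def algebra_simps)
qed

text \<open>Let g = x_p \<partial>_p \<phi>. Integration by parts gives 2 ip g \<phi> = (n - 1) ip
  \<phi> \<phi>, so expanding the square of 2 g - (n - 1) \<phi> leaves 4 ip g g - (n - 1)^2 ip
  \<phi> \<phi>. Finally g is only one component of the gradient.\<close>

lemma drift_bound:
  assumes \<phi>: "\<phi> \<in> D"
  shows "ip (drift \<phi>) (drift \<phi>) \<le> - 4 * ip \<phi> (L \<phi>) - (real CARD('n) - 1)\<^sup>2 * ip \<phi> \<phi>"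
proof -
  let ?g = "xm (partial_deriv p \<phi>)" and ?n = "real CARD('n)"
  have xp: "xm \<phi> \<in> D" using \<phi> by simp
  have "ip (partial_deriv p \<phi>) (xm \<phi>) + ip \<phi> (partial_deriv p (xm \<phi>)) = ?n * ip \<phi> (\<lambda>x. 1 / x $ p * xm \<phi> x)"
    using integration_by_parts_M[OF \<phi> xp, of p] by simp
  also have "ip \<phi> (\<lambda>x. 1 / x $ p * xm \<phi> x) = ip \<phi> \<phi>"
    using domain_pos by (intro ip_cong) force
  also have "ip (partial_deriv p \<phi>) (xm \<phi>) = ip ?g \<phi>" by (intro ip_cong) simp
  also have "partial_deriv p (xm \<phi>) = ?g + \<phi>" using \<phi> by (auto simp: partial_deriv_xm)
  also have "ip \<phi> (?g + \<phi>) = ip ?g \<phi> + ip \<phi> \<phi>" using \<phi> by (simp add: HS.ip_commute[of \<phi> ?g])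
  finally have g: "2 * ip ?g \<phi> = (?n - 1) * ip \<phi> \<phi>" by (simp add: algebra_simps)
  have "ip (drift \<phi>) (drift \<phi>) = 4 * ip ?g ?g - 2 * (?n - 1) * (2 * ip ?g \<phi>) + (?n - 1)\<^sup>2 * ip \<phi> \<phi>"
    unfolding drift_eq using \<phi> by (simp add: HS.ip_commute[of \<phi> ?g] algebra_simps power2_eq_square)
  also have "\<dots> = 4 * ip ?g ?g - (?n - 1)\<^sup>2 * ip \<phi> \<phi>"
    unfolding g by (simp add: algebra_simps power2_eq_square)
  also have "ip ?g ?g \<le> (\<Sum>j\<in>UNIV. ip (xm (partial_deriv j \<phi>)) (xm (partial_deriv j \<phi>)))"
    using \<phi> member_le_sum[of p UNIV "\<lambda>j. ip (xm (partial_deriv j \<phi>)) (xm (partial_deriv j \<phi>))"] by simp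
  also have "(\<Sum>j\<in>UNIV. ip (xm (partial_deriv j \<phi>)) (xm (partial_deriv j \<phi>))) = - ip \<phi> (L \<phi>)"
    using dirichlet_form[OF \<phi> \<phi>] by simp
  finally show ?thesis by simp
qed

text \<open>On the domain x_p lies between positive constants, so ln x_p is bounded and
  multiplication by it is a bounded operator.\<close>

lemma commutator_pair_lnm: "\<exists>B. commutator_pair (L2 M) ip D L lnm drift B ((real CARD('n) - 1)\<^sup>2)"
proof -
  obtain a b r where ab: "0 < a" "\<And>x. x \<in> \<Omega> \<Longrightarrow> a \<le> x $ p" "\<And>x. x \<in> \<Omega> \<Longrightarrow> x $ p \<le> b"
      "\<And>x. x \<in> \<Omega> \<Longrightarrow> norm x \<le> r"
    by (rule domain_bounds) (rule that)
  define B where "B = max \<bar>ln a\<bar> \<bar>ln b\<bar>"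
  have B: "\<bar>ln (x $ p)\<bar> \<le> B" if "x \<in> \<Omega>" for x
  proof -
    have "ln a \<le> ln (x $ p)" "ln (x $ p) \<le> ln b"
      using ab that by (auto intro!: ln_mono order.strict_trans2[of 0 a])
    then show ?thesis by (auto simp: B_def)
  qed
  have ln_m: "(\<lambda>x. ln (x $ p)) \<in> borel_measurable M" by measurable
  note bm = L2_bounded_mult[OF _ ln_m, unfolded space_M, OF _ B]
  have "commutator_pair (L2 M) ip D L lnm drift (B\<^sup>2) ((real CARD('n) - 1)\<^sup>2)"
  proof
    fix u v assume u: "u \<in> L2 M"
    show "lnm u \<in> L2 M" "ip (lnm u) (lnm u) \<le> B\<^sup>2 * ip u u"
      unfolding lnm_def using bm[OF u] by auto
    show "lnm (u - v) = lnm u - lnm v" by (auto simp: lnm_def algebra_simps)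
    show "ip (lnm u) v = ip u (lnm v)" unfolding lnm_def by (intro ip_cong) simp
  next
    fix \<phi> \<psi> assume \<phi>: "\<phi> \<in> D"
    show "lnm \<phi> \<in> D" "drift \<phi> \<in> D" using \<phi> by auto
    show "L (lnm \<phi>) = lnm (L \<phi>) + drift \<phi>" using \<phi> by (rule laplacian_lnm)
    show "drift (lnm \<phi>) = lnm (drift \<phi>) + 2 *\<^sub>R \<phi>" using \<phi> by (rule drift_lnm)
    show "ip (drift \<phi>) (drift \<phi>) \<le> - 4 * ip \<phi> (L \<phi>) - (real CARD('n) - 1)\<^sup>2 * ip \<phi> \<phi>" using \<phi> by (rule drift_bound)
    assume \<psi>: "\<psi> \<in> D"
    show "drift (\<phi> - \<psi>) = drift \<phi> - drift \<psi>"
      by (intro ext) (simp add: drift_def partial_deriv_diff[OF \<phi> \<psi>], simp add: algebra_simps)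
  qed simp
  then show ?thesis by blast
qed

end

section \<open>Rellich compactness\<close>

lemma nn_integral_lborel_translation:
  fixes f :: "'a::euclidean_space \<Rightarrow> ennreal"
  assumes "f \<in> borel_measurable borel"
  shows "(\<integral>\<^sup>+x. f (x + c) \<partial>lborel) = (\<integral>\<^sup>+x. f x \<partial>lborel)"
proof -
  have "(\<integral>\<^sup>+x. f x \<partial>lborel) = (\<integral>\<^sup>+x. f x \<partial>distr lborel borel ((+) c))" by (simp add: lborel_distr_plus)
  also have "\<dots> = (\<integral>\<^sup>+x. f (x + c) \<partial>lborel)"
    using assms by (subst nn_integral_distr) (auto simp: add.commute)
  finally show ?thesis by simp
qed

text \<open>Nonnegativity of the variance of \<open>g\<close> on the unit interval.\<close>

lemma square_integral_le:
  fixes g :: "real \<Rightarrow> real"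
  assumes "continuous_on UNIV g"
  shows "(\<integral>t. g t * indicator {0..1} t \<partial>lborel)\<^sup>2 \<le> (\<integral>t. (g t)\<^sup>2 * indicator {0..1} t \<partial>lborel)"
    and "integrable lborel (\<lambda>t. (g t)\<^sup>2 * indicator {0..1} t)"
proof -
  have int: "integrable lborel (\<lambda>t. h t * indicator {0..1} t)" if "continuous_on UNIV h" for h :: "real \<Rightarrow> real"
    using borel_integrable_compact[of "{0..1}" h] continuous_on_subset[OF that] by (simp add: mult.commute)
  define c where "c = (\<integral>t. g t * indicator {0..1} t \<partial>lborel)"
  have i1: "integrable lborel (\<lambda>t. g t * indicator {0..1} t)" using assms by (rule int)
  have i2: "integrable lborel (\<lambda>t. (g t)\<^sup>2 * indicator {0..1} t)" using assms by (intro int continuous_intros)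
  have i0: "integrable lborel (\<lambda>t. indicator {0..1::real} t :: real)" by simp
  have "0 \<le> (\<integral>t. (g t - c)\<^sup>2 * indicator {0..1} t \<partial>lborel)" by (intro Bochner_Integration.integral_nonneg) auto
  also have "\<dots> = (\<integral>t. (g t)\<^sup>2 * indicator {0..1} t - 2 * c * (g t * indicator {0..1} t) + c\<^sup>2 * indicator {0..1} t \<partial>lborel)"
    by (intro Bochner_Integration.integral_cong) (auto simp: power2_diff algebra_simps)
  also have "\<dots> = (\<integral>t. (g t)\<^sup>2 * indicator {0..1} t \<partial>lborel) - 2 * c * c + c\<^sup>2"
    using i1 i2 i0 by (simp add: c_def[symmetric])
  finally show "c\<^sup>2 \<le> (\<integral>t. (g t)\<^sup>2 * indicator {0..1} t \<partial>lborel)" by (simp add: power2_eq_square)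
  show "integrable lborel (\<lambda>t. (g t)\<^sup>2 * indicator {0..1} t)" by (rule i2)
qed

definition dirichlet :: "(real ^ 'n::finite \<Rightarrow> real) \<Rightarrow> real" where
  "dirichlet \<phi> = (\<Sum>j\<in>UNIV. \<integral>x. (partial_deriv j \<phi> x)\<^sup>2 \<partial>lborel)"

lemma test_function_square_integrable:
  "\<phi> \<in> test_functions \<Omega> \<Longrightarrow> integrable lborel (\<lambda>x. (\<phi> x)\<^sup>2)"
  using test_function_integrable[OF test_function_mult] by (simp add: power2_eq_square)

text \<open>The increment is the integral of the directional derivative along the segment from x to
  x + h. \<open>square_integral_le\<close> moves the square inside, Tonelli and translation
  invariance remove the segment parameter, and Cauchy-Schwarz over the coordinates separates
  |h|^2.\<close>

lemma translation_estimate: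
  assumes \<phi>: "\<phi> \<in> test_functions \<Omega>"
  shows "(\<integral>\<^sup>+x. ennreal ((\<phi> (x + h) - \<phi> x)\<^sup>2) \<partial>lborel) \<le> ennreal ((norm h)\<^sup>2 * dirichlet \<phi>)"
proof -
  define d where "d = (\<lambda>x. \<Sum>j\<in>UNIV. h $ j * partial_deriv j \<phi> x)"
  have d_cont: "continuous_on S d" for S
    unfolding d_def using test_function_continuous[OF test_function_partial_deriv[OF \<phi>]] by (intro continuous_intros) auto
  have d_meas [measurable]: "d \<in> borel_measurable borel" using d_cont by (intro borel_measurable_continuous_onI)
  have pointwise: "ennreal ((\<phi> (x + h) - \<phi> x)\<^sup>2) \<le> (\<integral>\<^sup>+t. ennreal ((d (x + t *\<^sub>R h))\<^sup>2) * indicator {0..1} t \<partial>lborel)" for x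
  proof -
    define g where "g = (\<lambda>t. d (x + t *\<^sub>R h))"
    have g: "continuous_on UNIV g" unfolding g_def
      by (rule continuous_on_compose2[OF d_cont[of UNIV]]) (auto intro!: continuous_intros)
    have "(\<integral>t. g t * indicator {0..1} t \<partial>lborel) = \<phi> (x + 1 *\<^sub>R h) - \<phi> (x + 0 *\<^sub>R h)"
    proof (rule integral_FTC_Icc_real)
      show "((\<lambda>t. \<phi> (x + t *\<^sub>R h)) has_real_derivative g t) (at t)" for t
        unfolding g_def d_def using \<phi> by (intro has_real_derivative_line) simp
      show "isCont g t" for t using g by (simp add: continuous_on_eq_continuous_at)
    qed simp
    then have "(\<phi> (x + h) - \<phi> x)\<^sup>2 \<le> (\<integral>t. (g t)\<^sup>2 * indicator {0..1} t \<partial>lborel)"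
      using square_integral_le(1)[OF g] by simp
    then have "ennreal ((\<phi> (x + h) - \<phi> x)\<^sup>2) \<le> ennreal (\<integral>t. (g t)\<^sup>2 * indicator {0..1} t \<partial>lborel)"
      by (rule ennreal_leI)
    also have "\<dots> = (\<integral>\<^sup>+t. ennreal ((g t)\<^sup>2 * indicator {0..1} t) \<partial>lborel)"
      using square_integral_le(2)[OF g] by (intro nn_integral_eq_integral[symmetric]) auto
    also have "\<dots> = (\<integral>\<^sup>+t. ennreal ((g t)\<^sup>2) * indicator {0..1} t \<partial>lborel)"
      by (intro nn_integral_cong) (auto simp: indicator_def)
    finally show ?thesis by (simp add: g_def)
  qed
  have "(\<integral>\<^sup>+x. ennreal ((\<phi> (x + h) - \<phi> x)\<^sup>2) \<partial>lborel)
      \<le> (\<integral>\<^sup>+x. \<integral>\<^sup>+t. ennreal ((d (x + t *\<^sub>R h))\<^sup>2) * indicator {0..1} t \<partial>lborel \<partial>lborel)"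
    by (intro nn_integral_mono pointwise)
  also have "\<dots> = (\<integral>\<^sup>+t. \<integral>\<^sup>+x. ennreal ((d (x + t *\<^sub>R h))\<^sup>2) * indicator {0..1} t \<partial>lborel \<partial>lborel)"
    by (rule lborel_pair.Fubini'[symmetric]) measurable
  also have "\<dots> = (\<integral>\<^sup>+t. (\<integral>\<^sup>+x. ennreal ((d x)\<^sup>2) \<partial>lborel) * indicator {0..1} t \<partial>(lborel::real measure))"
    using nn_integral_lborel_translation[of "\<lambda>x. ennreal ((d x)\<^sup>2)"]
    by (intro nn_integral_cong) (simp add: nn_integral_multc)
  also have "\<dots> = (\<integral>\<^sup>+x. ennreal ((d x)\<^sup>2) \<partial>lborel)" by (simp add: nn_integral_cmult)
  also have "\<dots> \<le> (\<integral>\<^sup>+x. ennreal ((norm h)\<^sup>2 * (\<Sum>j\<in>UNIV. (partial_deriv j \<phi> x)\<^sup>2)) \<partial>lborel)"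
  proof (intro nn_integral_mono ennreal_leI)
    fix x
    have "(norm h)\<^sup>2 = (\<Sum>j\<in>UNIV. (h $ j)\<^sup>2)"
      unfolding power2_norm_eq_inner by (simp add: inner_vec_def power2_eq_square)
    then show "(d x)\<^sup>2 \<le> (norm h)\<^sup>2 * (\<Sum>j\<in>UNIV. (partial_deriv j \<phi> x)\<^sup>2)"
      unfolding d_def using Cauchy_Schwarz_ineq_sum[of "\<lambda>j. h $ j" "\<lambda>j. partial_deriv j \<phi> x" UNIV] by simp
  qed
  also have "\<dots> = ennreal (\<integral>x. (norm h)\<^sup>2 * (\<Sum>j\<in>UNIV. (partial_deriv j \<phi> x)\<^sup>2) \<partial>lborel)"
    using test_function_square_integrable[OF test_function_partial_deriv[OF \<phi>]]
    by (intro nn_integral_eq_integral) (auto intro!: sum_nonneg mult_nonneg_nonneg)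
  also have "(\<integral>x. (norm h)\<^sup>2 * (\<Sum>j\<in>UNIV. (partial_deriv j \<phi> x)\<^sup>2) \<partial>lborel) = (norm h)\<^sup>2 * dirichlet \<phi>"
    using test_function_square_integrable[OF test_function_partial_deriv[OF \<phi>]]
    by (simp add: dirichlet_def)
  finally show ?thesis .
qed

text \<open>Half-open cubes of side \<open>s\<close>: defined by floors, they partition the space
  without overlapping faces.\<close>

definition cell :: "real \<Rightarrow> ('n::finite \<Rightarrow> int) \<Rightarrow> (real ^ 'n) set" where
  "cell s z = {x. \<forall>j. \<lfloor>x $ j / s\<rfloor> = z j}"

lemma cell_measurable [measurable]: "cell s z \<in> sets borel"
proof -
  have "cell s z = {x \<in> space borel. \<forall>j. \<lfloor>x $ j / s\<rfloor> = z j}" by (simp add: cell_def)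
  also have "\<dots> \<in> sets borel" by measurable
  finally show ?thesis .
qed

lemma cell_unique:
  assumes "x \<in> cell s w" "x \<in> cell s z"
  shows "w = z"
proof
  fix j
  have "\<lfloor>x $ j / s\<rfloor> = w j" "\<lfloor>x $ j / s\<rfloor> = z j" using assms unfolding cell_def by blast+
  then show "w j = z j" by simp
qed

lemma prod_Basis_const:
  "(\<Prod>b\<in>(Basis :: (real ^ 'n::finite) set). (\<chi> i. s) \<bullet> b) = s ^ CARD('n)"
proof -
  have "(\<chi> i. s) \<bullet> b = s" if "b \<in> Basis" for b :: "real ^ 'n"
    using that by (auto simp: Basis_vec_def inner_axis)
  then show ?thesis by simp
qed

lemma emeasure_cell:
  assumes s: "s > 0"
  shows "emeasure lborel (cell s (z :: 'n::finite \<Rightarrow> int)) = ennreal (s ^ CARD('n))"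
proof -
  define l u where "l = ((\<chi> i. s * of_int (z i)) :: real ^ 'n)" and "u = ((\<chi> i. s * of_int (z i) + s) :: real ^ 'n)"
  have ul: "u - l = (\<chi> i. s)" by (simp add: vec_eq_iff u_def l_def)
  have lu: "l \<bullet> b \<le> u \<bullet> b" if "b \<in> Basis" for b
  proof -
    have "(u - l) \<bullet> b = s" unfolding ul using that by (auto simp: Basis_vec_def inner_axis)
    then show ?thesis using s by (simp add: inner_diff_left)
  qed
  have fl: "\<lfloor>y / s\<rfloor> = k \<longleftrightarrow> s * of_int k \<le> y \<and> y < s * of_int k + s" for y k
    using s by (auto simp: floor_eq_iff field_simps)
  have "box l u \<subseteq> cell s z" by (auto simp: mem_box_cart cell_def fl l_def u_def less_imp_le)
  moreover have "cell s z \<subseteq> cbox l u" by (auto simp: mem_box_cart cell_def fl l_def u_def less_imp_le)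
  ultimately have "emeasure lborel (box l u) \<le> emeasure lborel (cell s z)"
      "emeasure lborel (cell s z) \<le> emeasure lborel (cbox l u)"
    by (auto intro!: emeasure_mono)
  then show ?thesis
    using lu by (simp add: emeasure_lborel_cbox emeasure_lborel_box ul prod_Basis_const)
qed

text \<open>On expanding (\<phi> y - \<phi> x)^2, each pure square contributes the cell volume times
  the integral of \<phi>^2, and the mixed term factors into the square of the integral of
  \<phi>.\<close>

lemma cell_variance:
  fixes \<phi> :: "real ^ 'n::finite \<Rightarrow> real" and z :: "'n \<Rightarrow> int"
  assumes \<phi>: "\<phi> \<in> test_functions \<Omega>" and s: "s > 0"
  shows "(\<integral>\<^sup>+x. \<integral>\<^sup>+y. ennreal (indicator (cell s z) x * indicator (cell s z) y * (\<phi> y - \<phi> x)\<^sup>2) \<partial>lborel \<partial>lborel)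
    = ennreal (2 * s ^ CARD('n) * (\<integral>x. indicator (cell s z) x * (\<phi> x)\<^sup>2 \<partial>lborel) - 2 * (\<integral>x. indicator (cell s z) x * \<phi> x \<partial>lborel)\<^sup>2)"
    (is "?lhs = _")
proof -
  let ?Q = "cell s z :: (real ^ 'n) set"
  define I where "I = (\<integral>x. indicator ?Q x * \<phi> x \<partial>lborel)"
  define J where "J = (\<integral>x. indicator ?Q x * (\<phi> x)\<^sup>2 \<partial>lborel)"
  have [measurable]: "\<phi> \<in> borel_measurable borel" using \<phi> by (rule test_function_measurable)
  have iq: "integrable lborel (\<lambda>x. indicator ?Q x :: real)"
    using emeasure_cell[OF s, of z] by (intro integrable_real_indicator) auto
  have mq: "(\<integral>x. indicator ?Q x \<partial>lborel) = s ^ CARD('n)"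
    using emeasure_cell[OF s, of z] s by (simp add: measure_def)
  have i\<phi>: "integrable lborel (\<lambda>x. indicator ?Q x * \<phi> x)"
    by (rule Bochner_Integration.integrable_bound[OF test_function_integrable[OF \<phi>]]) (auto simp: indicator_def)
  have i2: "integrable lborel (\<lambda>x. indicator ?Q x * (\<phi> x)\<^sup>2)"
    by (rule Bochner_Integration.integrable_bound[OF test_function_square_integrable[OF \<phi>]]) (auto simp: indicator_def)
  have expand: "indicator ?Q x * indicator ?Q y * (\<phi> y - \<phi> x)\<^sup>2
      = indicator ?Q x * (indicator ?Q y * (\<phi> y)\<^sup>2) - (2 * indicator ?Q x * \<phi> x) * (indicator ?Q y * \<phi> y)
        + (indicator ?Q x * (\<phi> x)\<^sup>2) * indicator ?Q y" for x y
    by (simp add: power2_diff algebra_simps)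
  have val: "(\<integral>y. indicator ?Q x * indicator ?Q y * (\<phi> y - \<phi> x)\<^sup>2 \<partial>lborel) = indicator ?Q x * J - 2 * indicator ?Q x * \<phi> x * I + indicator ?Q x * (\<phi> x)\<^sup>2 * s ^ CARD('n)" for x
    unfolding expand I_def J_def mq[symmetric]
    by (subst Bochner_Integration.integral_add Bochner_Integration.integral_diff,
        (intro Bochner_Integration.integrable_diff integrable_mult_right iq i\<phi> i2)+)+
       (simp only: integral_mult_right_zero)
  have inner: "(\<integral>\<^sup>+y. ennreal (indicator ?Q x * indicator ?Q y * (\<phi> y - \<phi> x)\<^sup>2) \<partial>lborel) = ennreal (indicator ?Q x * J - 2 * indicator ?Q x * \<phi> x * I + indicator ?Q x * (\<phi> x)\<^sup>2 * s ^ CARD('n))" for x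
  proof -
    have "integrable lborel (\<lambda>y. indicator ?Q x * indicator ?Q y * (\<phi> y - \<phi> x)\<^sup>2)"
      unfolding expand
      by (intro Bochner_Integration.integrable_add Bochner_Integration.integrable_diff integrable_mult_right iq i\<phi> i2)
    then show ?thesis unfolding val[symmetric] by (intro nn_integral_eq_integral) auto
  qed
  have nonneg: "0 \<le> indicator ?Q x * J - 2 * indicator ?Q x * \<phi> x * I + indicator ?Q x * (\<phi> x)\<^sup>2 * s ^ CARD('n)" for x
    unfolding val[symmetric] by (intro Bochner_Integration.integral_nonneg) auto
  have eq: "indicator ?Q x * J - 2 * indicator ?Q x * \<phi> x * I + indicator ?Q x * (\<phi> x)\<^sup>2 * s ^ CARD('n)
      = J * indicator ?Q x - (2 * I) * (indicator ?Q x * \<phi> x) + s ^ CARD('n) * (indicator ?Q x * (\<phi> x)\<^sup>2)" for x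
    by simp
  have "?lhs = (\<integral>\<^sup>+x. ennreal (indicator ?Q x * J - 2 * indicator ?Q x * \<phi> x * I + indicator ?Q x * (\<phi> x)\<^sup>2 * s ^ CARD('n)) \<partial>lborel)"
    unfolding inner ..
  also have "\<dots> = ennreal (\<integral>x. indicator ?Q x * J - 2 * indicator ?Q x * \<phi> x * I + indicator ?Q x * (\<phi> x)\<^sup>2 * s ^ CARD('n) \<partial>lborel)"
    using nonneg unfolding eq
    by (intro nn_integral_eq_integral Bochner_Integration.integrable_add Bochner_Integration.integrable_diff
        integrable_mult_right iq i\<phi> i2) auto
  also have "(\<integral>x. indicator ?Q x * J - 2 * indicator ?Q x * \<phi> x * I + indicator ?Q x * (\<phi> x)\<^sup>2 * s ^ CARD('n) \<partial>lborel)
      = J * s ^ CARD('n) - (2 * I) * I + s ^ CARD('n) * J"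
    unfolding eq
    by (subst Bochner_Integration.integral_add Bochner_Integration.integral_diff,
        (intro Bochner_Integration.integrable_diff integrable_mult_right iq i\<phi> i2)+)+
       (simp only: integral_mult_right_zero mq I_def[symmetric] J_def[symmetric])
  also have "\<dots> = 2 * s ^ CARD('n) * J - 2 * I\<^sup>2" by (simp add: power2_eq_square)
  finally show ?thesis by (simp add: I_def J_def)
qed

text \<open>
  The variance on a cell is an average of squared differences over pairs of its points. Such pairs
  differ by a vector of the cube \<open>[-s, s]\<^sup>n\<close>, so the translation estimate bounds the sum over all cells.
\<close>

lemma cell_poincare:
  fixes Z :: "('n::finite \<Rightarrow> int) set" and \<phi> :: "real ^ 'n \<Rightarrow> real"
  assumes \<phi>: "\<phi> \<in> test_functions \<Omega>" and s: "s > 0" and Z: "finite Z"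
    and cover: "\<And>x. x \<in> \<Omega> \<Longrightarrow> \<exists>z\<in>Z. x \<in> cell s z"
  shows "(\<integral>x. (\<phi> x)\<^sup>2 \<partial>lborel) \<le> (\<Sum>z\<in>Z. (\<integral>x. indicator (cell s z) x * \<phi> x \<partial>lborel)\<^sup>2) / s ^ CARD('n)
    + 2 ^ CARD('n) * real CARD('n) * s\<^sup>2 * dirichlet \<phi>"
proof -
  let ?q = "\<lambda>z x. indicator (cell s z) x :: real"
  define n where "n = CARD('n)"
  define C where "C = (cbox (\<chi> i. - s) (\<chi> i. s) :: (real ^ 'n) set)"
  have [measurable]: "\<phi> \<in> borel_measurable borel" using \<phi> by (rule test_function_measurable)
  have C_meas [measurable]: "C \<in> sets borel" by (simp add: C_def)
  have dir: "dirichlet \<phi> \<ge> 0" unfolding dirichlet_def by (intro sum_nonneg Bochner_Integration.integral_nonneg) auto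
  have diff: "y - x \<in> C" if "x \<in> cell s z" "y \<in> cell s z" for x y z
  proof -
    have le: "\<bar>y $ i - x $ i\<bar> \<le> s" for i
    proof -
      have "\<lfloor>x $ i / s\<rfloor> = \<lfloor>y $ i / s\<rfloor>" using that by (simp add: cell_def)
      then have "\<bar>y $ i / s - x $ i / s\<bar> \<le> 1" by linarith
      then have "\<bar>(y $ i - x $ i) / s\<bar> \<le> 1" by (simp add: diff_divide_distrib)
      then show ?thesis using s by (simp add: abs_divide pos_divide_le_eq)
    qed
    have "- s \<le> y $ i - x $ i \<and> y $ i - x $ i \<le> s" for i using le[of i] by linarith
    then show ?thesis by (simp add: C_def mem_box_cart)
  qed
  \<comment> \<open>Cells are disjoint, so a pair of points lies in at most one of them, and then
    its difference lies in the cube \<open>C\<close>.\<close>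
  have sum_q: "(\<Sum>z\<in>Z. ?q z x * ?q z y) \<le> indicator C (y - x)" for x y
  proof (cases "\<exists>z\<in>Z. x \<in> cell s z \<and> y \<in> cell s z")
    case True
    then obtain z where z: "z \<in> Z" "x \<in> cell s z" "y \<in> cell s z" by blast
    have wz: "x \<in> cell s w \<longleftrightarrow> w = z" for w using cell_unique z(2) by blast
    then have "(\<Sum>w\<in>Z. ?q w x * ?q w y) = (\<Sum>w\<in>Z. if w = z then 1 else 0)"
      using z(3) by (intro sum.cong) (simp_all add: indicator_def wz)
    then show ?thesis using z diff[OF z(2,3)] Z by simp
  next
    case False
    then have "(\<Sum>w\<in>Z. ?q w x * ?q w y) = 0" by (intro sum.neutral) (auto simp: indicator_def)
    then show ?thesis by simp
  qed
  have sum_1: "(\<Sum>z\<in>Z. ?q z x * (\<phi> x)\<^sup>2) = (\<phi> x)\<^sup>2" for x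
  proof (cases "x \<in> \<Omega>")
    case True
    then obtain z where z: "z \<in> Z" "x \<in> cell s z" using cover by blast
    have wz: "x \<in> cell s w \<longleftrightarrow> w = z" for w using cell_unique z(2) by blast
    then have "(\<Sum>w\<in>Z. ?q w x * (\<phi> x)\<^sup>2) = (\<Sum>w\<in>Z. if w = z then (\<phi> x)\<^sup>2 else 0)"
      by (intro sum.cong) (simp_all add: indicator_def wz)
    then show ?thesis using z Z by simp
  qed (use test_function_zero[OF \<phi>] in simp)
  define I where "I = (\<lambda>z. \<integral>x. ?q z x * \<phi> x \<partial>lborel)"
  define J where "J = (\<lambda>z. \<integral>x. ?q z x * (\<phi> x)\<^sup>2 \<partial>lborel)"
  have i2: "integrable lborel (\<lambda>x. ?q z x * (\<phi> x)\<^sup>2)" for z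
    by (rule Bochner_Integration.integrable_bound[OF test_function_square_integrable[OF \<phi>]]) (auto simp: indicator_def)
  have J_sum: "(\<Sum>z\<in>Z. J z) = (\<integral>x. (\<phi> x)\<^sup>2 \<partial>lborel)"
    unfolding J_def using i2 by (simp add: Bochner_Integration.integral_sum[symmetric] sum_1)
  \<comment> \<open>\<open>ennreal\<close> truncates negative reals to 0; the \<open>max\<close>
    makes this explicit and can only increase the sum.\<close>
  have "ennreal (\<Sum>z\<in>Z. max 0 (2 * s ^ n * J z - 2 * (I z)\<^sup>2)) = (\<Sum>z\<in>Z. ennreal (2 * s ^ n * J z - 2 * (I z)\<^sup>2))"
    by (subst sum_ennreal[symmetric]) (auto simp: ennreal_max_0)
  also have "\<dots> = (\<Sum>z\<in>Z. \<integral>\<^sup>+x. \<integral>\<^sup>+y. ennreal (?q z x * ?q z y * (\<phi> y - \<phi> x)\<^sup>2) \<partial>lborel \<partial>lborel)"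
    unfolding I_def J_def n_def by (intro sum.cong refl cell_variance[OF \<phi> s, symmetric])
  also have "\<dots> = (\<integral>\<^sup>+x. \<integral>\<^sup>+y. (\<Sum>z\<in>Z. ennreal (?q z x * ?q z y * (\<phi> y - \<phi> x)\<^sup>2)) \<partial>lborel \<partial>lborel)"
    by (simp add: nn_integral_sum del: sum_ennreal)
  also have "\<dots> \<le> (\<integral>\<^sup>+x. \<integral>\<^sup>+y. ennreal (indicator C (y - x) * (\<phi> y - \<phi> x)\<^sup>2) \<partial>lborel \<partial>lborel)"
  proof (intro nn_integral_mono)
    fix x y
    have "(\<Sum>z\<in>Z. ennreal (?q z x * ?q z y * (\<phi> y - \<phi> x)\<^sup>2)) = ennreal ((\<Sum>z\<in>Z. ?q z x * ?q z y) * (\<phi> y - \<phi> x)\<^sup>2)"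
      unfolding sum_distrib_right by (intro sum_ennreal) auto
    also have "\<dots> \<le> ennreal (indicator C (y - x) * (\<phi> y - \<phi> x)\<^sup>2)"
      by (intro ennreal_leI mult_right_mono sum_q) auto
    finally show "(\<Sum>z\<in>Z. ennreal (?q z x * ?q z y * (\<phi> y - \<phi> x)\<^sup>2)) \<le> ennreal (indicator C (y - x) * (\<phi> y - \<phi> x)\<^sup>2)" .
  qed
  also have "\<dots> = (\<integral>\<^sup>+x. \<integral>\<^sup>+h. ennreal (indicator C h * (\<phi> (x + h) - \<phi> x)\<^sup>2) \<partial>lborel \<partial>lborel)"
  proof (rule nn_integral_cong)
    fix x
    show "(\<integral>\<^sup>+y. ennreal (indicator C (y - x) * (\<phi> y - \<phi> x)\<^sup>2) \<partial>lborel)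
        = (\<integral>\<^sup>+h. ennreal (indicator C h * (\<phi> (x + h) - \<phi> x)\<^sup>2) \<partial>lborel)"
      using nn_integral_lborel_translation[of "\<lambda>y. ennreal (indicator C (y - x) * (\<phi> y - \<phi> x)\<^sup>2)" x]
      by (simp add: add.commute)
  qed
  also have "\<dots> = (\<integral>\<^sup>+h. \<integral>\<^sup>+x. ennreal (indicator C h * (\<phi> (x + h) - \<phi> x)\<^sup>2) \<partial>lborel \<partial>lborel)"
    by (rule lborel_pair.Fubini'[symmetric]) measurable
  also have "\<dots> \<le> (\<integral>\<^sup>+h. ennreal (real n * s\<^sup>2 * dirichlet \<phi>) * indicator C h \<partial>lborel)"
  proof (rule nn_integral_mono)
    fix h :: "real ^ 'n"
    show "(\<integral>\<^sup>+x. ennreal (indicator C h * (\<phi> (x + h) - \<phi> x)\<^sup>2) \<partial>lborel) \<le> ennreal (real n * s\<^sup>2 * dirichlet \<phi>) * indicator C h"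
    proof (cases "h \<in> C")
      case True
      have "(norm h)\<^sup>2 = (\<Sum>j\<in>UNIV. (h $ j)\<^sup>2)"
        unfolding power2_norm_eq_inner by (simp add: inner_vec_def power2_eq_square)
      also have "\<dots> \<le> (\<Sum>j\<in>(UNIV :: 'n set). s\<^sup>2)"
      proof (intro sum_mono)
        fix j
        have "\<bar>h $ j\<bar> \<le> s" using True by (auto simp: C_def mem_box_cart abs_le_iff minus_le_iff)
        from power_mono[OF this abs_ge_zero, of 2] show "(h $ j)\<^sup>2 \<le> s\<^sup>2" by simp
      qed
      finally have "(norm h)\<^sup>2 * dirichlet \<phi> \<le> real n * s\<^sup>2 * dirichlet \<phi>"
        using dir by (simp add: n_def mult_right_mono)
      then show ?thesis using translation_estimate[OF \<phi>, of h] True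
        by (auto intro: order_trans ennreal_leI)
    qed simp
  qed
  also have "\<dots> = ennreal (real n * s\<^sup>2 * dirichlet \<phi>) * emeasure lborel C"
    by (rule nn_integral_cmult_indicator) simp
  also have "emeasure lborel C = ennreal ((2 * s) ^ n)"
  proof -
    have d: "(\<chi> i. s) - (\<chi> i. - s) = ((\<chi> i. 2 * s) :: real ^ 'n)" by (simp add: vec_eq_iff)
    have "(\<chi> i. - s) \<bullet> b \<le> (\<chi> i. s) \<bullet> b" if "b \<in> Basis" for b :: "real ^ 'n"
      using that s by (auto simp: Basis_vec_def inner_axis)
    then show ?thesis unfolding C_def by (simp add: emeasure_lborel_cbox d prod_Basis_const n_def)
  qed
  also have "ennreal (real n * s\<^sup>2 * dirichlet \<phi>) * ennreal ((2 * s) ^ n) = ennreal (real n * s\<^sup>2 * dirichlet \<phi> * (2 * s) ^ n)"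
    using s dir by (intro ennreal_mult[symmetric]) auto
  finally have "(\<Sum>z\<in>Z. max 0 (2 * s ^ n * J z - 2 * (I z)\<^sup>2)) \<le> real n * s\<^sup>2 * dirichlet \<phi> * (2 * s) ^ n"
    using s dir by (subst (asm) ennreal_le_iff) auto
  moreover have "(\<Sum>z\<in>Z. 2 * s ^ n * J z - 2 * (I z)\<^sup>2) \<le> (\<Sum>z\<in>Z. max 0 (2 * s ^ n * J z - 2 * (I z)\<^sup>2))"
    by (intro sum_mono) simp
  moreover have "(\<Sum>z\<in>Z. 2 * s ^ n * J z - 2 * (I z)\<^sup>2) = 2 * s ^ n * (\<integral>x. (\<phi> x)\<^sup>2 \<partial>lborel) - 2 * (\<Sum>z\<in>Z. (I z)\<^sup>2)"
    by (simp add: sum_subtractf sum_distrib_left[symmetric] J_sum)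
  ultimately have "2 * s ^ n * (\<integral>x. (\<phi> x)\<^sup>2 \<partial>lborel) \<le> 2 * (\<Sum>z\<in>Z. (I z)\<^sup>2) + real n * s\<^sup>2 * dirichlet \<phi> * (2 * s) ^ n"
    by linarith
  \<comment> \<open>A factor 2 is given away here so that the whole inequality can be
    halved.\<close>
  also have "\<dots> \<le> 2 * (\<Sum>z\<in>Z. (I z)\<^sup>2) + 2 * (real n * s\<^sup>2 * dirichlet \<phi> * (2 * s) ^ n)"
    using s dir by simp
  finally have "s ^ n * (\<integral>x. (\<phi> x)\<^sup>2 \<partial>lborel) \<le> (\<Sum>z\<in>Z. (I z)\<^sup>2) + s ^ n * (2 ^ n * real n * s\<^sup>2 * dirichlet \<phi>)"
    by (simp add: power_mult_distrib mult_ac)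
  then have "(\<integral>x. (\<phi> x)\<^sup>2 \<partial>lborel) \<le> (\<Sum>z\<in>Z. (I z)\<^sup>2) / s ^ n + 2 ^ n * real n * s\<^sup>2 * dirichlet \<phi>"
    using s by (simp add: field_simps)
  then show ?thesis by (simp add: I_def n_def)
qed

section \<open>Comparison of norms and Rellich compactness on the domain\<close>

context hyp_domain
begin

lemma ip_lebesgue_bounds:
  assumes \<phi>: "\<phi> \<in> D" and a: "0 < a" "\<And>x. x \<in> \<Omega> \<Longrightarrow> a \<le> x $ p" and b: "\<And>x. x \<in> \<Omega> \<Longrightarrow> x $ p \<le> b"
  shows "ip \<phi> \<phi> \<le> (1 / a) ^ CARD('n) * (\<integral>x. (\<phi> x)\<^sup>2 \<partial>lborel)"
    and "(\<integral>x. (\<phi> x)\<^sup>2 \<partial>lborel) \<le> b ^ CARD('n) * ip \<phi> \<phi>"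
proof -
  let ?n = "CARD('n)"
  have \<phi>2: "(\<lambda>x. \<phi> x * \<phi> x) \<in> D" using \<phi> \<phi> by (rule test_function_mult)
  have w: "(\<lambda>x. (1 / x $ p) ^ ?n * (\<phi> x * \<phi> x)) \<in> D"
    using smooth_inverse_power \<phi>2 by (rule D_mult_smooth)
  have ip: "ip \<phi> \<phi> = (\<integral>x. (1 / x $ p) ^ ?n * (\<phi> x * \<phi> x) \<partial>lborel)"
    unfolding l2_inner_def using test_function_zero[OF \<phi>2] by (intro integral_M test_function_measurable[OF \<phi>2])
  note i1 = test_function_integrable[OF w] and i2 = test_function_integrable[OF \<phi>2]
  have "ip \<phi> \<phi> \<le> (\<integral>x. (1 / a) ^ ?n * (\<phi> x * \<phi> x) \<partial>lborel)"
    unfolding ip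
  proof (intro integral_mono i1 integrable_mult_right i2)
    fix x
    show "(1 / x $ p) ^ ?n * (\<phi> x * \<phi> x) \<le> (1 / a) ^ ?n * (\<phi> x * \<phi> x)"
    proof (cases "x \<in> \<Omega>")
      case True
      then have "1 / x $ p \<le> 1 / a" using a domain_pos[OF True] by (intro divide_left_mono) auto
      then show ?thesis using domain_pos[OF True] by (intro mult_right_mono power_mono) auto
    qed (use test_function_zero[OF \<phi>] in simp)
  qed
  then show "ip \<phi> \<phi> \<le> (1 / a) ^ ?n * (\<integral>x. (\<phi> x)\<^sup>2 \<partial>lborel)" by (simp add: power2_eq_square)
  have "(\<integral>x. \<phi> x * \<phi> x \<partial>lborel) \<le> (\<integral>x. b ^ ?n * ((1 / x $ p) ^ ?n * (\<phi> x * \<phi> x)) \<partial>lborel)"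
  proof (intro integral_mono i2 integrable_mult_right i1)
    fix x
    show "\<phi> x * \<phi> x \<le> b ^ ?n * ((1 / x $ p) ^ ?n * (\<phi> x * \<phi> x))"
    proof (cases "x \<in> \<Omega>")
      case True
      then have "1 \<le> b / x $ p" using b domain_pos[OF True] by simp
      then have "1 \<le> (b / x $ p) ^ ?n" by (rule one_le_power)
      then have "1 * (\<phi> x * \<phi> x) \<le> (b / x $ p) ^ ?n * (\<phi> x * \<phi> x)" by (intro mult_right_mono) auto
      then show ?thesis by (simp add: power_divide)
    qed (use test_function_zero[OF \<phi>] in simp)
  qed
  then show "(\<integral>x. (\<phi> x)\<^sup>2 \<partial>lborel) \<le> b ^ ?n * ip \<phi> \<phi>" by (simp add: ip power2_eq_square)
qed

text \<open>Expanding the squared norm of \<phi> + L \<phi> gives this bound even with a factor 1/2,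
  which is given away.\<close>

lemma dirichlet_le_energy:
  assumes \<phi>: "\<phi> \<in> D"
  shows "- ip \<phi> (L \<phi>) \<le> ip \<phi> \<phi> + ip (L \<phi>) (L \<phi>)"
proof -
  have "0 \<le> ip (\<phi> + L \<phi>) (\<phi> + L \<phi>)" using \<phi> by (intro HS.ip_nonneg L2_add) auto
  then have "0 \<le> ip \<phi> \<phi> + 2 * ip \<phi> (L \<phi>) + ip (L \<phi>) (L \<phi>)" using \<phi> HS.sq_add[of \<phi> "L \<phi>"] by simp
  moreover have "0 \<le> ip \<phi> \<phi>" "0 \<le> ip (L \<phi>) (L \<phi>)" using \<phi> by (auto intro: HS.ip_nonneg)
  ultimately show ?thesis by linarith
qed

lemma ip_le_xm:
  assumes a: "0 < a" "\<And>x. x \<in> \<Omega> \<Longrightarrow> a \<le> x $ p" and u: "xm u \<in> L2 M"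
  shows "ip u u \<le> (1 / a)\<^sup>2 * ip (xm u) (xm u)"
proof -
  have m: "(\<lambda>x. 1 / x $ p) \<in> borel_measurable M" by measurable
  have b: "\<bar>1 / x $ p\<bar> \<le> 1 / a" if "x \<in> space M" for x
    using a(1) a(2)[of x] domain_pos[of x] that by (simp add: frac_le)
  have "ip (\<lambda>x. 1 / x $ p * xm u x) (\<lambda>x. 1 / x $ p * xm u x) = ip u u"
    using domain_pos by (intro ip_cong) force
  with L2_bounded_mult(2)[OF u m b] show ?thesis by simp
qed

text \<open>The Dirichlet form controls x_p times the derivatives, and x_p is bounded below on the
  domain.\<close>

lemma gradient_bound:
  obtains C where "C \<ge> 0" "\<And>\<phi>. \<phi> \<in> D \<Longrightarrow> (\<Sum>j\<in>UNIV. ip (partial_deriv j \<phi>) (partial_deriv j \<phi>)) \<le> C * (ip \<phi> \<phi> + ip (L \<phi>) (L \<phi>))"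
proof -
  obtain a b r where ab: "0 < a" "\<And>x. x \<in> \<Omega> \<Longrightarrow> a \<le> x $ p" "\<And>x. x \<in> \<Omega> \<Longrightarrow> x $ p \<le> b"
      "\<And>x. x \<in> \<Omega> \<Longrightarrow> norm x \<le> r"
    by (rule domain_bounds) (rule that)
  have "(\<Sum>j\<in>UNIV. ip (partial_deriv j \<phi>) (partial_deriv j \<phi>)) \<le> (1 / a)\<^sup>2 * (ip \<phi> \<phi> + ip (L \<phi>) (L \<phi>))"
    if \<phi>: "\<phi> \<in> D" for \<phi>
  proof -
    have "ip (partial_deriv j \<phi>) (partial_deriv j \<phi>) \<le> (1 / a)\<^sup>2 * ip (xm (partial_deriv j \<phi>)) (xm (partial_deriv j \<phi>))" for j
      using \<phi> ab(1,2) by (intro ip_le_xm) auto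
    then have "(\<Sum>j\<in>UNIV. ip (partial_deriv j \<phi>) (partial_deriv j \<phi>))
        \<le> (\<Sum>j\<in>UNIV. (1 / a)\<^sup>2 * ip (xm (partial_deriv j \<phi>)) (xm (partial_deriv j \<phi>)))" by (rule sum_mono)
    also have "\<dots> = (1 / a)\<^sup>2 * (- ip \<phi> (L \<phi>))"
      using dirichlet_form[OF \<phi> \<phi>] by (simp add: sum_distrib_left[symmetric])
    also have "\<dots> \<le> (1 / a)\<^sup>2 * (ip \<phi> \<phi> + ip (L \<phi>) (L \<phi>))"
      using dirichlet_le_energy[OF \<phi>] by (intro mult_left_mono) auto
    finally show ?thesis .
  qed
  then show ?thesis by (intro that[of "(1 / a)\<^sup>2"]) auto
qed

text \<open>The functionals are integrals over the cells of a fine grid, and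
  \<open>cell_poincare\<close> makes the remainder small. The factor (x_p)^n in \<eta> cancels the
  hyperbolic density, so that \<open>ip \<phi> (\<eta> z)\<close> is a Lebesgue integral; \<kappa>
  carries the constant in front of the squares.\<close>

lemma rellich:
  assumes \<delta>: "\<delta> > 0"
  shows "\<exists>(Q::nat set) \<eta>. finite Q \<and> (\<forall>k\<in>Q. \<eta> k \<in> L2 M) \<and>
    (\<forall>\<phi>\<in>D. ip \<phi> \<phi> \<le> (\<Sum>k\<in>Q. (ip \<phi> (\<eta> k))\<^sup>2) + \<delta> * (ip \<phi> \<phi> + ip (L \<phi>) (L \<phi>)))"
proof -
  define n where "n = CARD('n)"
  obtain a b r where ab: "0 < a" "\<And>x. x \<in> \<Omega> \<Longrightarrow> a \<le> x $ p" "\<And>x. x \<in> \<Omega> \<Longrightarrow> x $ p \<le> b"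
      "\<And>x. x \<in> \<Omega> \<Longrightarrow> norm x \<le> r"
    by (rule domain_bounds) (rule that)
  have b0: "b \<ge> 0" using domain_nonempty ab domain_pos by force
  obtain C where C: "C \<ge> 0" "\<And>\<phi>. \<phi> \<in> D \<Longrightarrow>
      (\<Sum>j\<in>UNIV. ip (partial_deriv j \<phi>) (partial_deriv j \<phi>)) \<le> C * (ip \<phi> \<phi> + ip (L \<phi>) (L \<phi>))"
    by (rule gradient_bound) (rule that)
  define K where "K = (1 / a) ^ n * (2 ^ n * real n * (b ^ n * C))"
  have K: "K \<ge> 0" using ab(1) b0 C(1) by (simp add: K_def)
  \<comment> \<open>\<open>K * s\<^sup>2\<close> will be the coefficient of the energy; this side
    length makes it at most \<delta>.\<close>
  define s where "s = sqrt (\<delta> / (K + 1))"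
  have s: "s > 0" "s\<^sup>2 = \<delta> / (K + 1)" using \<delta> K by (auto simp: s_def)
  have Ks: "K * s\<^sup>2 \<le> \<delta>" using \<delta> K unfolding s(2) by (simp add: field_simps)
  define N where "N = \<lceil>r / s\<rceil>"
  define Z where "Z = PiE (UNIV :: 'n set) (\<lambda>_. {- N..N})"
  have Z: "finite Z" unfolding Z_def by (intro finite_PiE) auto
  have cover: "\<exists>z\<in>Z. x \<in> cell s z" if x: "x \<in> \<Omega>" for x
  proof (rule bexI[of _ "\<lambda>j. \<lfloor>x $ j / s\<rfloor>"])
    have "\<lfloor>x $ j / s\<rfloor> \<in> {- N..N}" for j
    proof -
      have "\<bar>x $ j\<bar> \<le> r" using component_le_norm_cart[of x j] ab(4)[OF x] by linarith
      then have "\<bar>x $ j / s\<bar> \<le> r / s" using s(1) by (simp add: abs_divide divide_right_mono)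
      also have "r / s \<le> of_int N" unfolding N_def by (rule le_of_int_ceiling)
      finally have "- of_int N \<le> x $ j / s" "x $ j / s \<le> of_int N" by linarith+
      then show ?thesis by (auto simp: le_floor_iff floor_le_iff)
    qed
    then show "(\<lambda>j. \<lfloor>x $ j / s\<rfloor>) \<in> Z" by (simp add: Z_def PiE_UNIV_domain)
  qed (simp add: cell_def)
  define \<kappa> where "\<kappa> = sqrt ((1 / a) ^ n / s ^ n)"
  have \<kappa>: "\<kappa> \<ge> 0" "\<kappa>\<^sup>2 = (1 / a) ^ n / s ^ n" using ab(1) s(1) by (auto simp: \<kappa>_def)
  define \<eta> where "\<eta> = (\<lambda>z x. \<kappa> * (x $ p) ^ n * indicator (cell s z) x :: real)"
  have \<eta>_meas [measurable]: "\<eta> z \<in> borel_measurable borel" for z unfolding \<eta>_def by measurable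
  have \<eta>: "\<eta> z \<in> L2 M" for z
  proof (rule bounded_L2_M)
    show "\<eta> z \<in> borel_measurable M" by (rule borel_measurable_M) measurable
    fix x assume x: "x \<in> \<Omega>"
    have "\<bar>\<eta> z x\<bar> = \<kappa> * (x $ p) ^ n * indicator (cell s z) x"
      using \<kappa>(1) domain_pos[OF x] by (simp add: \<eta>_def abs_mult)
    also have "\<dots> \<le> \<kappa> * b ^ n * 1"
      using \<kappa>(1) domain_pos[OF x] ab(3)[OF x] by (intro mult_mono power_mono) (auto simp: indicator_def b0)
    finally show "\<bar>\<eta> z x\<bar> \<le> \<kappa> * b ^ n" by simp
  qed
  have \<eta>_ip: "ip \<phi> (\<eta> z) = \<kappa> * (\<integral>x. indicator (cell s z) x * \<phi> x \<partial>lborel)" if \<phi>: "\<phi> \<in> D" for \<phi> z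
  proof -
    have [measurable]: "\<phi> \<in> borel_measurable borel" using \<phi> by (rule test_function_measurable)
    have "ip \<phi> (\<eta> z) = (\<integral>x. (1 / x $ p) ^ CARD('n) * (\<phi> x * \<eta> z x) \<partial>lborel)"
      unfolding l2_inner_def using test_function_zero[OF \<phi>] by (intro integral_M) auto
    also have "\<dots> = (\<integral>x. \<kappa> * (indicator (cell s z) x * \<phi> x) \<partial>lborel)"
    proof (intro Bochner_Integration.integral_cong refl)
      fix x
      show "(1 / x $ p) ^ CARD('n) * (\<phi> x * \<eta> z x) = \<kappa> * (indicator (cell s z) x * \<phi> x)"
      proof (cases "x \<in> \<Omega>")
        case True
        then have "(1 / x $ p) ^ n * (x $ p) ^ n = 1" using domain_pos[OF True] by (simp add: power_mult_distrib[symmetric])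
        then show ?thesis by (simp add: \<eta>_def n_def mult_ac)
      qed (use test_function_zero[OF \<phi>] in simp)
    qed
    finally show ?thesis by simp
  qed
  have main: "ip \<phi> \<phi> \<le> (\<Sum>z\<in>Z. (ip \<phi> (\<eta> z))\<^sup>2) + \<delta> * (ip \<phi> \<phi> + ip (L \<phi>) (L \<phi>))" if \<phi>: "\<phi> \<in> D" for \<phi>
  proof -
    have E: "0 \<le> ip \<phi> \<phi> + ip (L \<phi>) (L \<phi>)" using \<phi> by (intro add_nonneg_nonneg HS.ip_nonneg) auto
    have "dirichlet \<phi> \<le> (\<Sum>j\<in>UNIV. b ^ n * ip (partial_deriv j \<phi>) (partial_deriv j \<phi>))"
      unfolding dirichlet_def n_def using \<phi> ab by (intro sum_mono ip_lebesgue_bounds) auto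
    also have "\<dots> \<le> b ^ n * (C * (ip \<phi> \<phi> + ip (L \<phi>) (L \<phi>)))"
      unfolding sum_distrib_left[symmetric] using C(2)[OF \<phi>] b0 by (intro mult_left_mono) auto
    finally have dir: "dirichlet \<phi> \<le> b ^ n * C * (ip \<phi> \<phi> + ip (L \<phi>) (L \<phi>))" by simp
    have "ip \<phi> \<phi> \<le> (1 / a) ^ n * (\<integral>x. (\<phi> x)\<^sup>2 \<partial>lborel)"
      unfolding n_def using ip_lebesgue_bounds(1)[OF \<phi> ab(1,2,3)] .
    also have "\<dots> \<le> (1 / a) ^ n * ((\<Sum>z\<in>Z. (\<integral>x. indicator (cell s z) x * \<phi> x \<partial>lborel)\<^sup>2) / s ^ n
        + 2 ^ n * real n * s\<^sup>2 * dirichlet \<phi>)"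
      unfolding n_def using cell_poincare[OF \<phi> s(1) Z cover] ab(1) by (intro mult_left_mono) auto
    also have "\<dots> = \<kappa>\<^sup>2 * (\<Sum>z\<in>Z. (\<integral>x. indicator (cell s z) x * \<phi> x \<partial>lborel)\<^sup>2)
        + (1 / a) ^ n * (2 ^ n * real n * s\<^sup>2) * dirichlet \<phi>"
      unfolding \<kappa>(2) by (simp add: distrib_left mult.assoc)
    also have "\<kappa>\<^sup>2 * (\<Sum>z\<in>Z. (\<integral>x. indicator (cell s z) x * \<phi> x \<partial>lborel)\<^sup>2) = (\<Sum>z\<in>Z. (ip \<phi> (\<eta> z))\<^sup>2)"
      by (simp add: \<eta>_ip[OF \<phi>] power_mult_distrib sum_distrib_left)
    also have "(1 / a) ^ n * (2 ^ n * real n * s\<^sup>2) * dirichlet \<phi>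
        \<le> (1 / a) ^ n * (2 ^ n * real n * s\<^sup>2) * (b ^ n * C * (ip \<phi> \<phi> + ip (L \<phi>) (L \<phi>)))"
      using dir ab(1) by (intro mult_left_mono) auto
    also have "\<dots> = K * s\<^sup>2 * (ip \<phi> \<phi> + ip (L \<phi>) (L \<phi>))" by (simp add: K_def)
    also have "\<dots> \<le> \<delta> * (ip \<phi> \<phi> + ip (L \<phi>) (L \<phi>))" using Ks E by (intro mult_right_mono)
    finally show ?thesis by simp
  qed
  \<comment> \<open>The compactness hypothesis indexes its functionals by natural numbers, hence an
    enumeration of the cells.\<close>
  obtain e where e: "bij_betw e {0..<card Z} Z" using ex_bij_betw_nat_finite[OF Z] by blast
  show ?thesis
  proof (intro exI[of _ "{0..<card Z}"] exI[of _ "\<lambda>k. \<eta> (e k)"] conjI ballI)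
    fix \<phi> assume \<phi>: "\<phi> \<in> D"
    have "(\<Sum>k\<in>{0..<card Z}. (ip \<phi> (\<eta> (e k)))\<^sup>2) = (\<Sum>z\<in>Z. (ip \<phi> (\<eta> z))\<^sup>2)"
      using sum.reindex_bij_betw[OF e, of "\<lambda>z. (ip \<phi> (\<eta> z))\<^sup>2"] .
    then show "ip \<phi> \<phi> \<le> (\<Sum>k\<in>{0..<card Z}. (ip \<phi> (\<eta> (e k)))\<^sup>2) + \<delta> * (ip \<phi> \<phi> + ip (L \<phi>) (L \<phi>))"
      using main[OF \<phi>] by simp
  qed (use \<eta> in auto)
qed

end

section \<open>The elliptic estimate and weak eigenfunctions\<close>

lemma integration_by_parts_lborel:
  assumes "\<phi> \<in> test_functions \<Omega>" "\<psi> \<in> test_functions \<Omega>"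
  shows "(\<integral>x. partial_deriv j \<phi> x * \<psi> x \<partial>lborel) = - (\<integral>x. \<phi> x * partial_deriv j \<psi> x \<partial>lborel)"
proof -
  have p: "partial_deriv j (\<lambda>x. \<phi> x * \<psi> x) x = partial_deriv j \<phi> x * \<psi> x + \<phi> x * partial_deriv j \<psi> x" for x
    using assms by (subst partial_deriv_mult) (auto intro: test_function_differentiable)
  have "0 = (\<integral>x. partial_deriv j \<phi> x * \<psi> x + \<phi> x * partial_deriv j \<psi> x \<partial>lborel)"
    using integral_partial_deriv_zero[OF test_function_mult[OF assms], of j] by (simp add: p)
  also have "\<dots> = (\<integral>x. partial_deriv j \<phi> x * \<psi> x \<partial>lborel) + (\<integral>x. \<phi> x * partial_deriv j \<psi> x \<partial>lborel)"
    using assms by (intro Bochner_Integration.integral_add test_function_integrable[of _ \<Omega>] test_function_mult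
        test_function_partial_deriv)
  finally show ?thesis by simp
qed

text \<open>Two integrations by parts exchange one \<partial>_i for one \<partial>_j, using that
  partial derivatives commute.\<close>

lemma integral_mixed_derivative_square:
  assumes \<phi>: "\<phi> \<in> test_functions \<Omega>"
  shows "(\<integral>x. (partial_deriv i (partial_deriv j \<phi>) x)\<^sup>2 \<partial>lborel)
    = (\<integral>x. partial_deriv i (partial_deriv i \<phi>) x * partial_deriv j (partial_deriv j \<phi>) x \<partial>lborel)"
proof -
  note D = test_function_partial_deriv
  have c: "partial_deriv i (partial_deriv j \<psi>) = partial_deriv j (partial_deriv i \<psi>)" if "\<psi> \<in> test_functions \<Omega>" for \<psi>
    using partial_deriv_commute[OF test_function_smooth[OF that]] by blast
  have "(\<integral>x. partial_deriv i (partial_deriv j \<phi>) x * partial_deriv i (partial_deriv j \<phi>) x \<partial>lborel)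
      = - (\<integral>x. partial_deriv j \<phi> x * partial_deriv i (partial_deriv i (partial_deriv j \<phi>)) x \<partial>lborel)"
    using \<phi> by (intro integration_by_parts_lborel[of _ \<Omega>] D)
  also have "partial_deriv i (partial_deriv i (partial_deriv j \<phi>)) = partial_deriv j (partial_deriv i (partial_deriv i \<phi>))"
    using c[OF \<phi>] c[OF D[OF \<phi>], of i] by simp
  also have "- (\<integral>x. partial_deriv j \<phi> x * partial_deriv j (partial_deriv i (partial_deriv i \<phi>)) x \<partial>lborel)
      = (\<integral>x. partial_deriv j (partial_deriv j \<phi>) x * partial_deriv i (partial_deriv i \<phi>) x \<partial>lborel)"
    using \<phi> by (intro integration_by_parts_lborel[of _ \<Omega>, symmetric] D)
  finally show ?thesis by (simp add: power2_eq_square mult.commute)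
qed

text \<open>The square of the Euclidean Laplacian expands into products of pure second derivatives,
  each integrating to a squared mixed derivative. Compact support leaves no boundary terms, whatever
  the shape of the domain.\<close>

lemma integral_hessian_square:
  assumes \<phi>: "\<phi> \<in> test_functions \<Omega>"
  shows "(\<Sum>i\<in>UNIV. \<Sum>j\<in>UNIV. \<integral>x. (partial_deriv i (partial_deriv j \<phi>) x)\<^sup>2 \<partial>lborel)
    = (\<integral>x. (\<Sum>i\<in>UNIV. partial_deriv i (partial_deriv i \<phi>) x)\<^sup>2 \<partial>lborel)"
proof -
  have i: "integrable lborel (\<lambda>x. partial_deriv i (partial_deriv i \<phi>) x * partial_deriv j (partial_deriv j \<phi>) x)" for i j
    using \<phi> by (intro test_function_integrable[of _ \<Omega>] test_function_mult test_function_partial_deriv)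
  have "(\<integral>x. (\<Sum>i\<in>UNIV. partial_deriv i (partial_deriv i \<phi>) x)\<^sup>2 \<partial>lborel)
      = (\<integral>x. (\<Sum>i\<in>UNIV. \<Sum>j\<in>UNIV. partial_deriv i (partial_deriv i \<phi>) x * partial_deriv j (partial_deriv j \<phi>) x) \<partial>lborel)"
    by (simp add: power2_eq_square sum_product)
  also have "\<dots> = (\<Sum>i\<in>UNIV. \<Sum>j\<in>UNIV. \<integral>x. partial_deriv i (partial_deriv i \<phi>) x * partial_deriv j (partial_deriv j \<phi>) x \<partial>lborel)"
    using i by simp
  finally show ?thesis by (simp add: integral_mixed_derivative_square[OF \<phi>])
qed

context semi_hilbert
begin

lemma conv_sum:
  assumes "finite I" "\<And>i. i \<in> I \<Longrightarrow> conv (X i) (x i)" "\<And>i m. i \<in> I \<Longrightarrow> X i m \<in> H" "\<And>i. i \<in> I \<Longrightarrow> x i \<in> H"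
  shows "conv (\<lambda>m. \<Sum>i\<in>I. X i m) (\<Sum>i\<in>I. x i)"
  using assms
proof (induction I rule: finite_induct)
  case (insert i I)
  then show ?case by (auto intro!: conv_add)
qed simp

end

context hyp_domain
begin

text \<open>(x_p)^2 times the Euclidean Laplacian equals L \<phi> - (2 - n) x_p \<partial>_p \<phi>,
  whose last term is controlled by the Dirichlet form. \<open>integral_hessian_square\<close> then
  bounds each second derivative, and the bounds on x_p convert between the two measures.\<close>

lemma second_derivative_bound:
  obtains C where "C \<ge> 0" "\<And>\<phi> i j. \<phi> \<in> D \<Longrightarrow>
    ip (partial_deriv i (partial_deriv j \<phi>)) (partial_deriv i (partial_deriv j \<phi>)) \<le> C * (ip \<phi> \<phi> + ip (L \<phi>) (L \<phi>))"
proof -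
  define n where "n = CARD('n)"
  obtain a b r where ab: "0 < a" "\<And>x. x \<in> \<Omega> \<Longrightarrow> a \<le> x $ p" "\<And>x. x \<in> \<Omega> \<Longrightarrow> x $ p \<le> b"
      "\<And>x. x \<in> \<Omega> \<Longrightarrow> norm x \<le> r"
    by (rule domain_bounds) (rule that)
  have b0: "b \<ge> 0" using domain_nonempty ab domain_pos by force
  define A where "A = (1 / a) ^ n * (b ^ n * ((1 / a)\<^sup>2 * (1 / a)\<^sup>2))"
  have A: "A \<ge> 0" using ab(1) b0 by (simp add: A_def)
  have "ip (partial_deriv i (partial_deriv j \<phi>)) (partial_deriv i (partial_deriv j \<phi>))
      \<le> A * (2 + 2 * (2 - real n)\<^sup>2) * (ip \<phi> \<phi> + ip (L \<phi>) (L \<phi>))" if \<phi>: "\<phi> \<in> D" for \<phi> i j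
  proof -
    define E where "E = ip \<phi> \<phi> + ip (L \<phi>) (L \<phi>)"
    define d where "d = (\<lambda>x. \<Sum>i\<in>UNIV. partial_deriv i (partial_deriv i \<phi>) x)"
    define g where "g = L \<phi> - (2 - real n) *\<^sub>R xm (partial_deriv p \<phi>)"
    have d: "d \<in> D" unfolding d_def using \<phi> by (intro test_function_sum D_partial)
    have g: "g \<in> D" "xm (xm d) = g"
      using \<phi> by (auto simp: g_def hyp_laplacian_def d_def n_def power2_eq_square)
    have dir: "ip (xm (partial_deriv p \<phi>)) (xm (partial_deriv p \<phi>)) \<le> E"
    proof -
      have "ip (xm (partial_deriv p \<phi>)) (xm (partial_deriv p \<phi>))
          \<le> (\<Sum>j\<in>UNIV. ip (xm (partial_deriv j \<phi>)) (xm (partial_deriv j \<phi>)))"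
        using \<phi> member_le_sum[of p UNIV "\<lambda>j. ip (xm (partial_deriv j \<phi>)) (xm (partial_deriv j \<phi>))"] by simp
      also have "\<dots> = - ip \<phi> (L \<phi>)" using dirichlet_form[OF \<phi> \<phi>] by simp
      finally show ?thesis using dirichlet_le_energy[OF \<phi>] by (simp add: E_def)
    qed
    have "ip g g \<le> 2 * ip (L \<phi>) (L \<phi>) + 2 * ip ((2 - real n) *\<^sub>R xm (partial_deriv p \<phi>)) ((2 - real n) *\<^sub>R xm (partial_deriv p \<phi>))"
      unfolding g_def using \<phi> by (intro HS.sq_diff_le L2_scale) auto
    also have "ip ((2 - real n) *\<^sub>R xm (partial_deriv p \<phi>)) ((2 - real n) *\<^sub>R xm (partial_deriv p \<phi>))
        = (2 - real n)\<^sup>2 * ip (xm (partial_deriv p \<phi>)) (xm (partial_deriv p \<phi>))"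
      using \<phi> by (simp add: L2_scale power2_eq_square)
    also have "2 * ip (L \<phi>) (L \<phi>) + 2 * ((2 - real n)\<^sup>2 * ip (xm (partial_deriv p \<phi>)) (xm (partial_deriv p \<phi>)))
        \<le> 2 * E + 2 * ((2 - real n)\<^sup>2 * E)"
      using \<phi> dir by (intro add_mono mult_left_mono) (auto simp: E_def)
    finally have gE: "ip g g \<le> (2 + 2 * (2 - real n)\<^sup>2) * E" by (simp add: algebra_simps)
    have "ip d d \<le> (1 / a)\<^sup>2 * ip (xm d) (xm d)"
      using d ab(1,2) by (intro ip_le_xm) auto
    also have "\<dots> \<le> (1 / a)\<^sup>2 * ((1 / a)\<^sup>2 * ip (xm (xm d)) (xm (xm d)))"
      using d ab(1,2) by (intro mult_left_mono ip_le_xm) auto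
    finally have dg: "ip d d \<le> (1 / a)\<^sup>2 * (1 / a)\<^sup>2 * ip g g" unfolding g(2) by simp
    have "ip (partial_deriv i (partial_deriv j \<phi>)) (partial_deriv i (partial_deriv j \<phi>))
        \<le> (1 / a) ^ n * (\<integral>x. (partial_deriv i (partial_deriv j \<phi>) x)\<^sup>2 \<partial>lborel)"
      unfolding n_def using \<phi> by (intro ip_lebesgue_bounds(1)[OF _ ab(1,2,3)]) auto
    also have "(\<integral>x. (partial_deriv i (partial_deriv j \<phi>) x)\<^sup>2 \<partial>lborel)
        \<le> (\<Sum>j\<in>UNIV. \<integral>x. (partial_deriv i (partial_deriv j \<phi>) x)\<^sup>2 \<partial>lborel)"
      by (rule member_le_sum[of j UNIV]) (auto intro!: Bochner_Integration.integral_nonneg)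
    also have "\<dots> \<le> (\<Sum>i\<in>UNIV. \<Sum>j\<in>UNIV. \<integral>x. (partial_deriv i (partial_deriv j \<phi>) x)\<^sup>2 \<partial>lborel)"
      by (rule member_le_sum[of i UNIV]) (auto intro!: sum_nonneg Bochner_Integration.integral_nonneg)
    also have "\<dots> = (\<integral>x. (d x)\<^sup>2 \<partial>lborel)" unfolding d_def by (rule integral_hessian_square[OF \<phi>])
    also have "\<dots> \<le> b ^ n * ip d d" unfolding n_def by (rule ip_lebesgue_bounds(2)[OF d ab(1,2,3)])
    also have "\<dots> \<le> b ^ n * ((1 / a)\<^sup>2 * (1 / a)\<^sup>2 * ip g g)" using b0 dg by (intro mult_left_mono) auto
    also have "\<dots> \<le> b ^ n * ((1 / a)\<^sup>2 * (1 / a)\<^sup>2 * ((2 + 2 * (2 - real n)\<^sup>2) * E))"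
      using b0 gE by (intro mult_left_mono) auto
    finally show ?thesis using ab(1) by (simp add: A_def E_def mult_left_mono mult.assoc)
  qed
  then show ?thesis using A by (intro that[of "A * (2 + 2 * (2 - real n)\<^sup>2)"]) auto
qed

lemma iter_partial_bound:
  obtains C where "C \<ge> 0" "\<And>\<phi> js. \<phi> \<in> D \<Longrightarrow> length js \<le> 2 \<Longrightarrow>
    ip (iter_partial js \<phi>) (iter_partial js \<phi>) \<le> C * (ip \<phi> \<phi> + ip (L \<phi>) (L \<phi>))"
proof -
  obtain C1 where C1: "C1 \<ge> 0" "\<And>\<phi>. \<phi> \<in> D \<Longrightarrow>
      (\<Sum>j\<in>UNIV. ip (partial_deriv j \<phi>) (partial_deriv j \<phi>)) \<le> C1 * (ip \<phi> \<phi> + ip (L \<phi>) (L \<phi>))"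
    by (rule gradient_bound) (rule that)
  obtain C2 where C2: "C2 \<ge> 0" "\<And>\<phi> i j. \<phi> \<in> D \<Longrightarrow>
      ip (partial_deriv i (partial_deriv j \<phi>)) (partial_deriv i (partial_deriv j \<phi>)) \<le> C2 * (ip \<phi> \<phi> + ip (L \<phi>) (L \<phi>))"
    by (rule second_derivative_bound) (rule that)
  have "ip (iter_partial js \<phi>) (iter_partial js \<phi>) \<le> (1 + C1 + C2) * (ip \<phi> \<phi> + ip (L \<phi>) (L \<phi>))"
    if \<phi>: "\<phi> \<in> D" and js: "length js \<le> 2" for \<phi> js
  proof -
    define E where "E = ip \<phi> \<phi> + ip (L \<phi>) (L \<phi>)"
    have E: "0 \<le> ip \<phi> \<phi>" "ip \<phi> \<phi> \<le> E" using \<phi> by (auto simp: E_def)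
    have C: "0 \<le> C1 * E" "0 \<le> C2 * E" using C1(1) C2(1) E by auto
    have split: "(1 + C1 + C2) * E = E + C1 * E + C2 * E" by (simp add: algebra_simps)
    consider "js = []" | j where "js = [j]" | i j where "js = [i, j]"
      using js by (cases js rule: list.exhaust; cases "tl js" rule: list.exhaust; cases "tl (tl js)" rule: list.exhaust) auto
    then have "ip (iter_partial js \<phi>) (iter_partial js \<phi>) \<le> (1 + C1 + C2) * E"
    proof cases
      case 1
      then show ?thesis using E C split by simp
    next
      case 2
      have "ip (partial_deriv j \<phi>) (partial_deriv j \<phi>) \<le> (\<Sum>j\<in>UNIV. ip (partial_deriv j \<phi>) (partial_deriv j \<phi>))"
        using \<phi> by (intro member_le_sum) auto
      also have "\<dots> \<le> C1 * E" using C1(2)[OF \<phi>] by (simp add: E_def)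
      finally show ?thesis using 2 E C split by simp
    next
      case 3
      then show ?thesis using C2(2)[OF \<phi>, of i j] E C split unfolding E_def[symmetric] by simp
    qed
    then show ?thesis by (simp add: E_def)
  qed
  then show ?thesis using C1(1) C2(1) by (intro that[of "1 + C1 + C2"]) auto
qed

lemma iter_partial_in_D [simp]: "\<phi> \<in> D \<Longrightarrow> iter_partial js \<phi> \<in> D"
  by (induction js) auto

lemma iter_partial_diff:
  "\<phi> \<in> D \<Longrightarrow> \<psi> \<in> D \<Longrightarrow> iter_partial js (\<phi> - \<psi>) = iter_partial js \<phi> - iter_partial js \<psi>"
  by (induction js) (auto simp: partial_deriv_diff)

section \<open>Identification with the Sobolev space and with the clamped eigenspaces\<close>

lemma L2_space_eq: "L2_space p \<Omega> = L2 M"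
  by (auto simp: L2_space_def L2_def)

lemma conv_iff: "HS.conv X x \<longleftrightarrow> (\<lambda>m. \<integral>y. (X m y - x y)\<^sup>2 \<partial>M) \<longlonglongrightarrow> 0"
  by (simp add: HS.conv_def l2_inner_def power2_eq_square)

text \<open>By the elliptic estimate, a sequence that is Cauchy in the graph norm has all
  derivatives of order at most two Cauchy in L2.\<close>

lemma graph_imp_H20:
  assumes "(u, w) \<in> HS.graph_closure"
  shows "u \<in> H20_space p \<Omega>"
proof -
  obtain \<phi> where \<phi>: "u \<in> L2 M" "w \<in> L2 M" "\<And>m. \<phi> m \<in> D" "HS.conv \<phi> u" "HS.conv (\<lambda>m. L (\<phi> m)) w"
    using assms by (rule HS.graph_closureE) (rule that)
  obtain C where C: "C \<ge> 0" "\<And>\<phi> js. \<phi> \<in> D \<Longrightarrow> length js \<le> 2 \<Longrightarrow>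
      ip (iter_partial js \<phi>) (iter_partial js \<phi>) \<le> C * (ip \<phi> \<phi> + ip (L \<phi>) (L \<phi>))"
    by (rule iter_partial_bound) (rule that)
  have "\<exists>v\<in>L2 M. HS.conv (\<lambda>m. iter_partial js (\<phi> m)) v" if js: "length js \<le> 2" for js
  proof -
    have "\<exists>N. \<forall>m\<ge>N. \<forall>n\<ge>N. ip (iter_partial js (\<phi> m) - iter_partial js (\<phi> n)) (iter_partial js (\<phi> m) - iter_partial js (\<phi> n)) < e"
      if e: "e > 0" for e
    proof -
      define e' where "e' = e / (C + 1) / 2"
      have e': "e' > 0" using e C(1) by (simp add: e'_def)
      obtain N1 where N1: "\<And>m n. m \<ge> N1 \<Longrightarrow> n \<ge> N1 \<Longrightarrow> ip (\<phi> m - \<phi> n) (\<phi> m - \<phi> n) < e'"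
        using HS.conv_imp_cauchy[OF \<phi>(4) D_L2[OF \<phi>(3)] \<phi>(1) e'] by blast
      obtain N2 where N2: "\<And>m n. m \<ge> N2 \<Longrightarrow> n \<ge> N2 \<Longrightarrow> ip (L (\<phi> m) - L (\<phi> n)) (L (\<phi> m) - L (\<phi> n)) < e'"
        using HS.conv_imp_cauchy[OF \<phi>(5) D_L2[OF L_in_D[OF \<phi>(3)]] \<phi>(2) e'] by blast
      have "ip (iter_partial js (\<phi> m) - iter_partial js (\<phi> n)) (iter_partial js (\<phi> m) - iter_partial js (\<phi> n)) < e"
        if "m \<ge> max N1 N2" "n \<ge> max N1 N2" for m n
      proof -
        have "ip (iter_partial js (\<phi> m - \<phi> n)) (iter_partial js (\<phi> m - \<phi> n))
            \<le> C * (ip (\<phi> m - \<phi> n) (\<phi> m - \<phi> n) + ip (L (\<phi> m - \<phi> n)) (L (\<phi> m - \<phi> n)))"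
          using \<phi>(3) js by (intro C(2)) auto
        also have "\<dots> \<le> C * (e' + e')"
          using less_imp_le[OF N1[of m n]] less_imp_le[OF N2[of m n]] that C(1)
          unfolding HS.L_diff[OF \<phi>(3) \<phi>(3)] by (intro mult_left_mono add_mono) auto
        also have "e' + e' = e / (C + 1)" unfolding e'_def by (rule field_sum_of_halves)
        also have "C * (e / (C + 1)) = e * (C / (C + 1))" by simp
        also have "\<dots> < e * 1" using C(1) e by (intro mult_strict_left_mono) auto
        finally show ?thesis by (simp only: iter_partial_diff[OF \<phi>(3) \<phi>(3)] mult_1_right)
      qed
      then show ?thesis by blast
    qed
    then obtain v where "v \<in> L2 M" "HS.conv (\<lambda>m. iter_partial js (\<phi> m)) v"
      by (rule HS.cauchy_imp_conv[of "\<lambda>m. iter_partial js (\<phi> m)", rotated]) (use \<phi>(3) in auto)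
    then show ?thesis by blast
  qed
  then obtain v where v: "\<And>js. length js \<le> 2 \<Longrightarrow> v js \<in> L2 M"
      "\<And>js. length js \<le> 2 \<Longrightarrow> HS.conv (\<lambda>m. iter_partial js (\<phi> m)) (v js)" by metis
  \<comment> \<open>The limit for the empty list agrees with \<open>u\<close> only up to a null
    function, whereas \<open>H20_space\<close> asks for \<open>v [] = u\<close> literally.\<close>
  define v' where "v' = v([] := u)"
  have "length js \<le> 2 \<longrightarrow> v' js \<in> L2_space p \<Omega> \<and>
      (\<lambda>m. \<integral>x. (iter_partial js (\<phi> m) x - v' js x)\<^sup>2 \<partial>M) \<longlonglongrightarrow> 0" for js
    using v[of js] \<phi>(1,4) unfolding L2_space_eq conv_iff[symmetric] v'_def by (cases js) auto
  moreover have "v' [] = u" by (simp add: v'_def)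
  ultimately show ?thesis unfolding H20_space_def using \<phi>(3) by blast
qed

text \<open>Multiplication by x_p is bounded on the domain, so L2 convergence of the derivatives
  forces convergence of \<open>L (\<phi> k)\<close>; the limit \<open>w\<close> is the Laplacian
  expressed by the weak derivatives.\<close>

lemma H20_imp_graph:
  assumes "u \<in> H20_space p \<Omega>"
  shows "\<exists>w. (u, w) \<in> HS.graph_closure"
proof -
  obtain \<phi> v where \<phi>: "\<And>m::nat. \<phi> m \<in> D" and v0: "v [] = u"
    and "\<And>js. length js \<le> 2 \<Longrightarrow> v js \<in> L2_space p \<Omega> \<and>
      (\<lambda>m. \<integral>x. (iter_partial js (\<phi> m) x - v js x)\<^sup>2 \<partial>M) \<longlonglongrightarrow> 0"
    using assms unfolding H20_space_def by blast
  then have v: "\<And>js. length js \<le> 2 \<Longrightarrow> v js \<in> L2 M"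
      "\<And>js. length js \<le> 2 \<Longrightarrow> HS.conv (\<lambda>m. iter_partial js (\<phi> m)) (v js)"
    unfolding L2_space_eq conv_iff by blast+
  obtain a b r where ab: "0 < a" "\<And>x. x \<in> \<Omega> \<Longrightarrow> a \<le> x $ p" "\<And>x. x \<in> \<Omega> \<Longrightarrow> x $ p \<le> b"
      "\<And>x. x \<in> \<Omega> \<Longrightarrow> norm x \<le> r"
    by (rule domain_bounds) (rule that)
  have m: "(\<lambda>x. x $ p) \<in> borel_measurable M" by measurable
  have bd: "\<bar>x $ p\<bar> \<le> b" if "x \<in> space M" for x using ab(3)[of x] domain_pos[of x] that by simp
  have xm_L2: "xm f \<in> L2 M" if "f \<in> L2 M" for f by (rule L2_bounded_mult(1)[OF that m bd])
  have conv_xm: "HS.conv (\<lambda>k. xm (X k)) (xm x)" if X: "HS.conv X x" "\<And>k. X k \<in> L2 M" "x \<in> L2 M" for X x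
    unfolding HS.conv_def
  proof (rule Lim_null_comparison)
    have "ip (xm (X k) - xm x) (xm (X k) - xm x) \<le> b\<^sup>2 * ip (X k - x) (X k - x)" for k
    proof -
      have "xm (X k) - xm x = xm (X k - x)" by (auto simp: right_diff_distrib)
      then show ?thesis using L2_bounded_mult(2)[OF L2_diff[OF X(2) X(3)] m bd] by simp
    qed
    moreover have "0 \<le> ip (xm (X k) - xm x) (xm (X k) - xm x)" for k
      using X by (intro HS.ip_nonneg L2_diff xm_L2)
    ultimately show "\<forall>\<^sub>F k in sequentially. norm (ip (xm (X k) - xm x) (xm (X k) - xm x)) \<le> b\<^sup>2 * ip (X k - x) (X k - x)"
      by (intro always_eventually) (simp del: HS.ip_diff_left HS.ip_diff_right)
    have "(\<lambda>k. b\<^sup>2 * ip (X k - x) (X k - x)) \<longlonglongrightarrow> b\<^sup>2 * 0"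
      using X(1) unfolding HS.conv_def by (intro tendsto_intros)
    then show "(\<lambda>k. b\<^sup>2 * ip (X k - x) (X k - x)) \<longlonglongrightarrow> 0" by simp
  qed
  define w where "w = (\<Sum>j\<in>UNIV. xm (xm (v [j, j]))) + (2 - real CARD('n)) *\<^sub>R xm (v [p])"
  have L_eq: "L (\<phi> k) = (\<Sum>j\<in>UNIV. xm (xm (iter_partial [j, j] (\<phi> k)))) + (2 - real CARD('n)) *\<^sub>R xm (iter_partial [p] (\<phi> k))" for k
    by (auto simp: hyp_laplacian_def sum_fun_apply sum_distrib_left power2_eq_square mult_ac)
  have "HS.conv (\<lambda>k. L (\<phi> k)) w"
    unfolding L_eq w_def
    by (intro HS.conv_add HS.conv_sum HS.conv_scale conv_xm v HS.H_sum HS.H_scale xm_L2 D_L2 iter_partial_in_D \<phi>) auto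
  moreover have "HS.conv \<phi> u" using v(2)[of "[]"] v0 by simp
  moreover have "w \<in> L2 M" unfolding w_def by (intro HS.H_add HS.H_sum HS.H_scale xm_L2 v) auto
  moreover have "u \<in> L2 M" using v(1)[of "[]"] v0 by simp
  ultimately show ?thesis using \<phi> by (intro exI[of _ w] HS.graph_closureI[where \<phi> = \<phi>])
qed

text \<open>Since \<open>L \<phi>\<close> is again a test function, symmetry of the closed graph
  moves one Laplacian from \<open>L (L \<phi>)\<close> onto \<open>u\<close>, turning the
  distributional equation into the bilinear form.\<close>

lemma clamped_eigenspace_eq: "clamped_eigenspace p \<Omega> \<mu> = HS.weak_eigenspace \<mu>"
proof -
  have key: "(\<integral>x. u x * L (L \<phi>) x \<partial>M) = ip w (L \<phi>)" if "(u, w) \<in> HS.graph_closure" "\<phi> \<in> D" for u w \<phi>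
    using HS.graph_symmetric[OF that(1) HS.graph_D[OF L_in_D[OF that(2)]]] by (simp add: l2_inner_def)
  show ?thesis
  proof (intro equalityI subsetI)
    fix u assume u: "u \<in> clamped_eigenspace p \<Omega> \<mu>"
    then obtain w where w: "(u, w) \<in> HS.graph_closure"
      using H20_imp_graph by (auto simp: clamped_eigenspace_def)
    then have "HS.weak_eigen \<mu> u w"
      using u key[OF w] by (auto simp: HS.weak_eigen_def clamped_eigenspace_def l2_inner_def)
    then show "u \<in> HS.weak_eigenspace \<mu>" by (auto simp: HS.weak_eigenspace_def)
  next
    fix u assume "u \<in> HS.weak_eigenspace \<mu>"
    then obtain w where w: "HS.weak_eigen \<mu> u w" by (auto simp: HS.weak_eigenspace_def)
    then have g: "(u, w) \<in> HS.graph_closure" by (simp add: HS.weak_eigen_def)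
    show "u \<in> clamped_eigenspace p \<Omega> \<mu>"
      using w graph_imp_H20[OF g] key[OF g] by (auto simp: HS.weak_eigen_def clamped_eigenspace_def l2_inner_def)
  qed
qed

lemma has_multiplicity_imp:
  assumes "has_multiplicity p \<Omega> \<mu> m"
  shows "HS.multiplicity_is \<mu> m"
proof -
  obtain e where e: "\<And>i. i < m \<Longrightarrow> e i \<in> HS.weak_eigenspace \<mu>"
      "\<And>c. (AE x in M. (\<Sum>i<m. c i * e i x) = 0) \<Longrightarrow> (\<forall>i<m. c i = 0)"
      "\<And>u. u \<in> HS.weak_eigenspace \<mu> \<Longrightarrow> \<exists>c. AE x in M. u x = (\<Sum>i<m. c i * e i x)"
    using assms unfolding has_multiplicity_def clamped_eigenspace_eq by blast
  have S: "(\<Sum>i<m. c i *\<^sub>R e i) \<in> L2 M" for c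
    using e(1) by (intro HS.H_sum HS.H_scale HS.weak_eigenspace_in_H) auto
  have Sx: "(\<Sum>i<m. c i *\<^sub>R e i) x = (\<Sum>i<m. c i * e i x)" for c x by (simp add: sum_fun_apply)
  show ?thesis
    unfolding HS.multiplicity_is_def
  proof (intro exI[of _ e] conjI allI impI ballI)
    fix i c assume i: "i < m" and "ip (\<Sum>i<m. c i *\<^sub>R e i) (\<Sum>i<m. c i *\<^sub>R e i) = 0"
    then have "AE x in M. (\<Sum>i<m. c i * e i x) = 0" using l2_inner_zero_iff[OF S, of c] by (simp add: Sx)
    with e(2) i show "c i = 0" by blast
  next
    fix u assume u: "u \<in> HS.weak_eigenspace \<mu>"
    then obtain c where c: "AE x in M. u x = (\<Sum>i<m. c i * e i x)" using e(3) by blast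
    have "AE x in M. (u - (\<Sum>i<m. c i *\<^sub>R e i)) x = 0" using c by eventually_elim (simp add: Sx)
    then show "\<exists>c. ip (u - (\<Sum>i<m. c i *\<^sub>R e i)) (u - (\<Sum>i<m. c i *\<^sub>R e i)) = 0"
      using l2_inner_zero_iff[OF L2_diff[OF HS.weak_eigenspace_in_H[OF u] S]] by blast
  qed (use e(1) in auto)
qed

lemma clamped_plate_inequality:
  fixes lam :: "nat \<Rightarrow> real" and f g :: "real \<Rightarrow> real"
  assumes ev: "clamped_plate_eigenvalues p \<Omega> lam" and gap: "lam k < lam (Suc k)"
    and fg: "(f, g) \<in> Im_class (lam (Suc k))"
  shows "(\<Sum>i=1..k. f (lam i))
    \<le> sqrt (\<Sum>i=1..k. g (lam i) * (6 * sqrt (lam i) - (real CARD('n) - 1)\<^sup>2))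
      * sqrt (\<Sum>i=1..k. (f (lam i))\<^sup>2 / (g (lam i) * (lam (Suc k) - lam i)) * (4 * sqrt (lam i) - (real CARD('n) - 1)\<^sup>2))"
proof -
  have pos: "0 < lam i" if "1 \<le> i" for i using ev that by (simp add: clamped_plate_eigenvalues_def)
  have mono: "mono_on {1..} lam" and lim: "filterlim lam at_top sequentially"
    using ev by (auto simp: clamped_plate_eigenvalues_def)
  have mult: "HS.multiplicity_is \<mu> (card {i. 1 \<le> i \<and> lam i = \<mu>})" for \<mu>
    using ev by (auto simp: clamped_plate_eigenvalues_def intro: has_multiplicity_imp)
  obtain B where "commutator_pair (L2 M) ip D L lnm drift B ((real CARD('n) - 1)\<^sup>2)"
    using commutator_pair_lnm by blast
  then interpret CP: commutator_pair "L2 M" ip D L lnm drift B "(real CARD('n) - 1)\<^sup>2" .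
  obtain u where u: "\<And>i. i \<in> {1..k} \<Longrightarrow> u i \<in> HS.weak_eigenspace (lam i)"
      "\<And>i j. i \<in> {1..k} \<Longrightarrow> j \<in> {1..k} \<Longrightarrow> ip (u i) (u j) = (if i = j then 1 else 0)"
    using HS.eigenvalue_list_orthonormal[OF mult lim, of k] by blast
  have "\<forall>i\<in>{1..k}. \<exists>w. HS.weak_eigen (lam i) (u i) w" using u(1) by (auto simp: HS.weak_eigenspace_def)
  from bchoice[OF this] obtain w where w: "\<And>i. i \<in> {1..k} \<Longrightarrow> HS.weak_eigen (lam i) (u i) (w i)" by blast
  have ray: "lam (Suc k) * ip v v \<le> ip z z"
    if v: "(v, z) \<in> HS.graph_closure" "\<And>i. i \<in> {1..k} \<Longrightarrow> ip v (u i) = 0" for v z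
  proof (rule HS.rayleigh_lower_bound[where I = "{1..k}" and l = lam and u = u and w = w])
    show "ip v' v' = 0" if "\<mu> < lam (Suc k)" "HS.weak_eigen \<mu> v' z'" "\<And>i. i \<in> {1..k} \<Longrightarrow> ip v' (u i) = 0" for \<mu> v' z'
      by (rule HS.eigenvalue_list_complete[OF mult mono u that(1) _ that(3)])
         (use that(2) in \<open>auto simp: HS.weak_eigenspace_def\<close>)
  qed (use rellich w u v in auto)
  have lt: "lam i < lam (Suc k)" if "i \<in> {1..k}" for i
    using mono_onD[OF mono, of i k] gap that by auto
  have in_I: "lam i \<in> {0<..<lam (Suc k)}" if "i \<in> {1..k}" for i using pos lt that by auto
  have fg_pos: "0 < f x" "0 < g x" if "x \<in> {0<..<lam (Suc k)}" for x
    using fg that by (auto simp: Im_class_def)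
  \<comment> \<open>The defining inequality multiplied by (x - y)^2. In this form it also holds for
    x = y, which is needed because eigenvalues may be repeated.\<close>
  have couple: "(f x - f y)\<^sup>2 + ((f x)\<^sup>2 / (g x * (lam (Suc k) - x)) + (f y)\<^sup>2 / (g y * (lam (Suc k) - y))) * ((g x - g y) * (x - y)) \<le> 0"
    if x: "x \<in> {0<..<lam (Suc k)}" and y: "y \<in> {0<..<lam (Suc k)}" for x y
  proof (cases "x = y")
    case False
    define h where "h = (f x)\<^sup>2 / (g x * (lam (Suc k) - x)) + (f y)\<^sup>2 / (g y * (lam (Suc k) - y))"
    have "((f x - f y) / (x - y))\<^sup>2 + h * ((g x - g y) / (x - y)) \<le> 0"
      using fg x y False by (auto simp: Im_class_def h_def)
    then have "(x - y)\<^sup>2 * (((f x - f y) / (x - y))\<^sup>2 + h * ((g x - g y) / (x - y))) \<le> 0"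
      by (simp add: mult_nonneg_nonpos)
    also have "(x - y)\<^sup>2 * (((f x - f y) / (x - y))\<^sup>2 + h * ((g x - g y) / (x - y)))
        = (f x - f y)\<^sup>2 + h * ((g x - g y) * (x - y))"
      using False by (simp add: distrib_left power_divide) (simp add: power2_eq_square)
    finally show ?thesis by (simp add: h_def)
  qed simp
  show ?thesis
    by (rule CP.clamped_commutator_inequality[where u = u and w = w])
       (use w u ray lt fg_pos in_I couple in auto)
qed

end

theorem theorem4p1:
  fixes p :: "'n::finite" and \<Omega> :: "(real ^ 'n) set"
    and lam :: "nat \<Rightarrow> real" and k :: nat and f g :: "real \<Rightarrow> real"
  assumes "bounded_hyp_domain p \<Omega>"
    and "clamped_plate_eigenvalues p \<Omega> lam"
    and "k \<ge> 1"
    and "lam (k + 1) > lam k"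
    and "(f, g) \<in> Im_class (lam (k + 1))"
  shows "(\<Sum>i=1..k. f (lam i))
    \<le> sqrt (\<Sum>i=1..k. g (lam i) * (6 * sqrt (lam i) - (real CARD('n) - 1)\<^sup>2))
      * sqrt (\<Sum>i=1..k. (f (lam i))\<^sup>2 / (g (lam i) * (lam (k + 1) - lam i))
                           * (4 * sqrt (lam i) - (real CARD('n) - 1)\<^sup>2))"
proof -
  interpret hyp_domain p \<Omega> using assms(1) by unfold_locales
  show ?thesis using clamped_plate_inequality[of lam k f g] assms by simp
qed

end
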